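(* Let $n\ge 4$ and let $X$ be a finite Abelian covering of $P_{2n}$, that is, $X\to P_{2n}$ is an unramified finite Galois covering and $\mathrm{Gal}(X/P_{2n})$ is an Abelian group. Then the Reidemeister–Schreier calculation of the Veech group $\Gamma(X)$ described in the context stops (after finitely many steps).
   Context: Flat structures and Veech groups. Let $\varphi$ be a holomorphic quadratic differential with $\iint|\varphi|<\infty$ on a Riemann surface $Y$ and let $Y'$ be $Y$ minus the zeros of $\varphi$. The local functions $z(p)=\int_{p_0}^p\sqrt{\varphi}$ form an atlas of $Y'$ whose transition maps have the form $w=\pm z+c$; the maximal such atlas is the flat structure $u_\varphi$. $\mathrm{Aff}^+(Y,\varphi)$ is the group of all quasiconformal (in particular orientation-preserving) self-homeomorphisms $f$ of $Y$ with $f(Y')=Y'$ that are of the form $z\mapsto Az+c$ in the charts of $u_\varphi$; then $A\in\mathrm{SL}(2,\mathbb R)$ is determined up to sign, and $D(f)=[A]\in \mathrm{PSL}(2,\mathbb R)$. The Veech group is $\Gamma(Y,\varphi)=D(\mathrm{Aff}^+(Y,\varphi))$. The surface $P_{2n}$. Fix $n\ge 4$. Let $\Pi_{2n}$ be a regular $2n$-gon in the plane with sides of length $1$, with two horizontal sides, and with its vertices removed. Gluing each side to the opposite parallel side by a Euclidean translation gives a Riemann surface $P_{2n}$ on which $dz^2$ extends to a holomorphic quadratic differential $\varphi_{2n}$ (the vertices are punctures). For an unramified finite covering $p:X\to P_{2n}$ put $\varphi_X=p^*\varphi_{2n}$ and $\Gamma(X)=\Gamma(X,\varphi_X)$. Put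 $$R_{2n}=\begin{pmatrix}\cos\frac{\pi}{n}&-\sin\frac{\pi}{n}\\ \sin\frac{\pi}{n}&\cos\frac{\pi}{n}\end{pmatrix},\qquad T_{2n}=\begin{pmatrix}1&2\cot\frac{\pi}{2n}\\0&1\end{pmatrix}.$$ It is known that $\Gamma(X)$ is a subgroup of $\langle [R_{2n}],[T_{2n}]\rangle\subset \mathrm{PSL}(2,\mathbb R)$. The calculation. Maintain two ordered lists $\mathbf{Rep}$ and $\mathbf{Gen}$ of elements of $\langle [R_{2n}],[T_{2n}]\rangle$, initially empty. Add $[I]$ to $\mathbf{Rep}$ and set $A=I$. Loop: set $B=A\cdot T_{2n}$ and $C=A\cdot R_{2n}$. For each $[D]$ in $\mathbf{Rep}$, check whether $[B][D]^{-1}\in\Gamma(X)$; if so, add $[B][D]^{-1}$ to $\mathbf{Gen}$. If no such $[D]$ is found, add $[B]$ at the end of $\mathbf{Rep}$. Then do the same with $C$ in place of $B$ (using the updated $\mathbf{Rep}$). If there is a successor of $A$ in $\mathbf{Rep}$ (an element coming immediately after $[A]$ in the list), let $A$ be this successor and go back to the beginning of the loop; if not, the calculation stops. *)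

theory Defs
  imports
    "HOL-Complex_Analysis.Complex_Analysis"
    "HOL-Algebra.Coset"
    "HOL-Algebra.Bij"
    "HOL-Library.While_Combinator"
begin

section \<open>Riemann surfaces\<close>

text \<open>A chart is a pair \<open>(U, z)\<close> of an open set and a coordinate function; the values of \<open>z\<close>
  outside \<open>U\<close> are irrelevant. The local inverse of \<open>z\<close> is \<open>inv_into U z\<close>.\<close>

type_synonym 'a chart = "'a set \<times> ('a \<Rightarrow> complex)"

record 'a surface =
  surface_topology :: "'a topology"
  atlas :: "'a chart set"

abbreviation points :: "'a surface \<Rightarrow> 'a set" where
  "points Y \<equiv> topspace (surface_topology Y)"

definition coordinate_on :: "'a topology \<Rightarrow> 'a set \<Rightarrow> ('a \<Rightarrow> complex) \<Rightarrow> bool" where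
  "coordinate_on T U z \<longleftrightarrow>
     openin T U \<and> open (z ` U) \<and>
     homeomorphic_map (subtopology T U) (top_of_set (z ` U)) z"

definition riemann_surface :: "'a surface \<Rightarrow> bool" where
  "riemann_surface Y \<longleftrightarrow>
     points Y \<noteq> {} \<and> connected_space (surface_topology Y) \<and> Hausdorff_space (surface_topology Y) \<and>
     (\<forall>(U, z) \<in> atlas Y. coordinate_on (surface_topology Y) U z) \<and>
     \<Union> (fst ` atlas Y) = points Y \<and>
     (\<forall>(U, z) \<in> atlas Y. \<forall>(V, w) \<in> atlas Y.
        (w \<circ> inv_into U z) holomorphic_on z ` (U \<inter> V))"

definition holomorphic_map :: "'a surface \<Rightarrow> 'b surface \<Rightarrow> ('a \<Rightarrow> 'b) \<Rightarrow> bool" where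
  "holomorphic_map X Y f \<longleftrightarrow>
     continuous_map (surface_topology X) (surface_topology Y) f \<and>
     (\<forall>(U, z) \<in> atlas X. \<forall>(V, w) \<in> atlas Y.
        (w \<circ> f \<circ> inv_into U z) holomorphic_on z ` {x \<in> U. f x \<in> V})"


section \<open>Quasiconformal homeomorphisms\<close>

definition orientation_preserving_at :: "(complex \<Rightarrow> complex) \<Rightarrow> complex \<Rightarrow> bool" where
  "orientation_preserving_at g a \<longleftrightarrow>
     (\<forall>\<^sub>F r in at_right 0. winding_number (g \<circ> circlepath a r) (g a) = 1)"

text \<open>The metric definition: the linear dilatation
  \<open>limsup\<^bsub>r \<rightarrow> 0\<^esub> (max\<^bsub>|y - a| = r\<^esub> |g y - g a|) / (min\<^bsub>|y - a| = r\<^esub> |g y - g a|)\<close> of the coordinate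
  expressions \<open>g\<close> of \<open>f\<close> is bounded by a constant independent of the point. Whether there is a uniform
  bound does not change if the upper limit is replaced by the values for all small \<open>r\<close>.\<close>

definition dilatation_bounded_at :: "real \<Rightarrow> (complex \<Rightarrow> complex) \<Rightarrow> complex \<Rightarrow> bool" where
  "dilatation_bounded_at K g a \<longleftrightarrow>
     (\<forall>\<^sub>F r in at_right 0. \<forall>y \<in> sphere a r. \<forall>y' \<in> sphere a r.
        dist (g y) (g a) \<le> K * dist (g y') (g a))"

definition quasiconformal_homeo :: "'a surface \<Rightarrow> ('a \<Rightarrow> 'a) \<Rightarrow> bool" where
  "quasiconformal_homeo Y f \<longleftrightarrow>
     homeomorphic_map (surface_topology Y) (surface_topology Y) f \<and>
     (\<exists>K. \<forall>(U, z) \<in> atlas Y. \<forall>(V, w) \<in> atlas Y. \<forall>x \<in> U. f x \<in> V \<longrightarrow>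
        orientation_preserving_at (w \<circ> f \<circ> inv_into U z) (z x) \<and>
        dilatation_bounded_at K (w \<circ> f \<circ> inv_into U z) (z x))"


section \<open>Quadratic differentials and their flat structures\<close>

text \<open>A quadratic differential is given by its coefficients: \<open>q (U, z) x\<close> is the value at the point
  \<open>x \<in> U\<close> of the function \<open>h\<close> with \<open>q = h dz\<^sup>2\<close> in the chart \<open>(U, z)\<close>.\<close>

type_synonym 'a qdiff = "'a chart \<Rightarrow> 'a \<Rightarrow> complex"

text \<open>The holomorphic quadratic differentials on \<open>Y\<close>; the notions below are meant for these.\<close>

definition holomorphic_qdiff :: "'a surface \<Rightarrow> 'a qdiff \<Rightarrow> bool" where
  "holomorphic_qdiff Y q \<longleftrightarrow>
     (\<forall>(U, z) \<in> atlas Y. (q (U, z) \<circ> inv_into U z) holomorphic_on z ` U) \<and>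
     (\<forall>(U, z) \<in> atlas Y. \<forall>(V, w) \<in> atlas Y. \<forall>x \<in> U \<inter> V.
        q (U, z) x = q (V, w) x * (deriv (w \<circ> inv_into U z) (z x))\<^sup>2)"

text \<open>The pullback \<open>p\<^sup>* q\<close>. By the transformation rule it does not depend on the chart that is
  chosen around \<open>p x\<close>.\<close>

definition pullback_qdiff :: "'b surface \<Rightarrow> ('a \<Rightarrow> 'b) \<Rightarrow> 'b qdiff \<Rightarrow> 'a qdiff" where
  "pullback_qdiff Y p q = (\<lambda>(U, z) x.
     let (V, w) = (SOME c. c \<in> atlas Y \<and> p x \<in> fst c)
     in q (V, w) (p x) * (deriv (w \<circ> p \<circ> inv_into U z) (z x))\<^sup>2)"

definition nonzero_points :: "'a surface \<Rightarrow> 'a qdiff \<Rightarrow> 'a set" where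
  "nonzero_points Y q = {x \<in> points Y. \<forall>c \<in> atlas Y. x \<in> fst c \<longrightarrow> q c x \<noteq> 0}"

text \<open>The maximal atlas of local functions \<open>w = \<integral>\<surd>q\<close>, i.e. of the local coordinates with
  \<open>dw\<^sup>2 = q\<close>.\<close>

definition flat_structure :: "'a surface \<Rightarrow> 'a qdiff \<Rightarrow> 'a chart set" where
  "flat_structure Y q =
     {(V, w). coordinate_on (surface_topology Y) V w \<and> V \<subseteq> nonzero_points Y q \<and>
        (\<forall>(U, z) \<in> atlas Y. \<forall>x \<in> U \<inter> V.
           \<exists>d. ((w \<circ> inv_into U z) has_field_derivative d) (at (z x)) \<and> d\<^sup>2 = q (U, z) x)}"


section \<open>The groups SL(2,R) and PSL(2,R)\<close>

definition SL2R :: "(real^2^2) monoid" where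
  "SL2R = \<lparr>carrier = {A. det A = 1}, monoid.mult = (**), one = mat 1\<rparr>"

definition PSL2R :: "(real^2^2) set monoid" where
  "PSL2R = SL2R Mod {mat 1, - mat 1}"

definition psl_class :: "real^2^2 \<Rightarrow> (real^2^2) set" where
  "psl_class A = {mat 1, - mat 1} #>\<^bsub>SL2R\<^esub> A"


section \<open>Affine homeomorphisms and Veech groups\<close>

definition matrix_act :: "real^2^2 \<Rightarrow> complex \<Rightarrow> complex" where
  "matrix_act A z = Complex (A$1$1 * Re z + A$1$2 * Im z) (A$2$1 * Re z + A$2$2 * Im z)"

text \<open>\<open>f\<close> has the form \<open>\<zeta> \<mapsto> \<plusminus> A \<zeta> + c\<close> in the flat charts; the sign and \<open>c\<close> are only locally
  constant.\<close>

definition affine_with_derivative ::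
    "'a surface \<Rightarrow> 'a qdiff \<Rightarrow> ('a \<Rightarrow> 'a) \<Rightarrow> real^2^2 \<Rightarrow> bool" where
  "affine_with_derivative Y q f A \<longleftrightarrow>
     (\<forall>(U, z) \<in> flat_structure Y q. \<forall>(V, w) \<in> flat_structure Y q. \<forall>x \<in> U. f x \<in> V \<longrightarrow>
        (\<exists>W s c. openin (surface_topology Y) W \<and> x \<in> W \<and> W \<subseteq> {y \<in> U. f y \<in> V} \<and> s \<in> {1, -1} \<and>
           (\<forall>y \<in> W. w (f y) = s * matrix_act A (z y) + c)))"

definition affine_homeos :: "'a surface \<Rightarrow> 'a qdiff \<Rightarrow> ('a \<Rightarrow> 'a) set" where
  "affine_homeos Y q =
     {f. quasiconformal_homeo Y f \<and> f ` nonzero_points Y q = nonzero_points Y q \<and>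
         (\<exists>A. affine_with_derivative Y q f A)}"

definition veech_group :: "'a surface \<Rightarrow> 'a qdiff \<Rightarrow> (real^2^2) set set" where
  "veech_group Y q =
     {psl_class A | A. A \<in> carrier SL2R \<and>
        (\<exists>f \<in> affine_homeos Y q. affine_with_derivative Y q f A)}"


section \<open>The surface obtained from the regular 2n-gon\<close>

text \<open>The polygon is centred at 0 and has circumradius \<open>1 / (2 sin (\<pi>/2n))\<close>, hence sides of length 1.
  The side from vertex \<open>0\<close> to vertex \<open>2n - 1\<close> is the horizontal one at the bottom. The vertices are
  indexed by all natural numbers, with period \<open>2n\<close>.\<close>

definition vertex :: "nat \<Rightarrow> nat \<Rightarrow> complex" where
  "vertex n k =
     complex_of_real (1 / (2 * sin (pi / (2 * real n)))) *
     cis (- pi / 2 + (2 * real k + 1) * pi / (2 * real n))"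

definition punctured_polygon :: "nat \<Rightarrow> complex set" where
  "punctured_polygon n = convex hull (range (vertex n)) - range (vertex n)"

text \<open>The translation by \<open>vertex n (k + n + 1) - vertex n k\<close> carries the \<open>k\<close>-th side to the opposite
  one.\<close>

definition gluing :: "nat \<Rightarrow> (complex \<times> complex) set" where
  "gluing n = Id_on (punctured_polygon n) \<union>
     {(z, z + (vertex n (k + n + 1) - vertex n k)) | z k.
        z \<in> open_segment (vertex n k) (vertex n (Suc k))}"

definition quotient_topology :: "'a topology \<Rightarrow> ('a \<Rightarrow> 'b) \<Rightarrow> 'b topology" where
  "quotient_topology T f =
     topology (\<lambda>V. V \<subseteq> f ` topspace T \<and> openin T {x \<in> topspace T. f x \<in> V})"

lemma openin_quotient_topology:
  "openin (quotient_topology T f) V \<longleftrightarrow>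
     V \<subseteq> f ` topspace T \<and> openin T {x \<in> topspace T. f x \<in> V}"
proof -
  have "istopology (\<lambda>V. V \<subseteq> f ` topspace T \<and> openin T {x \<in> topspace T. f x \<in> V})"
    unfolding istopology_def
  proof (intro conjI allI impI)
    fix S S'
    assume "S \<subseteq> f ` topspace T \<and> openin T {x \<in> topspace T. f x \<in> S}"
      and "S' \<subseteq> f ` topspace T \<and> openin T {x \<in> topspace T. f x \<in> S'}"
    moreover have "{x \<in> topspace T. f x \<in> S \<inter> S'} =
        {x \<in> topspace T. f x \<in> S} \<inter> {x \<in> topspace T. f x \<in> S'}" by auto
    ultimately show "S \<inter> S' \<subseteq> f ` topspace T" "openin T {x \<in> topspace T. f x \<in> S \<inter> S'}"
      by auto
  next
    fix \<K>
    assume *: "\<forall>K \<in> \<K>. K \<subseteq> f ` topspace T \<and> openin T {x \<in> topspace T. f x \<in> K}"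
    then show "\<Union> \<K> \<subseteq> f ` topspace T" by auto
    have "{x \<in> topspace T. f x \<in> \<Union> \<K>} = (\<Union>K \<in> \<K>. {x \<in> topspace T. f x \<in> K})" by auto
    with * show "openin T {x \<in> topspace T. f x \<in> \<Union> \<K>}" by auto
  qed
  then show ?thesis
    unfolding quotient_topology_def by (simp add: topology_inverse')
qed

lemma topspace_quotient_topology: "topspace (quotient_topology T f) = f ` topspace T"
proof
  show "topspace (quotient_topology T f) \<subseteq> f ` topspace T"
    by (meson openin_quotient_topology openin_topspace)
  have "{x \<in> topspace T. f x \<in> f ` topspace T} = topspace T" by auto
  then have "openin (quotient_topology T f) (f ` topspace T)"
    by (simp add: openin_quotient_topology)
  then show "f ` topspace T \<subseteq> topspace (quotient_topology T f)"
    by (rule openin_subset)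
qed

lemma quotient_map_quotient_topology: "quotient_map T (quotient_topology T f) f"
  unfolding quotient_map_def topspace_quotient_topology openin_quotient_topology by auto

definition glue_class :: "nat \<Rightarrow> complex \<Rightarrow> complex set" where
  "glue_class n z = gluing n `` {z}"

definition polygon_topology :: "nat \<Rightarrow> complex set topology" where
  "polygon_topology n = quotient_topology (top_of_set (punctured_polygon n)) (glue_class n)"

text \<open>The charts are the local coordinates that, lifted to the polygon, differ from the coordinate
  \<open>z\<close> of the plane by locally constant functions (at a point on a side, the two constants belonging to
  the two identified sides differ by the gluing translation, because a coordinate is well defined
  and continuous on the quotient).\<close>

definition polygon_surface :: "nat \<Rightarrow> complex set surface" where
  "polygon_surface n =
     \<lparr>surface_topology = polygon_topology n,
      atlas = {(U, w). coordinate_on (polygon_topology n) U w \<and>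
        (\<forall>a \<in> punctured_polygon n. glue_class n a \<in> U \<longrightarrow>
           (\<forall>\<^sub>F z in at a within punctured_polygon n.
              w (glue_class n z) - z = w (glue_class n a) - a))}\<rparr>"

text \<open>The differential \<open>dz\<^sup>2\<close>: all charts of the atlas above are translates of \<open>z\<close>.\<close>

definition polygon_qdiff :: "complex set qdiff" where
  "polygon_qdiff = (\<lambda>c x. 1)"


section \<open>Finite Abelian coverings\<close>

text \<open>The counterpart of \<^const>\<open>covering_space\<close> for abstract topologies.\<close>

definition covering_map :: "'a topology \<Rightarrow> 'b topology \<Rightarrow> ('a \<Rightarrow> 'b) \<Rightarrow> bool" where
  "covering_map X Y p \<longleftrightarrow>
     continuous_map X Y p \<and> p ` topspace X = topspace Y \<and>
     (\<forall>y \<in> topspace Y. \<exists>V. y \<in> V \<and> openin Y V \<and>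
        (\<exists>\<U>. \<Union>\<U> = {x \<in> topspace X. p x \<in> V} \<and> (\<forall>U \<in> \<U>. openin X U) \<and>
              pairwise disjnt \<U> \<and>
              (\<forall>U \<in> \<U>. homeomorphic_map (subtopology X U) (subtopology Y V) p)))"

definition finite_unramified_covering :: "'a surface \<Rightarrow> 'b surface \<Rightarrow> ('a \<Rightarrow> 'b) \<Rightarrow> bool" where
  "finite_unramified_covering X Y p \<longleftrightarrow>
     holomorphic_map X Y p \<and> covering_map (surface_topology X) (surface_topology Y) p \<and>
     (\<forall>y \<in> points Y. finite {x \<in> points X. p x = y})"

definition Gal :: "'a surface \<Rightarrow> ('a \<Rightarrow> 'b) \<Rightarrow> ('a \<Rightarrow> 'a) monoid" where
  "Gal X p = (BijGroup (points X))
     \<lparr>carrier := {g \<in> Bij (points X).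
        holomorphic_map X X g \<and> holomorphic_map X X (inv_into (points X) g) \<and>
        (\<forall>x \<in> points X. p (g x) = p x)}\<rparr>"

definition galois_covering :: "'a surface \<Rightarrow> ('a \<Rightarrow> 'b) \<Rightarrow> bool" where
  "galois_covering X p \<longleftrightarrow>
     (\<forall>x \<in> points X. \<forall>x' \<in> points X. p x = p x' \<longrightarrow> (\<exists>g \<in> carrier (Gal X p). g x = x'))"

definition finite_abelian_covering :: "'a surface \<Rightarrow> 'b surface \<Rightarrow> ('a \<Rightarrow> 'b) \<Rightarrow> bool" where
  "finite_abelian_covering X Y p \<longleftrightarrow>
     riemann_surface X \<and> finite_unramified_covering X Y p \<and> galois_covering X p \<and>
     comm_group (Gal X p)"


section \<open>The Reidemeister-Schreier calculation\<close>

definition rotation_matrix :: "nat \<Rightarrow> real^2^2" where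
  "rotation_matrix n =
     vector [vector [cos (pi / real n), - sin (pi / real n)],
             vector [sin (pi / real n), cos (pi / real n)]]"

definition shear_matrix :: "nat \<Rightarrow> real^2^2" where
  "shear_matrix n = vector [vector [1, 2 * cot (pi / (2 * real n))], vector [0, 1]]"

text \<open>The current element \<open>A\<close> becomes \<^const>\<open>None\<close> when the calculation has stopped.\<close>

record rs_state =
  Rep :: "(real^2^2) set list"
  Gen :: "(real^2^2) set list"
  cur :: "(real^2^2) set option"

definition rs_check :: "(real^2^2) set set \<Rightarrow> (real^2^2) set \<Rightarrow> rs_state \<Rightarrow> rs_state" where
  "rs_check \<Gamma> B s =
     (let Ds = filter (\<lambda>D. B \<otimes>\<^bsub>PSL2R\<^esub> inv\<^bsub>PSL2R\<^esub> D \<in> \<Gamma>) (Rep s)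
      in if Ds = [] then s\<lparr>Rep := Rep s @ [B]\<rparr>
         else s\<lparr>Gen := Gen s @ map (\<lambda>D. B \<otimes>\<^bsub>PSL2R\<^esub> inv\<^bsub>PSL2R\<^esub> D) Ds\<rparr>)"

fun successor :: "'a \<Rightarrow> 'a list \<Rightarrow> 'a option" where
  "successor a (x # y # zs) = (if x = a then Some y else successor a (y # zs))"
| "successor a _ = None"

definition rs_loop :: "nat \<Rightarrow> (real^2^2) set set \<Rightarrow> rs_state \<Rightarrow> rs_state" where
  "rs_loop n \<Gamma> s =
     (let A = the (cur s);
          B = A \<otimes>\<^bsub>PSL2R\<^esub> psl_class (shear_matrix n);
          C = A \<otimes>\<^bsub>PSL2R\<^esub> psl_class (rotation_matrix n);
          s' = rs_check \<Gamma> C (rs_check \<Gamma> B s)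
      in s'\<lparr>cur := successor A (Rep s')\<rparr>)"

definition rs_calculation :: "nat \<Rightarrow> (real^2^2) set set \<Rightarrow> rs_state option" where
  "rs_calculation n \<Gamma> =
     while_option (\<lambda>s. cur s \<noteq> None) (rs_loop n \<Gamma>)
       \<lparr>Rep = [psl_class (mat 1)], Gen = [], cur = Some (psl_class (mat 1))\<rparr>"

definition rs_stops :: "nat \<Rightarrow> (real^2^2) set set \<Rightarrow> bool" where
  "rs_stops n \<Gamma> \<longleftrightarrow> (\<exists>s. rs_calculation n \<Gamma> = Some s)"

end

theory Submission
  imports Defs
begin

text \<open>Let \<open>\<alpha>\<^sub>A\<close> be an affine automorphism of \<open>P\<^sub>2\<^sub>n\<close> with derivative \<open>A\<close>; such automorphisms exist for \<open>R\<^sub>2\<^sub>n\<close>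
  (rotation of the polygon) and \<open>T\<^sub>2\<^sub>n\<close> (a simultaneous Dehn twist in the horizontal cylinders), hence
  for all words in them. All the maps \<open>\<alpha>\<^sub>A\<^sup>-\<^sup>1 \<circ> p\<close> are coverings of \<open>P\<^sub>2\<^sub>n\<close> with the same group of deck
  transformations as \<open>p\<close>. Since the punctured polygon is convex, it lifts to \<open>X\<close>, and such a covering is
  determined up to isomorphism by the deck transformations that relate the lifts of opposite sides.
  There are finitely many possibilities for these. If they agree for \<open>A\<close> and \<open>B\<close>, then
  \<open>\<alpha>\<^sub>B \<circ> \<alpha>\<^sub>A\<^sup>-\<^sup>1\<close> lifts to \<open>X\<close>, so \<open>[B][A]\<^sup>-\<^sup>1\<close> is in the Veech group of \<open>X\<close>. Hence the number of
  representatives that the calculation finds is bounded.\<close>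

section \<open>PSL(2,R) and the calculation\<close>

text \<open>The calculation tests only membership of \<open>[B][D]^-1\<close> in the Veech group, so
  it suffices to colour the classes it can reach with finitely many colours such that equal colours
  give membership. The colour is the tuple of deck transformations on the \<open>2 * n\<close>
  sides, taken for one chosen matrix, automorphism and lift per class. Convexity of the polygon
  stands in for simple connectivity: two coverings are compared by a map prescribed on the
  translates of one lifted polygon. A homeomorphic lift alone is not enough, since elements of the
  Veech group are quasiconformal in the conformal charts of \<open>X\<close>. There a lift has a
  real derivative of the form \<open>v \<mapsto> d * A (c * v)\<close> with complex \<open>c\<close>
  and \<open>d\<close>, and this form yields a dilatation bound that depends on \<open>A\<close>
  alone. On the polygon, the constant \<open>2 * cot (pi / (2 * n))\<close> is what shears every
  horizontal strip by exactly two tiles from its bottom to its top. For this reason the pieces of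
  the sheared polygon fit together both along the sides and at the heights of the vertices.\<close>

lemma matrix_mul_uminus_left: "(- A) ** B = - (A ** (B::real^'n^'m))"
  by (simp add: matrix_matrix_mult_def vec_eq_iff sum_negf)

lemma matrix_mul_uminus_right: "A ** (- B) = - (A ** (B::real^'n^'m))"
  by (simp add: matrix_matrix_mult_def vec_eq_iff sum_negf)

lemma group_SL2R: "group SL2R"
proof (rule groupI)
  fix A assume A: "A \<in> carrier SL2R"
  then have "invertible A" by (simp add: SL2R_def invertible_det_nz)
  then obtain B where B: "A ** B = mat 1" "B ** A = mat 1" by (auto simp: invertible_def)
  with A have "det B = 1" using det_mul[of A B] by (simp add: SL2R_def)
  with B show "\<exists>B\<in>carrier SL2R. B \<otimes>\<^bsub>SL2R\<^esub> A = \<one>\<^bsub>SL2R\<^esub>"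
    by (auto simp: SL2R_def)
qed (auto simp: SL2R_def det_mul matrix_mul_assoc)

lemma det_uminus_2: "det (- A) = det (A::real^2^2)"
  by (simp add: det_2)

lemma normal_SL2R: "normal {mat 1, - mat 1} SL2R"
proof -
  interpret group SL2R by (rule group_SL2R)
  have sub: "subgroup {mat 1, - mat 1} SL2R"
  proof (rule subgroupI)
    fix A assume "A \<in> {mat 1, - mat 1 :: real^2^2}"
    then have "A \<otimes>\<^bsub>SL2R\<^esub> A = \<one>\<^bsub>SL2R\<^esub>" "A \<in> carrier SL2R"
      by (auto simp: SL2R_def det_uminus_2 matrix_mul_uminus_left matrix_mul_uminus_right)
    then have "inv\<^bsub>SL2R\<^esub> A = A" by (simp add: inv_equality)
    with \<open>A \<in> {mat 1, - mat 1}\<close> show "inv\<^bsub>SL2R\<^esub> A \<in> {mat 1, - mat 1}" by simp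
  qed (auto simp: SL2R_def det_uminus_2 matrix_mul_uminus_left matrix_mul_uminus_right)
  then show ?thesis
    by (rule normalI) (auto simp: SL2R_def r_coset_def l_coset_def
        matrix_mul_uminus_left matrix_mul_uminus_right)
qed

lemma group_PSL2R: "group PSL2R"
  unfolding PSL2R_def by (rule normal.factorgroup_is_group[OF normal_SL2R])

lemma psl_class_in_carrier:
  assumes "det A = 1" shows "psl_class A \<in> carrier PSL2R"
  using assms by (auto simp: psl_class_def PSL2R_def FactGroup_def RCOSETS_def SL2R_def)

lemma psl_class_mult:
  assumes "det A = 1" "det B = 1"
  shows "psl_class A \<otimes>\<^bsub>PSL2R\<^esub> psl_class B = psl_class (A ** B)"
  using normal.rcos_sum[OF normal_SL2R, of A B] assms
  by (simp add: psl_class_def PSL2R_def FactGroup_def SL2R_def)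

lemma psl_class_one: "\<one>\<^bsub>PSL2R\<^esub> = psl_class (mat 1)"
  by (auto simp: psl_class_def PSL2R_def FactGroup_def r_coset_def SL2R_def)

lemma psl_class_inv:
  assumes "det A = 1" "det B = 1" "A ** B = mat 1"
  shows "inv\<^bsub>PSL2R\<^esub> (psl_class A) = psl_class B"
proof -
  interpret group PSL2R by (rule group_PSL2R)
  have "psl_class B \<otimes>\<^bsub>PSL2R\<^esub> psl_class A = \<one>\<^bsub>PSL2R\<^esub>"
    using assms matrix_left_right_inverse[of A B] by (simp add: psl_class_mult psl_class_one)
  then show ?thesis using assms by (simp add: inv_equality psl_class_in_carrier)
qed

section \<open>Progress of the loop along its list\<close>

fun list_index :: "'a \<Rightarrow> 'a list \<Rightarrow> nat" where
  "list_index a [] = 0"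
| "list_index a (x # xs) = (if x = a then 0 else Suc (list_index a xs))"

lemma list_index_less: "a \<in> set xs \<Longrightarrow> list_index a xs < length xs"
  by (induction xs) auto

lemma list_index_append: "a \<in> set xs \<Longrightarrow> list_index a (xs @ ys) = list_index a xs"
  by (induction xs) auto

text \<open>Distinctness makes the first occurrence of \<open>b\<close> the entry right after
  \<open>a\<close>, so that moving to the successor raises the position by exactly one.\<close>

lemma successor_Some:
  "\<lbrakk>successor a xs = Some b; distinct xs\<rbrakk>
     \<Longrightarrow> b \<in> set xs \<and> list_index b xs = Suc (list_index a xs)"
  by (induction a xs rule: successor.induct) (auto split: if_splits)

text \<open>The representatives have distinct colours, so the list of representatives is bounded, while
  the position of the current element increases.\<close>

lemma rs_stops_if_finitely_coloured:
  fixes F :: "(real^2^2) set \<Rightarrow> 'c"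
  assumes one: "psl_class (mat 1) \<in> M"
    and step: "\<And>A. A \<in> M \<Longrightarrow> A \<otimes>\<^bsub>PSL2R\<^esub> psl_class (shear_matrix n) \<in> M"
      "\<And>A. A \<in> M \<Longrightarrow> A \<otimes>\<^bsub>PSL2R\<^esub> psl_class (rotation_matrix n) \<in> M"
    and fin: "finite (F ` M)"
    and F: "\<And>A B. \<lbrakk>A \<in> M; B \<in> M; F A = F B\<rbrakk> \<Longrightarrow> B \<otimes>\<^bsub>PSL2R\<^esub> inv\<^bsub>PSL2R\<^esub> A \<in> \<Gamma>"
  shows "rs_stops n \<Gamma>"
proof -
  define I where "I s \<longleftrightarrow> set (Rep s) \<subseteq> M \<and> distinct (Rep s) \<and> inj_on F (set (Rep s)) \<and>
      (\<forall>A. cur s = Some A \<longrightarrow> A \<in> set (Rep s))" for s :: rs_state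
  \<comment> \<open>While there is a current element, its position is below the length of the list
    and hence below the number of colours, so the truncated difference stays positive. Stopping,
    with value 0, is therefore a decrease too.\<close>
  define f where
    "f s = (case cur s of None \<Rightarrow> 0 | Some A \<Rightarrow> Suc (card (F ` M)) - list_index A (Rep s))" for s :: rs_state
  have check: "I (rs_check \<Gamma> B s) \<and> (\<exists>ys. Rep (rs_check \<Gamma> B s) = Rep s @ ys)
      \<and> cur (rs_check \<Gamma> B s) = cur s" if "I s" "B \<in> M" for B and s :: rs_state
  proof (cases "filter (\<lambda>D. B \<otimes>\<^bsub>PSL2R\<^esub> inv\<^bsub>PSL2R\<^esub> D \<in> \<Gamma>) (Rep s) = []")
    case True
    then have no: "B \<otimes>\<^bsub>PSL2R\<^esub> inv\<^bsub>PSL2R\<^esub> D \<notin> \<Gamma>" if "D \<in> set (Rep s)" for D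
      using that by (simp add: filter_empty_conv)
    \<comment> \<open>An element is appended only when every check fails, and by \<open>F\<close> a
      colour already present would make one check succeed. Thus each new entry brings a new
      colour.\<close>
    have "F B \<notin> F ` set (Rep s)"
    proof
      assume "F B \<in> F ` set (Rep s)"
      then obtain D where "D \<in> set (Rep s)" "F B = F D" by auto
      with F[of D B] no[of D] \<open>I s\<close> \<open>B \<in> M\<close> show False by (auto simp: I_def)
    qed
    with True that show ?thesis by (auto simp: I_def rs_check_def)
  next
    case False
    with that show ?thesis by (auto simp: I_def rs_check_def)
  qed
  have bound: "length (Rep s) \<le> card (F ` M)" if "I s" for s :: rs_state
  proof -
    have "length (Rep s) = card (F ` set (Rep s))"
      using that by (simp add: I_def card_image distinct_card)
    also have "\<dots> \<le> card (F ` M)" using that fin by (auto simp: I_def intro: card_mono)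
    finally show ?thesis .
  qed
  have "\<exists>t. while_option (\<lambda>s. cur s \<noteq> None) (rs_loop n \<Gamma>)
      \<lparr>Rep = [psl_class (mat 1)], Gen = [], cur = Some (psl_class (mat 1))\<rparr> = Some t"
  proof (rule measure_while_option_Some[where P = I and f = f])
    fix s assume s: "I s" "cur s \<noteq> None"
    then obtain A where A: "cur s = Some A" "A \<in> set (Rep s)" "A \<in> M" by (auto simp: I_def)
    let ?B = "A \<otimes>\<^bsub>PSL2R\<^esub> psl_class (shear_matrix n)"
    let ?C = "A \<otimes>\<^bsub>PSL2R\<^esub> psl_class (rotation_matrix n)"
    define s1 where "s1 = rs_check \<Gamma> ?B s"
    define s2 where "s2 = rs_check \<Gamma> ?C s1"
    have s1: "I s1" "\<exists>ys. Rep s1 = Rep s @ ys" using check[OF s(1) step(1)[OF A(3)]]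
      by (auto simp: s1_def)
    have s2: "I s2" "\<exists>ys. Rep s2 = Rep s1 @ ys" using check[OF s1(1) step(2)[OF A(3)]]
      by (auto simp: s2_def)
    from s1 s2 obtain ys where ys: "Rep s2 = Rep s @ ys" by auto
    have loop: "rs_loop n \<Gamma> s = s2\<lparr>cur := successor A (Rep s2)\<rparr>"
      by (simp add: rs_loop_def A s1_def s2_def Let_def)
    \<comment> \<open>The list only grows at its end, so the current element keeps its position
      while \<open>Rep\<close> is updated.\<close>
    have idx: "list_index A (Rep s2) = list_index A (Rep s)" 
      using A ys by (simp add: list_index_append)
    have dist: "distinct (Rep s2)" using s2 by (simp add: I_def)
    have lt: "list_index A (Rep s) < card (F ` M)"
      using list_index_less[OF A(2)] bound[OF s(1)] by simp
    show "I (rs_loop n \<Gamma> s) \<and> f (rs_loop n \<Gamma> s) < f s"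
      using s2(1) successor_Some[OF _ dist, of A] lt idx A
      unfolding loop by (cases "successor A (Rep s2)") (auto simp: I_def f_def)
  next
    show "I \<lparr>Rep = [psl_class (mat 1)], Gen = [], cur = Some (psl_class (mat 1))\<rparr>"
      using one by (simp add: I_def)
  qed
  then show ?thesis by (simp add: rs_stops_def rs_calculation_def)
qed

section \<open>Quasiconformality of affine maps in conformal charts\<close>

text \<open>The conformal part of a derivative maps small circles to such circles, with a phase in
  the complex \<open>k\<close>. The integrand of the contour integral is constantly
  \<open>2 * pi * \<i>\<close>, whatever that phase.\<close>

lemma winding_number_rotated_circle:
  fixes b k :: complex
  assumes "k \<noteq> 0"
  shows "winding_number (\<lambda>t. b + k * exp (2 * of_real pi * \<i> * of_real t)) b = 1"
proof -
  let ?g = "\<lambda>t::real. b + k * exp (2 * of_real pi * \<i> * of_real t)"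
  have der: "(?g has_vector_derivative k * (2 * of_real pi * \<i> * exp (2 * of_real pi * \<i> * of_real t)))
      (at t within A)" for t A
    by (rule has_vector_derivative_real_field)  (auto intro!: derivative_eq_intros)
  have "valid_path ?g"
    unfolding valid_path_def by (rule C1_differentiable_imp_piecewise)
       (auto simp: C1_differentiable_on_def intro!: exI[where x="\<lambda>t. k * (2 * of_real pi * \<i> * exp (2 * of_real pi * \<i> * of_real t))"] der continuous_intros)
  moreover have "b \<notin> path_image ?g" using assms by (auto simp: path_image_def)
  moreover have "((\<lambda>w. 1 / (w - b)) has_contour_integral (2 * of_real pi * \<i>)) ?g"
  proof -
    have "2 * of_real pi * \<i> = 1 / (?g t - b) * vector_derivative ?g (at t within {0..1})"
      if "t \<in> {0..1}" for t :: real
      using vector_derivative_within_cbox[of 0 1 t ?g, OF _ _ der[of t "cbox 0 1"]] that assms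
      by (simp add: cbox_interval)
    moreover have "((\<lambda>t. 2 * of_real pi * \<i>) has_integral 2 * of_real pi * \<i>) {0..1::real}"
      using has_integral_const_real[of "2 * of_real pi * \<i> :: complex" 0 1] by simp
    ultimately have "((\<lambda>t. 1 / (?g t - b) * vector_derivative ?g (at t within {0..1}))
        has_integral 2 * of_real pi * \<i>) {0..1}"
      by (rule has_integral_eq)
    then show ?thesis by (simp only: has_contour_integral_def)
  qed
  ultimately show ?thesis
    by (simp add: winding_number_valid_path contour_integral_unique)
qed

text \<open>The Wirtinger coefficients of the real-linear map \<open>matrix_act A\<close>: this one
  belongs to \<open>z\<close>, \<open>anticonformal_part\<close> to \<open>cnj z\<close>. The
  difference of their squared moduli is \<open>det A\<close>.\<close>

definition conformal_part :: "real^2^2 \<Rightarrow> complex" where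
  "conformal_part A = Complex ((A$1$1 + A$2$2) / 2) ((A$2$1 - A$1$2) / 2)"

definition anticonformal_part :: "real^2^2 \<Rightarrow> complex" where
  "anticonformal_part A = Complex ((A$1$1 - A$2$2) / 2) ((A$2$1 + A$1$2) / 2)"

text \<open>Twice the dilatation of the linear map \<open>matrix_act A\<close>. The factor 2 leaves
  room for the error of the first-order approximation.\<close>

definition dilatation_bound :: "real^2^2 \<Rightarrow> real" where
  "dilatation_bound A = 2 * (norm (conformal_part A) + norm (anticonformal_part A)) /
     (norm (conformal_part A) - norm (anticonformal_part A))"

lemma matrix_act_conformal:
  "matrix_act A z = conformal_part A * z + anticonformal_part A * cnj z"
  by (auto simp: matrix_act_def conformal_part_def anticonformal_part_def complex_eq_iff field_simps)

lemma norm_anticonformal_less: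
  assumes "det A = 1" shows "norm (anticonformal_part A) < norm (conformal_part A)"
proof -
  have "(norm (conformal_part A))\<^sup>2 - (norm (anticonformal_part A))\<^sup>2 = det A"
    unfolding cmod_power2
    by (simp add: conformal_part_def anticonformal_part_def det_2 power2_eq_square field_simps)
  with assms have "(norm (anticonformal_part A))\<^sup>2 < (norm (conformal_part A))\<^sup>2" by simp
  then show ?thesis by (rule power2_less_imp_less) simp
qed

text \<open>The complex factors \<open>c\<close> and \<open>d\<close> come from changes of charts;
  they scale all directions equally and drop out of the dilatation. Near \<open>a\<close> the
  conformal term outweighs the anticonformal term and the remainder together: a straight-line
  homotopy to its circle gives the winding number, and the triangle inequality gives the
  dilatation.\<close>

lemma affine_derivative_imp_quasiconformal_at:
  assumes der: "(g has_derivative (\<lambda>h. d * matrix_act A (c * h))) (at a)"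
    and "d \<noteq> 0" "c \<noteq> 0" "det A = 1"
    and e: "e > 0" "continuous_on (ball a e) g"
  shows "orientation_preserving_at g a" "dilatation_bounded_at (dilatation_bound A) g a"
proof -
  define \<alpha> \<beta> where "\<alpha> = conformal_part A" and "\<beta> = anticonformal_part A"
  define q where "q = norm d * norm c"
  \<comment> \<open>With a third of the gap as error,
    \<open>norm \<alpha> - norm \<beta> - \<eta>\<close> is still \<open>2 * \<eta>\<close>, while
    \<open>norm \<alpha> + norm \<beta> + \<eta>\<close> is at most 4/3 of
    \<open>norm \<alpha> + norm \<beta>\<close>. The quotient of these two bounds is
    \<open>dilatation_bound A\<close>.\<close>
  define \<eta> where "\<eta> = (norm \<alpha> - norm \<beta>) / 3"
  have ab: "norm \<beta> < norm \<alpha>" using norm_anticonformal_less assms by (simp add: \<alpha>_def \<beta>_def)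
  have q: "q > 0" and \<eta>: "\<eta> > 0" using assms ab by (auto simp: q_def \<eta>_def)
  then have "q * \<eta> > 0" by simp
  then obtain \<delta> where \<delta>: "\<delta> > 0" "\<And>y. norm (y - a) < \<delta> \<Longrightarrow>
      norm (g y - g a - d * matrix_act A (c * (y - a))) \<le> q * \<eta> * norm (y - a)"
    using der unfolding has_derivative_at_alt by blast
  have main: "norm (g y - g a - d * (\<alpha> * (c * h))) \<le> q * (norm \<beta> + \<eta>) * norm h"
    if "y = a + h" "norm h < \<delta>" for y h
  proof -
    have "g y - g a - d * (\<alpha> * (c * h)) =
        (g y - g a - d * matrix_act A (c * (y - a))) + d * (\<beta> * cnj (c * h))"
      using that by (simp add: matrix_act_conformal \<alpha>_def \<beta>_def algebra_simps)
    also have "norm \<dots> \<le> norm (g y - g a - d * matrix_act A (c * (y - a))) + norm (d * (\<beta> * cnj (c * h)))"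
      by (rule norm_triangle_ineq)
    also have "\<dots> \<le> q * \<eta> * norm h + norm (d * (\<beta> * cnj (c * h)))"
      using \<delta>(2)[of y] that by simp
    also have "norm (d * (\<beta> * cnj (c * h))) = q * norm \<beta> * norm h"
      by (simp add: norm_mult q_def)
    finally show ?thesis by (simp add: algebra_simps)
  qed
  have nlin: "norm (d * (\<alpha> * (c * h))) = q * norm \<alpha> * norm h" for h
    by (simp add: norm_mult q_def)
  have ev: "eventually (\<lambda>r. 0 < r \<and> r < \<delta> \<and> r < e) (at_right (0::real))"
    unfolding eventually_at_right_field using \<delta> e by (intro exI[where x = "min \<delta> e"]) auto
  show "orientation_preserving_at g a"
    unfolding orientation_preserving_at_def
  proof (rule eventually_mono[OF ev], elim conjE)
    fix r :: real assume r: "0 < r" "r < \<delta>" "r < e"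
    let ?k = "d * \<alpha> * c * of_real r"
    let ?h = "\<lambda>t::real. g a + ?k * exp (2 * of_real pi * \<i> * of_real t)"
    let ?E = "\<lambda>t::real. of_real r * exp (2 * of_real pi * \<i> * of_real t) :: complex"
    have circ: "circlepath a r t = a + ?E t" for t
      by (simp add: circlepath)
    have [simp]: "norm (?E t) = r" for t using r by (simp add: norm_mult)
    have "path (g \<circ> circlepath a r)"
      using r by (intro path_continuous_image continuous_on_subset[OF e(2)]) (auto simp: dist_norm)
    moreover have "path ?h" by (auto simp: path_def intro!: continuous_intros)
    moreover have "pathfinish (g \<circ> circlepath a r) = pathstart (g \<circ> circlepath a r)"
      by (simp add: pathfinish_compose pathstart_compose)
    moreover have "exp (2 * of_real pi * \<i>) = (1::complex)" using exp_two_pi_i by (simp add: mult_ac)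
    then have "pathfinish ?h = pathstart ?h"
      by (simp add: pathfinish_def pathstart_def)
    \<comment> \<open>No point of the segment is farther from \<open>?h t\<close> than the other end
      is; but \<open>g a\<close> has distance \<open>q * norm \<alpha> * r\<close> from
      \<open>?h t\<close>, which exceeds the approximation error.\<close>
    moreover have "g a \<notin> closed_segment (?h t) ((g \<circ> circlepath a r) t)" for t
    proof
      assume "g a \<in> closed_segment (?h t) ((g \<circ> circlepath a r) t)"
      then have "norm (g a - ?h t) \<le> norm ((g \<circ> circlepath a r) t - ?h t)"
        using segment_bound(1) by blast
      moreover have "norm (g a - ?h t) = q * norm \<alpha> * r"
        using r by (simp add: norm_mult q_def)
      moreover have "norm ((g \<circ> circlepath a r) t - ?h t) \<le> q * (norm \<beta> + \<eta>) * r"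
      proof -
        have k: "?h t = g a + d * (\<alpha> * (c * ?E t))" by (simp add: mult_ac)
        have "norm (g (a + h) - (g a + d * (\<alpha> * (c * h)))) \<le> q * (norm \<beta> + \<eta>) * r" if "norm h = r" for h
          using main[of "a + h" h] r that by (simp add: algebra_simps)
        from this[of "?E t"] show ?thesis unfolding k o_apply circ by simp
      qed
      moreover have "norm \<beta> + \<eta> < norm \<alpha>" using ab by (simp add: \<eta>_def field_simps)
      then have "q * (norm \<beta> + \<eta>) * r < q * norm \<alpha> * r" using q r by simp
      ultimately show False by simp
    qed
    ultimately have "winding_number (g \<circ> circlepath a r) (g a) = winding_number ?h (g a)"
      by (intro winding_number_loops_linear_eq) auto
    also have "\<dots> = 1"
      using r assms ab by (intro winding_number_rotated_circle) auto
    finally show "winding_number (g \<circ> circlepath a r) (g a) = 1" .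
  qed
  show "dilatation_bounded_at (dilatation_bound A) g a"
    unfolding dilatation_bounded_at_def
  proof (rule eventually_mono[OF ev], elim conjE, intro ballI)
    fix r :: real and y y' assume r: "0 < r" "r < \<delta>" "r < e" and y: "y \<in> sphere a r" "y' \<in> sphere a r"
    have h: "norm (y - a) = r" "norm (y' - a) = r" using y by (auto simp: dist_norm norm_minus_commute)
    have "norm (g y - g a) \<le> norm (d * (\<alpha> * (c * (y - a)))) + norm (g y - g a - d * (\<alpha> * (c * (y - a))))"
      by (metis add.commute diff_add_cancel norm_triangle_ineq)
    also have "\<dots> \<le> q * norm \<alpha> * r + q * (norm \<beta> + \<eta>) * r"
      using main[of y "y - a"] h r nlin[of "y - a"] by simp
    finally have up: "norm (g y - g a) \<le> q * r * (norm \<alpha> + norm \<beta> + \<eta>)" by (simp add: algebra_simps)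
    have "norm (d * (\<alpha> * (c * (y' - a)))) - norm (g y' - g a - d * (\<alpha> * (c * (y' - a)))) \<le> norm (g y' - g a)"
      by (smt (verit) norm_minus_commute norm_triangle_ineq2)
    then have "q * norm \<alpha> * r - q * (norm \<beta> + \<eta>) * r \<le> norm (g y' - g a)"
      using main[of y' "y' - a"] h r nlin[of "y' - a"] by simp
    then have low: "q * r * (2 * \<eta>) \<le> norm (g y' - g a)" by (simp add: \<eta>_def field_simps)
    have K: "dilatation_bound A = 2 * (norm \<alpha> + norm \<beta>) / (3 * \<eta>)"
    proof -
      have "3 * \<eta> = norm \<alpha> - norm \<beta>" by (simp add: \<eta>_def)
      then show ?thesis by (simp only: dilatation_bound_def \<alpha>_def \<beta>_def)
    qed
    have "norm \<alpha> + norm \<beta> + \<eta> \<le> (4/3) * (norm \<alpha> + norm \<beta>)" by (simp add: \<eta>_def)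
    also have "\<dots> = dilatation_bound A * (2 * \<eta>)" using \<eta> by (simp add: K)
    finally have "norm (g y - g a) \<le> q * r * (dilatation_bound A * (2 * \<eta>))"
      using up q r by (smt (verit) mult_left_mono mult_pos_pos)
    also have "\<dots> = dilatation_bound A * (q * r * (2 * \<eta>))" by simp
    also have "\<dots> \<le> dilatation_bound A * norm (g y' - g a)"
      using low \<eta> by (intro mult_left_mono) (auto simp: K)
    finally show "dist (g y) (g a) \<le> dilatation_bound A * dist (g y') (g a)" by (simp add: dist_norm)
  qed
qed

section \<open>Lifting to coverings\<close>

text \<open>Sheets are presented through the points of a fibre and continuous inverses
  \<open>q\<close>: two lifts that both stay in \<open>U\<close> are compared by applying
  \<open>q\<close> to their common projection.\<close>

definition evenly_covered :: "'a topology \<Rightarrow> 'b topology \<Rightarrow> ('a \<Rightarrow> 'b) \<Rightarrow> 'b set \<Rightarrow> bool" where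
  "evenly_covered X Y p V \<longleftrightarrow> openin Y V \<and>
     (\<forall>x \<in> topspace X. p x \<in> V \<longrightarrow> (\<exists>U q. openin X U \<and> x \<in> U \<and>
        continuous_map (subtopology Y V) X q \<and>
        (\<forall>y \<in> V. q y \<in> U \<and> p (q y) = y) \<and> (\<forall>u \<in> U. p u \<in> V \<and> q (p u) = u)))"

lemma evenly_coveredE:
  assumes "evenly_covered X Y p V" "x \<in> topspace X" "p x \<in> V"
  obtains U q where "openin X U" "x \<in> U" "continuous_map (subtopology Y V) X q"
    "\<And>y. y \<in> V \<Longrightarrow> q y \<in> U" "\<And>y. y \<in> V \<Longrightarrow> p (q y) = y"
    "\<And>u. u \<in> U \<Longrightarrow> p u \<in> V" "\<And>u. u \<in> U \<Longrightarrow> q (p u) = u"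
proof -
  obtain U q where "openin X U" "x \<in> U" "continuous_map (subtopology Y V) X q"
      "\<forall>y \<in> V. q y \<in> U \<and> p (q y) = y" "\<forall>u \<in> U. p u \<in> V \<and> q (p u) = u"
    using assms by (auto simp: evenly_covered_def)
  then show ?thesis by (intro that[of U q]) auto
qed

lemma covering_map_evenly_covered:
  assumes "covering_map X Y p" "y \<in> topspace Y"
  obtains V where "y \<in> V" "evenly_covered X Y p V"
proof -
  obtain V \<U> where V: "y \<in> V" "openin Y V" and U: "\<Union>\<U> = {x \<in> topspace X. p x \<in> V}"
      "\<And>U. U \<in> \<U> \<Longrightarrow> openin X U"
      "\<And>U. U \<in> \<U> \<Longrightarrow> homeomorphic_map (subtopology X U) (subtopology Y V) p"
    using assms unfolding covering_map_def by meson
  have "\<exists>U q. openin X U \<and> x \<in> U \<and> continuous_map (subtopology Y V) X q \<and>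
        (\<forall>y \<in> V. q y \<in> U \<and> p (q y) = y) \<and> (\<forall>u \<in> U. p u \<in> V \<and> q (p u) = u)"
    if "x \<in> topspace X" "p x \<in> V" for x
  proof -
    have "x \<in> \<Union>\<U>" using that U(1) by simp
    then obtain U where "x \<in> U" "U \<in> \<U>" by (rule UnionE)
    then have hom: "homeomorphic_map (subtopology X U) (subtopology Y V) p" and "openin X U"
      using U by auto
    then obtain q where q: "homeomorphic_maps (subtopology X U) (subtopology Y V) p q"
      using homeomorphic_map_maps by blast
    have "topspace (subtopology X U) = U" "topspace (subtopology Y V) = V"
      using \<open>openin X U\<close> V(2) by (auto dest: openin_subset)
    with q \<open>openin X U\<close> \<open>x \<in> U\<close> show ?thesis
      unfolding homeomorphic_maps_def continuous_map_in_subtopology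
      by (intro exI[where x = U] exI[where x = q]) (simp add: Pi_iff)
  qed
  with V have "evenly_covered X Y p V" by (simp add: evenly_covered_def)
  with V(1) show ?thesis by (rule that)
qed

text \<open>The set where the lifts agree is closed because \<open>X\<close> is Hausdorff and open
  because \<open>p\<close> is injective on a sheet; being nonempty, it is all of the connected
  domain.\<close>

lemma covering_map_lift_unique:
  assumes cov: "covering_map X Y p" and haus: "Hausdorff_space X" and C: "connected_space C"
    and f: "continuous_map C X f" and g: "continuous_map C X g"
    and pfg: "\<And>c. c \<in> topspace C \<Longrightarrow> p (f c) = p (g c)"
    and c0: "c0 \<in> topspace C" "f c0 = g c0" and c: "c \<in> topspace C"
  shows "f c = g c"
proof -
  let ?E = "{c \<in> topspace C. f c = g c}"
  have "openin C ?E"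
  proof (subst openin_subopen, intro ballI)
    fix c assume "c \<in> ?E"
    then have cc: "c \<in> topspace C" "f c = g c" by auto
    have fcX: "f c \<in> topspace X" using f cc(1) by (auto simp: continuous_map_def)
    then have "p (f c) \<in> topspace Y"
      using cov by (auto simp: covering_map_def)
    then obtain V where V: "p (f c) \<in> V" "evenly_covered X Y p V"
      by (rule covering_map_evenly_covered[OF cov])
    obtain U q where U: "openin X U" "f c \<in> U" "\<And>u. u \<in> U \<Longrightarrow> q (p u) = u"
      by (rule evenly_coveredE[OF V(2) fcX V(1)], rule that)
    define T where "T = {c \<in> topspace C. f c \<in> U} \<inter> {c \<in> topspace C. g c \<in> U}"
    have "openin C T"
      unfolding T_def
      using openin_Int[OF openin_continuous_map_preimage[OF f U(1)] openin_continuous_map_preimage[OF g U(1)]] .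
    moreover have "c \<in> T" using cc U(2) by (simp add: T_def)
    moreover have "T \<subseteq> ?E"
    proof
      fix d assume d: "d \<in> T"
      then have "q (p (f d)) = f d" "q (p (g d)) = g d" by (simp_all add: T_def U(3))
      moreover have dC: "d \<in> topspace C" using d by (simp add: T_def)
      ultimately have "f d = g d" using pfg[OF dC] by metis
      with dC show "d \<in> ?E" by simp
    qed
    ultimately show "\<exists>T. openin C T \<and> c \<in> T \<and> T \<subseteq> ?E" by (intro exI[where x = T] conjI)
  qed
  moreover have "closedin C ?E" by (rule closedin_continuous_maps_eq[OF haus f g])
  moreover have "?E \<noteq> {}" using c0 by auto
  ultimately have "?E = topspace C" using C by (auto simp: connected_space_clopen_in)
  with c show ?thesis by auto
qed

text \<open>The time interval is cut into steps so short that, over a fixed neighbourhood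
  \<open>N\<close> of \<open>z\<close>, each step stays in an evenly covered set. The lift is then
  prolonged step by step with the inverse of one sheet.\<close>

lemma covering_map_homotopy_lift_locally:
  fixes S :: "'c::real_normed_vector set" and H :: "real \<times> 'c \<Rightarrow> 'b"
  assumes cov: "covering_map X Y p" and haus: "Hausdorff_space X"
    and S: "convex S" "z \<in> S" and H: "continuous_map (top_of_set ({0..1} \<times> S)) Y H"
    and H0: "\<And>z. z \<in> S \<Longrightarrow> H (0, z) = p x0" and x0: "x0 \<in> topspace X"
  obtains N L where "openin (top_of_set S) N" "z \<in> N" 
    "continuous_map (top_of_set ({0..1} \<times> N)) X L"
    "\<And>t z. \<lbrakk>t \<in> {0..1}; z \<in> N\<rbrakk> \<Longrightarrow> p (L (t, z)) = H (t, z)"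
    "\<And>z. z \<in> N \<Longrightarrow> L (0, z) = x0"
proof -
  define \<G> where "\<G> = {G. open G \<and> (\<exists>V. evenly_covered X Y p V \<and> H ` (G \<inter> ({0..1} \<times> S)) \<subseteq> V)}"
  have HY: "H w \<in> topspace Y" if "w \<in> {0..1} \<times> S" for w
    using H that by (auto simp: continuous_map_def)
  have "{0..1} \<times> {z} \<subseteq> \<Union>\<G>"
  proof
    fix w assume w: "w \<in> {0..1::real} \<times> {z}"
    then have wS: "w \<in> {0..1} \<times> S" using S by auto
    obtain V where V: "H w \<in> V" "evenly_covered X Y p V"
      by (rule covering_map_evenly_covered[OF cov HY[OF wS]])
    then have "openin Y V" by (simp add: evenly_covered_def)
    from openin_continuous_map_preimage[OF H this]
    have "openin (top_of_set ({0..1} \<times> S)) {w \<in> {0..1} \<times> S. H w \<in> V}" by simp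
    then obtain G where "open G" "{w \<in> {0..1} \<times> S. H w \<in> V} = {0..1} \<times> S \<inter> G"
      by (auto simp: openin_open)
    with V wS show "w \<in> \<Union>\<G>" unfolding \<G>_def by blast
  qed
  moreover have "compact ({0..1::real} \<times> {z})" by (intro compact_Times) auto
  ultimately obtain \<epsilon> where eps: "\<epsilon> > 0" "\<And>w. w \<in> {0..1} \<times> {z} \<Longrightarrow> \<exists>G \<in> \<G>. ball w \<epsilon> \<subseteq> G"
    using Heine_Borel_lemma[of "{0..1::real} \<times> {z}" \<G>] unfolding \<G>_def by blast
  \<comment> \<open>Half of the Lebesgue number \<open>\<epsilon>\<close> is reserved for the length
    \<open>1 / m\<close> of a step and half for the radius of \<open>N\<close>, so that each box
    fits into a ball of radius \<open>\<epsilon>\<close>.\<close>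
  obtain m :: nat where "2 / \<epsilon> < real m" using reals_Archimedean2 by blast
  moreover from this have m: "m > 0" using eps(1) by (cases m) (auto simp: field_simps)
  ultimately have m2: "1 / real m < \<epsilon> / 2" using eps(1) by (simp add: field_simps)
  define N where "N = S \<inter> ball z (\<epsilon> / 2)"
  have N: "openin (top_of_set S) N" "z \<in> N" "N \<subseteq> S" "connected N"
    using S eps(1) by (auto simp: N_def openin_open convex_Int intro!: convex_connected)
  have box: "\<exists>V. evenly_covered X Y p V \<and> H ` ({i / m .. (i + 1) / m} \<times> N) \<subseteq> V"
    if "i < m" for i :: nat
  proof -
    have im: "(i / m, z) \<in> {0..1} \<times> {z}" "(real i + 1) / m \<le> 1" using that m by (auto simp: field_simps)
    obtain G where G: "G \<in> \<G>" "ball (i / m, z) \<epsilon> \<subseteq> G" using eps(2)[OF im(1)] by auto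
    then obtain V where V: "evenly_covered X Y p V" "H ` (G \<inter> ({0..1} \<times> S)) \<subseteq> V"
      by (auto simp: \<G>_def)
    have "(t, z') \<in> ball (i / m, z) \<epsilon> \<and> (t, z') \<in> {0..1} \<times> S"
      if "t \<in> {i / m .. (i + 1) / m}" "z' \<in> N" for t z'
    proof -
      have "\<bar>i / m - t\<bar> \<le> 1 / m" using that(1) by (simp add: add_divide_distrib abs_if)
      moreover have "norm (z - z') < \<epsilon> / 2" using that(2) by (simp add: N_def dist_norm)
      ultimately have "dist (i / m, z) (t, z') < \<epsilon>"
        using norm_Pair_le[of "i / m - t" "z - z'"] m2 by (simp add: dist_norm)
      moreover have "0 \<le> real i / m" by simp
      then have "t \<in> {0..1}" using that(1) im(2) by (auto simp: add.commute simp del: divide_nonneg_nonneg)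
      ultimately show ?thesis using that(2) N(3) by auto
    qed
    then have "{i / m .. (i + 1) / m} \<times> N \<subseteq> G \<inter> ({0..1} \<times> S)" using G(2) by blast
    with V show ?thesis by (intro exI[where x = V]) blast
  qed
  have "\<exists>L. continuous_map (top_of_set ({0..i / m} \<times> N)) X L \<and>
      (\<forall>t \<in> {0..i / m}. \<forall>z \<in> N. p (L (t, z)) = H (t, z)) \<and> (\<forall>z \<in> N. L (0, z) = x0)"
    if "i \<le> m" for i :: nat
    using that
  proof (induction i)
    case 0
    then show ?case using x0 H0 N(3) by (intro exI[where x = "\<lambda>_. x0"]) auto
  next
    case (Suc i)
    then obtain L where L: "continuous_map (top_of_set ({0..i / m} \<times> N)) X L"
        "\<And>t z. t \<in> {0..i / m} \<Longrightarrow> z \<in> N \<Longrightarrow> p (L (t, z)) = H (t, z)" "\<And>z. z \<in> N \<Longrightarrow> L (0, z) = x0"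
      by auto
    obtain V where V: "evenly_covered X Y p V" "H ` ({i / m .. (i + 1) / m} \<times> N) \<subseteq> V"
      using box[of i] Suc.prems by auto
    have i0: "0 \<le> real i / m" and i1: "real i / m \<le> (i + 1) / m" using m by (auto simp: field_simps)
    have i2: "(real i + 1) / m \<le> 1" using Suc.prems m by (simp add: field_simps)
    have LX: "L (i / m, z) \<in> topspace X" using L(1) N(2) i0 by (auto simp: continuous_map_def)
    have pV: "p (L (i / m, z)) \<in> V" using V(2) L(2)[of "i / m" z] N(2) i0 i1 by auto
    obtain U q where U: "openin X U" "L (i / m, z) \<in> U"
        "continuous_map (subtopology Y V) X q" "\<And>y. y \<in> V \<Longrightarrow> p (q y) = y"
        "\<And>u. u \<in> U \<Longrightarrow> q (p u) = u"
      by (rule evenly_coveredE[OF V(1) LX pV], rule that)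
    have qH: "continuous_map (top_of_set ({i / m .. (i + 1) / m} \<times> N)) X (q \<circ> H)"
    proof (rule continuous_map_compose[OF _ U(3)])
      have "{i / m .. (i + 1) / m} \<subseteq> {0..1}" using i0 i2 by (simp add: add.commute)
      then have sub: "{i / m .. (i + 1) / m} \<times> N \<subseteq> {0..1} \<times> S" using N(3) by (rule Sigma_mono)
      have "continuous_map (top_of_set ({i / m .. (i + 1) / m} \<times> N)) Y H"
        using continuous_map_from_subtopology_mono[OF H sub] .
      then show "continuous_map (top_of_set ({i / m .. (i + 1) / m} \<times> N)) (subtopology Y V) H"
        using V(2) by (simp add: continuous_map_in_subtopology image_subset_iff_funcset)
    qed
    \<comment> \<open>The sheet was selected at \<open>z\<close> only. On the connected face over
      time \<open>i / m\<close>, both \<open>L\<close> and \<open>q \<circ> H\<close> lift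
      \<open>H\<close>, so agreement at \<open>z\<close> spreads to all of \<open>N\<close>.\<close>
    have fibre: "L (i / m, z') = q (H (i / m, z'))" if "z' \<in> N" for z'
    proof -
      have N': "connected_space (top_of_set N)" using N(4) by (simp add: connected_space_subtopology)
      have emb: "continuous_map (top_of_set N) (top_of_set (T \<times> N)) (\<lambda>z. (i / m, z))" if "i / m \<in> T" for T
        using that by (auto simp: continuous_map_in_subtopology intro!: continuous_intros)
      have c1: "continuous_map (top_of_set N) X (L \<circ> (\<lambda>z. (i / m, z)))"
        using continuous_map_compose[OF emb L(1)] i0 by simp
      have c2: "continuous_map (top_of_set N) X (q \<circ> H \<circ> (\<lambda>z. (i / m, z)))"
        using continuous_map_compose[OF emb qH] i1 by simp
      have c3: "p ((L \<circ> (\<lambda>z. (i / m, z))) c) = p ((q \<circ> H \<circ> (\<lambda>z. (i / m, z))) c)"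
        if "c \<in> topspace (top_of_set N)" for c
      proof -
        have "(i / m, c) \<in> {i / m .. (i + 1) / m} \<times> N" using that i1 by simp
        then have "H (i / m, c) \<in> V" using V(2) by blast
        then show ?thesis using that U(4) L(2)[of "i / m" c] i0 by simp
      qed
      have "L (i / m, z) = q (p (L (i / m, z)))" using U by simp
      then have c4: "(L \<circ> (\<lambda>z. (i / m, z))) z = (q \<circ> H \<circ> (\<lambda>z. (i / m, z))) z"
        using L(2)[of "i / m" z] N(2) i0 by simp
      have "z \<in> topspace (top_of_set N)" "z' \<in> topspace (top_of_set N)" using N(2) that by auto
      from covering_map_lift_unique[OF cov haus N' c1 c2 c3 this(1) c4 this(2)]
      show ?thesis by simp
    qed
    define L' where "L' w = (if fst w \<le> i / m then L w else (q \<circ> H) w)" for w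
    have "continuous_map (top_of_set ({0..(i + 1) / m} \<times> N)) X L'"
      unfolding L'_def
    proof (rule continuous_map_cases_le)
      have "({0..(i + 1) / m} \<times> N) \<inter> {x \<in> topspace (top_of_set ({0..(i + 1) / m} \<times> N)). fst x \<le> i / m}
          = {0..i / m} \<times> N" using i1 by auto
      then show "continuous_map (subtopology (top_of_set ({0..(i + 1) / m} \<times> N))
          {x \<in> topspace (top_of_set ({0..(i + 1) / m} \<times> N)). fst x \<le> i / m}) X L"
        using L(1) by (simp only: subtopology_subtopology)
      have "({0..(i + 1) / m} \<times> N) \<inter> {x \<in> topspace (top_of_set ({0..(i + 1) / m} \<times> N)). i / m \<le> fst x}
          = {i / m..(i + 1) / m} \<times> N" using order_trans[OF i0] by auto
      then show "continuous_map (subtopology (top_of_set ({0..(i + 1) / m} \<times> N))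
          {x \<in> topspace (top_of_set ({0..(i + 1) / m} \<times> N)). i / m \<le> fst x}) X (q \<circ> H)"
        using qH by (simp only: subtopology_subtopology)
      show "L x = (q \<circ> H) x" if "x \<in> topspace (top_of_set ({0..(i + 1) / m} \<times> N))" "fst x = i / m" for x
        using that fibre[of "snd x"] by (cases x) auto
    qed (auto intro!: continuous_intros)
    moreover have "p (L' (t, z)) = H (t, z)" if "t \<in> {0..(i + 1) / m}" "z \<in> N" for t z
      using that L(2)[of t z] U(4) V(2) by (auto simp: L'_def image_subset_iff)
    moreover have "L' (0, z) = x0" if "z \<in> N" for z using that L(3) i0 by (auto simp: L'_def)
    ultimately show ?case by (intro exI[where x = L']) (auto simp: add.commute)
  qed
  from this[of m] obtain L where "continuous_map (top_of_set ({0..1} \<times> N)) X L"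
      "\<forall>t \<in> {0..1}. \<forall>z \<in> N. p (L (t, z)) = H (t, z)" "\<forall>z \<in> N. L (0, z) = x0"
    using m by auto
  with N that show ?thesis by blast
qed

text \<open>The straight-line contraction to \<open>z0\<close> turns \<open>\<psi>\<close> into a
  homotopy that begins with a constant map. Its local lifts with the common start \<open>x0\<close>
  patch together at time 1, where they lift \<open>\<psi>\<close>.\<close>

lemma covering_map_lift_convex:
  fixes S :: "'c::real_normed_vector set"
  assumes cov: "covering_map X Y p" and haus: "Hausdorff_space X"
    and S: "convex S" and \<psi>: "continuous_map (top_of_set S) Y \<psi>"
  obtains s where "continuous_map (top_of_set S) X s" "\<And>z. z \<in> S \<Longrightarrow> p (s z) = \<psi> z"
proof (cases "S = {}")
  case True
  then show ?thesis using that by (auto simp: continuous_map_on_empty)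
next
  case False
  then obtain z0 where z0: "z0 \<in> S" by auto
  then have "\<psi> z0 \<in> topspace Y" using \<psi> by (auto simp: continuous_map_def)
  then obtain x0 where x0: "x0 \<in> topspace X" "p x0 = \<psi> z0"
    using cov unfolding covering_map_def by (metis imageE)
  define H where "H = \<psi> \<circ> (\<lambda>w. (1 - fst w) *\<^sub>R z0 + fst w *\<^sub>R snd w)"
  have HS: "(1 - t) *\<^sub>R z0 + t *\<^sub>R z \<in> S" if "t \<in> {0..1}" "z \<in> S" for t z
    using convexD[OF S z0 that(2), of "1 - t" t] that(1) by simp
  have H: "continuous_map (top_of_set ({0..1} \<times> S)) Y H"
    unfolding H_def
  proof (rule continuous_map_compose[OF _ \<psi>])
    show "continuous_map (top_of_set ({0..1} \<times> S)) (top_of_set S)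
        (\<lambda>w. (1 - fst w) *\<^sub>R z0 + fst w *\<^sub>R snd w)"
      using HS by (auto intro!: continuous_intros)
  qed
  define Q where "Q z N L \<longleftrightarrow> openin (top_of_set S) N \<and> z \<in> N \<and>
      continuous_map (top_of_set ({0..1} \<times> N)) X L \<and>
      (\<forall>t \<in> {0..1}. \<forall>z \<in> N. p (L (t, z)) = H (t, z)) \<and> (\<forall>z \<in> N. L (0, z) = x0)" for z N L
  have "\<exists>N L. Q z N L" if zS: "z \<in> S" for z
  proof -
    have H0: "H (0, z) = p x0" if "z \<in> S" for z using x0 by (simp add: H_def)
    obtain N L where "openin (top_of_set S) N" "z \<in> N"
        "continuous_map (top_of_set ({0..1} \<times> N)) X L"
        "\<And>t z. \<lbrakk>t \<in> {0..1}; z \<in> N\<rbrakk> \<Longrightarrow> p (L (t, z)) = H (t, z)" "\<And>z. z \<in> N \<Longrightarrow> L (0, z) = x0"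
      by (rule covering_map_homotopy_lift_locally[OF cov haus S zS H H0 x0(1)], (assumption+)?, rule that)
    then show ?thesis by (intro exI[where x = N] exI[where x = L]) (simp add: Q_def)
  qed
  then obtain N L where "\<And>z. z \<in> S \<Longrightarrow> Q z (N z) (L z)" by metis
  then have NL: "\<And>z. z \<in> S \<Longrightarrow> openin (top_of_set S) (N z)" "\<And>z. z \<in> S \<Longrightarrow> z \<in> N z"
      "\<And>z. z \<in> S \<Longrightarrow> continuous_map (top_of_set ({0..1} \<times> N z)) X (L z)"
      "\<And>z t z'. \<lbrakk>z \<in> S; t \<in> {0..1}; z' \<in> N z\<rbrakk> \<Longrightarrow> p (L z (t, z')) = H (t, z')"
      "\<And>z z'. \<lbrakk>z \<in> S; z' \<in> N z\<rbrakk> \<Longrightarrow> L z (0, z') = x0"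
    unfolding Q_def by blast+
  have emb: "continuous_map (top_of_set A) (top_of_set (A \<times> B)) (\<lambda>t. (t, z))" if "z \<in> B"
    for A :: "real set" and B :: "'c set" and z
    using that by (auto simp: continuous_map_in_subtopology intro!: continuous_intros)
  have emb': "continuous_map (top_of_set B) (top_of_set (A \<times> B)) (\<lambda>z. (t, z))" if "t \<in> A"
    for A :: "real set" and B :: "'c set" and t
    using that by (auto simp: continuous_map_in_subtopology intro!: continuous_intros)
  \<comment> \<open>For fixed \<open>z\<close>, both local lifts follow the same path from the same
    point \<open>x0\<close>, hence have the same end.\<close>
  have agree: "L z1 (1, z) = L z2 (1, z)" if z: "z1 \<in> S" "z2 \<in> S" "z \<in> N z1" "z \<in> N z2" for z z1 z2
  proof -
    have I: "connected_space (top_of_set {0..1::real})" by (simp add: connected_space_subtopology)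
    have c1: "continuous_map (top_of_set {0..1}) X (L z1 \<circ> (\<lambda>t. (t, z)))"
      by (rule continuous_map_compose[OF emb[OF z(3)] NL(3)[OF z(1)]])
    have c2: "continuous_map (top_of_set {0..1}) X (L z2 \<circ> (\<lambda>t. (t, z)))"
      by (rule continuous_map_compose[OF emb[OF z(4)] NL(3)[OF z(2)]])
    have c3: "p ((L z1 \<circ> (\<lambda>t. (t, z))) t) = p ((L z2 \<circ> (\<lambda>t. (t, z))) t)"
      if "t \<in> topspace (top_of_set {0..1})" for t
      using that z NL(4) by simp
    have c4: "(L z1 \<circ> (\<lambda>t. (t, z))) 0 = (L z2 \<circ> (\<lambda>t. (t, z))) 0" using z NL(5) by simp
    have "0 \<in> topspace (top_of_set {0..1::real})" "1 \<in> topspace (top_of_set {0..1::real})" by auto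
    from covering_map_lift_unique[OF cov haus I c1 c2 c3 this(1) c4 this(2)]
    show ?thesis by simp
  qed
  have NS: "N z \<subseteq> S" if "z \<in> S" for z using NL(1)[OF that] by (auto dest: openin_imp_subset)
  show ?thesis
  proof (rule that)
    show "continuous_map (top_of_set S) X (\<lambda>z. L z (1, z))"
    proof (rule pasting_lemma[where I = S and T = N and f = "\<lambda>z1 z. L z1 (1, z)"])
      show "continuous_map (subtopology (top_of_set S) (N z)) X (\<lambda>z'. L z (1, z'))" if "z \<in> S" for z
        using continuous_map_compose[OF emb' NL(3)[OF that], of 1] NS[OF that]
        by (simp add: o_def subtopology_subtopology Int_absorb1)
      show "L z1 (1, z) = L z2 (1, z)" if "z1 \<in> S" "z2 \<in> S" "z \<in> topspace (top_of_set S) \<inter> N z1 \<inter> N z2"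
        for z1 z2 z
        using that by (intro agree) auto
      show "\<exists>j. j \<in> S \<and> z \<in> N j \<and> L z (1, z) = L j (1, z)" if "z \<in> topspace (top_of_set S)" for z
        using that NL(2) by auto
    qed (rule NL(1))
    show "p (L z (1, z)) = \<psi> z" if "z \<in> S" for z
      using NL(4)[OF that _ NL(2)[OF that], of 1] by (simp add: H_def)
  qed
qed

section \<open>Deck transformations and maps between coverings\<close>

definition transitive_deck_maps :: "'a topology \<Rightarrow> ('a \<Rightarrow> 'b) \<Rightarrow> ('a \<Rightarrow> 'a) set \<Rightarrow> bool" where
  "transitive_deck_maps X p G \<longleftrightarrow>
     (\<forall>g \<in> G. continuous_map X X g \<and> (\<forall>x \<in> topspace X. p (g x) = p x)) \<and>
     (\<forall>x \<in> topspace X. \<forall>x' \<in> topspace X. p x = p x' \<longrightarrow> (\<exists>g \<in> G. g x = x'))"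

lemma transitive_deck_mapsD:
  assumes "transitive_deck_maps X p G"
  shows "\<And>g. g \<in> G \<Longrightarrow> continuous_map X X g"
    "\<And>g x. \<lbrakk>g \<in> G; x \<in> topspace X\<rbrakk> \<Longrightarrow> p (g x) = p x"
    "\<And>x x'. \<lbrakk>x \<in> topspace X; x' \<in> topspace X; p x = p x'\<rbrakk> \<Longrightarrow> \<exists>g \<in> G. g x = x'"
  using assms by (auto simp: transitive_deck_maps_def)

text \<open>A section over a quotient \<open>S\<close> of \<open>Y\<close> and its translates by deck transformations together
  form a quotient map onto the covering space.\<close>

lemma continuous_map_from_covering:
  assumes cov: "covering_map X Y p"
    and deck: "transitive_deck_maps X p G"
    and q: "quotient_map S Y q"
    and s: "continuous_map S X s" "\<And>z. z \<in> topspace S \<Longrightarrow> p (s z) = q z"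
    and \<phi>: "\<And>g. g \<in> G \<Longrightarrow> continuous_map S Z (\<phi> \<circ> g \<circ> s)" "\<phi> ` topspace X \<subseteq> topspace Z"
  shows "continuous_map X Z \<phi>"
  unfolding continuous_map_def
proof (intro conjI allI impI)
  note G = transitive_deck_mapsD(1,2)[OF deck] and trans = transitive_deck_mapsD(3)[OF deck]
  show "\<phi> \<in> topspace X \<rightarrow> topspace Z" using \<phi>(2) by auto
  fix W assume W: "openin Z W"
  let ?O = "{x \<in> topspace X. \<phi> x \<in> W}"
  have sX: "s z \<in> topspace X" if "z \<in> topspace S" for z
    using s(1) that by (auto simp: continuous_map_def)
  have gX: "g x \<in> topspace X" if "g \<in> G" "x \<in> topspace X" for g x
    using G(1)[OF that(1)] that(2) by (auto simp: continuous_map_def)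
  have p: "continuous_map X Y p" using cov by (simp add: covering_map_def)
  show "openin X ?O"
  proof (subst openin_subopen, intro ballI)
    fix x assume "x \<in> ?O"
    then have x: "x \<in> topspace X" "\<phi> x \<in> W" by auto
    then have "p x \<in> topspace Y" using p by (auto simp: continuous_map_def)
    then obtain V where V: "p x \<in> V" "evenly_covered X Y p V"
      by (rule covering_map_evenly_covered[OF cov])
    obtain U r where U: "openin X U" "x \<in> U" "\<And>y. y \<in> V \<Longrightarrow> r y \<in> U" "\<And>y. y \<in> V \<Longrightarrow> p (r y) = y"
        "\<And>u. u \<in> U \<Longrightarrow> p u \<in> V" "\<And>u. u \<in> U \<Longrightarrow> r (p u) = u"
      by (rule evenly_coveredE[OF V(2) x(1) V(1)], rule that)
    have UX: "U \<subseteq> topspace X" using U(1) by (rule openin_subset)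
    \<comment> \<open>Openness is tested in \<open>Y\<close>, where the quotient map
      \<open>q\<close> reduces it to \<open>S\<close>: the points of \<open>U\<close> above
      \<open>E\<close> are those mapped into \<open>W\<close>. By transitivity the point of
      \<open>U\<close> over \<open>q z\<close> is some translate \<open>g (s z)\<close>, so the
      preimage of \<open>E\<close> in \<open>S\<close> is a union of open sets indexed by
      \<open>g\<close>.\<close>
    define E where "E = {y \<in> V. r y \<in> ?O}"
    have "openin Y V" using V(2) by (simp add: evenly_covered_def)
    then have EY: "E \<subseteq> topspace Y" by (auto simp: E_def dest: openin_subset)
    have "{z \<in> topspace S. q z \<in> E} = (\<Union>g \<in> G. {z \<in> topspace S. (g \<circ> s) z \<in> U} \<inter>
        {z \<in> topspace S. (\<phi> \<circ> g \<circ> s) z \<in> W})"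
    proof (intro equalityI subsetI)
      fix z assume "z \<in> {z \<in> topspace S. q z \<in> E}"
      then have z: "z \<in> topspace S" "q z \<in> V" "r (q z) \<in> topspace X" "\<phi> (r (q z)) \<in> W"
        by (auto simp: E_def)
      have "p (s z) = p (r (q z))" using s(2)[OF z(1)] U(4)[OF z(2)] by simp
      then obtain g where "g \<in> G" "g (s z) = r (q z)" using trans[OF sX[OF z(1)] z(3)] by auto
      then show "z \<in> (\<Union>g \<in> G. {z \<in> topspace S. (g \<circ> s) z \<in> U} \<inter> {z \<in> topspace S. (\<phi> \<circ> g \<circ> s) z \<in> W})"
        using z U(3)[OF z(2)] by (intro UN_I[of g]) auto
    next
      fix z assume "z \<in> (\<Union>g \<in> G. {z \<in> topspace S. (g \<circ> s) z \<in> U} \<inter> {z \<in> topspace S. (\<phi> \<circ> g \<circ> s) z \<in> W})"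
      then obtain g where g: "g \<in> G" "z \<in> topspace S" "g (s z) \<in> U" "\<phi> (g (s z)) \<in> W" by auto
      have "p (g (s z)) = q z" using G(2)[OF g(1) sX[OF g(2)]] s(2)[OF g(2)] by simp
      then have "q z \<in> V" "r (q z) = g (s z)" using U(5,6)[OF g(3)] by auto
      then show "z \<in> {z \<in> topspace S. q z \<in> E}" using g gX[OF g(1) sX[OF g(2)]] by (simp add: E_def)
    qed
    moreover have "openin S ({z \<in> topspace S. (g \<circ> s) z \<in> U} \<inter> {z \<in> topspace S. (\<phi> \<circ> g \<circ> s) z \<in> W})"
      if "g \<in> G" for g
      using openin_Int[OF openin_continuous_map_preimage[OF continuous_map_compose[OF s(1) G(1)[OF that]] U(1)]
          openin_continuous_map_preimage[OF \<phi>(1)[OF that] W]] .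
    then have "openin S (\<Union>g \<in> G. {z \<in> topspace S. (g \<circ> s) z \<in> U} \<inter> {z \<in> topspace S. (\<phi> \<circ> g \<circ> s) z \<in> W})"
      by (intro openin_Union) blast
    ultimately have "openin S {z \<in> topspace S. q z \<in> E}" by (simp only:)
    then have "openin Y E" using q EY by (simp add: quotient_map_def)
    from openin_Int[OF U(1) openin_continuous_map_preimage[OF p this]]
    have "openin X (U \<inter> {x \<in> topspace X. p x \<in> E})" .
    moreover have "U \<inter> {x \<in> topspace X. p x \<in> E} \<subseteq> ?O"
      using U(6) by (auto simp: E_def)
    moreover have "x \<in> U \<inter> {x \<in> topspace X. p x \<in> E}"
      using x U(2) U(6)[OF U(2)] V(1) by (simp add: E_def)
    ultimately show "\<exists>T. openin X T \<and> x \<in> T \<and> T \<subseteq> ?O" by (intro exI conjI)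
  qed
qed

text \<open>The values are forced, so the point is that they are well defined. If
  \<open>g (s z) = h (s z')\<close> and \<open>s z' = k (s z)\<close>, then \<open>g\<close> and
  \<open>h \<circ> k\<close> both lift \<open>p\<close> and agree at \<open>s z\<close>, hence
  everywhere, in particular at \<open>s' z\<close>.\<close>

lemma covering_map_deck_equivariant_map:
  assumes cov: "covering_map X Y p" and haus: "Hausdorff_space X" and conn: "connected_space X"
    and deck: "transitive_deck_maps X p G"
    and q: "quotient_map S Y q"
    and s: "continuous_map S X s" "\<And>z. z \<in> topspace S \<Longrightarrow> p (s z) = q z"
    and s': "continuous_map S X s'"
    and data: "\<And>z z'. \<lbrakk>z \<in> topspace S; z' \<in> topspace S; q z = q z'\<rbrakk>
       \<Longrightarrow> \<exists>k \<in> G. s z' = k (s z) \<and> s' z' = k (s' z)"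
  obtains f where "continuous_map X X f"
    "\<And>g z. \<lbrakk>g \<in> G; z \<in> topspace S\<rbrakk> \<Longrightarrow> f (g (s z)) = g (s' z)"
proof -
  note G = transitive_deck_mapsD(1,2)[OF deck] and trans = transitive_deck_mapsD(3)[OF deck]
  have sX: "s z \<in> topspace X" "s' z \<in> topspace X" if "z \<in> topspace S" for z
    using s(1) s' that by (auto simp: continuous_map_def)
  have gX: "g x \<in> topspace X" if "g \<in> G" "x \<in> topspace X" for g x
    using G(1)[OF that(1)] that(2) by (auto simp: continuous_map_def)
  have wd: "g (s' z) = h (s' z')"
    if gh: "g \<in> G" "h \<in> G" "z \<in> topspace S" "z' \<in> topspace S" "g (s z) = h (s z')" for g h z z'
  proof -
    have "q z = q z'"
      using gh G(2)[OF gh(1) sX(1)[OF gh(3)]] G(2)[OF gh(2) sX(1)[OF gh(4)]] s(2) by simp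
    then obtain k where k: "k \<in> G" "s z' = k (s z)" "s' z' = k (s' z)" using data gh by blast
    have "g x = (h \<circ> k) x" if "x \<in> topspace X" for x
    proof (rule covering_map_lift_unique[OF cov haus conn G(1)[OF gh(1)]
          continuous_map_compose[OF G(1)[OF k(1)] G(1)[OF gh(2)]] _ sX(1)[OF gh(3)] _ that])
      show "p (g c) = p ((h \<circ> k) c)" if "c \<in> topspace X" for c
        using G(2) gh(1,2) k(1) gX that by simp
      show "g (s z) = (h \<circ> k) (s z)" using gh(5) k(2) by simp
    qed
    from this[OF sX(2)[OF gh(3)]] k(3) show ?thesis by simp
  qed
  define R where "R x y \<longleftrightarrow> (\<exists>g \<in> G. \<exists>z \<in> topspace S. x = g (s z) \<and> y = g (s' z))" for x y
  define f where "f x = (SOME y. R x y)" for x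
  have f: "f (g (s z)) = g (s' z)" if "g \<in> G" "z \<in> topspace S" for g z
    unfolding f_def
  proof (rule some_equality)
    show "R (g (s z)) (g (s' z))" using that by (auto simp: R_def)
    show "y = g (s' z)" if "R (g (s z)) y" for y
      using that wd \<open>g \<in> G\<close> \<open>z \<in> topspace S\<close> unfolding R_def by metis
  qed
  have onto: "\<exists>g \<in> G. \<exists>z \<in> topspace S. x = g (s z)" if "x \<in> topspace X" for x
  proof -
    have "p x \<in> topspace Y" using cov that by (auto simp: covering_map_def)
    also have "topspace Y = q ` topspace S" using q by (simp add: quotient_map_def)
    finally obtain z where z: "z \<in> topspace S" "p x = q z" by auto
    with trans[OF sX(1)[OF z(1)] that] s(2) show ?thesis by fastforce
  qed
  have "continuous_map X X f"
  proof (rule continuous_map_from_covering[OF cov deck q s])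
    show "continuous_map S X (f \<circ> g \<circ> s)" if "g \<in> G" for g
      by (rule continuous_map_eq[OF continuous_map_compose[OF s' G(1)[OF that]]]) (simp add: f that)
    show "f ` topspace X \<subseteq> topspace X"
      using onto f gX sX by fastforce
  qed
  with f that show thesis by blast
qed

text \<open>Since \<open>q\<close> and \<open>q'\<close> identify the same points, the data are
  symmetric in the two sections, and exchanging them gives the inverse map. The last conclusion
  allows a property of \<open>f\<close> to be checked on translates of the section.\<close>

lemma covering_map_deck_equivariant_homeomorphism:
  assumes cov: "covering_map X Y p" and haus: "Hausdorff_space X" and conn: "connected_space X"
    and deck: "transitive_deck_maps X p G"
    and q: "quotient_map S Y q" "quotient_map S Y q'"
    and qq: "\<And>z z'. \<lbrakk>z \<in> topspace S; z' \<in> topspace S\<rbrakk> \<Longrightarrow> q z = q z' \<longleftrightarrow> q' z = q' z'"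
    and s: "continuous_map S X s" "\<And>z. z \<in> topspace S \<Longrightarrow> p (s z) = q z"
    and s': "continuous_map S X s'" "\<And>z. z \<in> topspace S \<Longrightarrow> p (s' z) = q' z"
    and data: "\<And>z z'. \<lbrakk>z \<in> topspace S; z' \<in> topspace S; q z = q z'\<rbrakk>
       \<Longrightarrow> \<exists>k \<in> G. s z' = k (s z) \<and> s' z' = k (s' z)"
  obtains f where "homeomorphic_map X X f"
    "\<And>g z. \<lbrakk>g \<in> G; z \<in> topspace S\<rbrakk> \<Longrightarrow> f (g (s z)) = g (s' z)"
    "\<And>x. x \<in> topspace X \<Longrightarrow> \<exists>g \<in> G. \<exists>z \<in> topspace S. x = g (s z)"
proof -
  note G = transitive_deck_mapsD(1,2)[OF deck] and trans = transitive_deck_mapsD(3)[OF deck]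
  obtain f where f: "continuous_map X X f"
      "\<And>g z. \<lbrakk>g \<in> G; z \<in> topspace S\<rbrakk> \<Longrightarrow> f (g (s z)) = g (s' z)"
    by (rule covering_map_deck_equivariant_map[OF cov haus conn deck q(1) s s'(1) data], (assumption+)?, rule that)
  have data': "\<exists>k \<in> G. s' z' = k (s' z) \<and> s z' = k (s z)"
    if "z \<in> topspace S" "z' \<in> topspace S" "q' z = q' z'" for z z'
    using data[of z z'] qq[of z z'] that by blast
  obtain f' where f': "continuous_map X X f'"
      "\<And>g z. \<lbrakk>g \<in> G; z \<in> topspace S\<rbrakk> \<Longrightarrow> f' (g (s' z)) = g (s z)"
    by (rule covering_map_deck_equivariant_map[OF cov haus conn deck q(2) s' s(1) data'], (assumption+)?, rule that)
  have onto: "\<exists>g \<in> G. \<exists>z \<in> topspace S. x = g (s z)"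
    if "x \<in> topspace X" "continuous_map S X s" "\<And>z. z \<in> topspace S \<Longrightarrow> p (s z) = q z" "quotient_map S Y q"
    for x s q
  proof -
    have "p x \<in> topspace Y" using cov that by (auto simp: covering_map_def)
    also have "topspace Y = q ` topspace S" using that by (simp add: quotient_map_def)
    finally obtain z where z: "z \<in> topspace S" "p x = q z" by auto
    have "s z \<in> topspace X" using that(2) z(1) by (auto simp: continuous_map_def)
    with trans[OF this that(1)] that(3) z show ?thesis by fastforce
  qed
  have "homeomorphic_maps X X f f'"
    unfolding homeomorphic_maps_def
  proof (intro conjI ballI)
    show "f' (f x) = x" if "x \<in> topspace X" for x using onto[OF that s q(1)] f(2) f'(2) by force
    show "f (f' x) = x" if "x \<in> topspace X" for x using onto[OF that s' q(2)] f(2) f'(2) by force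
  qed (use f f' in auto)
  then have "homeomorphic_map X X f" by (auto simp: homeomorphic_map_maps)
  then show thesis using that f(2) onto[OF _ s q(1)] by blast
qed

section \<open>The regular 2n-gon\<close>

definition apothem :: "nat \<Rightarrow> real" where
  "apothem n = cos (pi / (2 * real n)) / (2 * sin (pi / (2 * real n)))"

text \<open>The \<open>k\<close>-th side joins the vertices \<open>k\<close> and \<open>k + 1\<close>; like the vertices, the sides are indexed modulo
  \<open>2n\<close>. Its opposite has index \<open>k + n\<close> and is obtained from it by the translation by
  \<open>- side_width n k\<close>.\<close>

definition side_normal :: "nat \<Rightarrow> nat \<Rightarrow> complex" where
  "side_normal n k = cis (- pi / 2 + (real k + 1) * pi / n)"

definition side_height :: "nat \<Rightarrow> nat \<Rightarrow> complex \<Rightarrow> real" where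
  "side_height n k z = Re (z * cnj (side_normal n k))"

definition side_width :: "nat \<Rightarrow> nat \<Rightarrow> complex" where
  "side_width n k = 2 * of_real (apothem n) * side_normal n k"

lemma sin_half_angle_pos: "n > 0 \<Longrightarrow> sin (pi / (2 * real n)) > 0"
  by (rule sin_gt_zero) (auto simp: field_simps)

lemma apothem_pos: "n \<ge> 2 \<Longrightarrow> apothem n > 0"
  unfolding apothem_def using sin_half_angle_pos[of n]
  by (intro divide_pos_pos cos_gt_zero) (auto simp: field_simps)

text \<open>In the frame whose real axis is the outer normal, a side of length 1 at distance
  \<open>apothem n\<close> has its ends at the imaginary parts -1/2 and 1/2. Statements about the
  \<open>k\<close>-th side thus reduce to a vertical unit segment.\<close>

lemma vertex_eq_normal:
  assumes "n > 0"
  shows "vertex n k = side_normal n k * Complex (apothem n) (- 1 / 2)"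
    "vertex n (Suc k) = side_normal n k * Complex (apothem n) (1 / 2)"
proof -
  let ?a = "pi / (2 * real n)"
  have s: "sin ?a > 0" using assms by (rule sin_half_angle_pos)
  have 1: "Complex (apothem n) (- 1 / 2) = complex_of_real (1 / (2 * sin ?a)) * cis (- ?a)"
    using s by (simp add: complex_eq_iff apothem_def)
  have 2: "Complex (apothem n) (1 / 2) = complex_of_real (1 / (2 * sin ?a)) * cis ?a"
    using s by (simp add: complex_eq_iff apothem_def)
  have "- pi / 2 + (2 * real k + 1) * pi / (2 * real n) = (- pi / 2 + (real k + 1) * pi / n) + (- ?a)"
    using assms by (simp add: field_simps)
  then have "cis (- pi / 2 + (2 * real k + 1) * pi / (2 * real n)) = side_normal n k * cis (- ?a)"
    by (simp only: side_normal_def cis_mult)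
  then have "vertex n k = complex_of_real (1 / (2 * sin ?a)) * (side_normal n k * cis (- ?a))"
    by (simp only: vertex_def)
  then show "vertex n k = side_normal n k * Complex (apothem n) (- 1 / 2)"
    by (simp only: 1 mult_ac)
  have "- pi / 2 + (2 * real (Suc k) + 1) * pi / (2 * real n) = (- pi / 2 + (real k + 1) * pi / n) + ?a"
    using assms by (simp add: field_simps)
  then have "cis (- pi / 2 + (2 * real (Suc k) + 1) * pi / (2 * real n)) = side_normal n k * cis ?a"
    by (simp only: side_normal_def cis_mult)
  then have "vertex n (Suc k) = complex_of_real (1 / (2 * sin ?a)) * (side_normal n k * cis ?a)"
    by (simp only: vertex_def)
  then show "vertex n (Suc k) = side_normal n k * Complex (apothem n) (1 / 2)"
    by (simp only: 2 mult_ac)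
qed

lemma norm_side_normal [simp]: "norm (side_normal n k) = 1"
  by (simp add: side_normal_def)

lemma side_normal_mult_cnj [simp]:
  "side_normal n k * cnj (side_normal n k) = 1" "cnj (side_normal n k) * side_normal n k = 1"
  by (simp_all add: side_normal_def cis_cnj cis_mult)

lemma side_normal_shift: "n > 0 \<Longrightarrow> side_normal n (k + n) = - side_normal n k"
proof -
  assume n: "n > 0"
  have "- pi / 2 + (real (k + n) + 1) * pi / n = (- pi / 2 + (real k + 1) * pi / n) + pi"
    using n by (simp add: field_simps)
  then have "side_normal n (k + n) = side_normal n k * cis pi"
    by (simp only: side_normal_def cis_mult)
  then show ?thesis by simp
qed

lemma side_normal_add: "side_normal n (k + j) = side_normal n k * cis (j * pi / n)"
proof -
  have "- pi / 2 + (real (k + j) + 1) * pi / n = (- pi / 2 + (real k + 1) * pi / n) + j * pi / n"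
    by (cases "n = 0") (simp_all add: field_simps)
  then show ?thesis by (simp only: side_normal_def cis_mult)
qed

lemma side_normal_period: "n > 0 \<Longrightarrow> side_normal n (k + 2 * n) = side_normal n k"
  using side_normal_shift[of n k] side_normal_shift[of n "k + n"] by (simp add: mult_2 add.assoc)

lemma side_normal_mod: "n > 0 \<Longrightarrow> side_normal n (k mod (2 * n)) = side_normal n k"
proof (induction k rule: less_induct)
  case (less k)
  show ?case
  proof (cases "k < 2 * n")
    case False
    then have "side_normal n ((k - 2 * n) mod (2 * n)) = side_normal n (k - 2 * n)" using less by simp
    also have "\<dots> = side_normal n k" using side_normal_period[of n "k - 2 * n"] False less by simp
    finally show ?thesis using False by (simp add: le_mod_geq)
  qed auto
qed

lemma vertex_mod: "n > 0 \<Longrightarrow> vertex n (k mod (2 * n)) = vertex n k"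
  by (simp add: vertex_eq_normal side_normal_mod)

lemma vertex_shift: "n > 0 \<Longrightarrow> vertex n (k + n) = - vertex n k"
  by (simp add: vertex_eq_normal(1) side_normal_shift)

lemma side_width_eq: "n > 0 \<Longrightarrow> side_width n k = vertex n k + vertex n (Suc k)"
proof -
  assume n: "n > 0"
  have "vertex n k + vertex n (Suc k) =
      side_normal n k * (Complex (apothem n) (- 1 / 2) + Complex (apothem n) (1 / 2))"
    by (simp only: vertex_eq_normal(1)[OF n, of k] vertex_eq_normal(2)[OF n, of k] distrib_left)
  also have "Complex (apothem n) (- 1 / 2) + Complex (apothem n) (1 / 2) = 2 * of_real (apothem n)"
    by (simp add: complex_eq_iff)
  finally show ?thesis by (simp add: side_width_def)
qed

lemma side_width_shift: "n > 0 \<Longrightarrow> side_width n (k + n) = - side_width n k"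
  by (simp add: side_width_def side_normal_shift)

lemma side_height_shift: "n > 0 \<Longrightarrow> side_height n (k + n) z = - side_height n k z"
  by (simp add: side_height_def side_normal_shift)

lemma side_height_mod: "n > 0 \<Longrightarrow> side_height n (k mod (2 * n)) z = side_height n k z"
  by (simp add: side_height_def side_normal_mod)

lemma side_height_add: "side_height n k (z + w) = side_height n k z + side_height n k w"
  and side_height_diff: "side_height n k (z - w) = side_height n k z - side_height n k w"
  and side_height_scaleR: "side_height n k (c *\<^sub>R z) = c * side_height n k z"
  by (simp_all add: side_height_def algebra_simps)

lemma side_height_width: "side_height n k (side_width n k) = 2 * apothem n"
  by (simp add: side_height_def side_width_def mult.assoc del: complex_cnj_cnj)

lemma continuous_on_side_height [continuous_intros]:
  "continuous_on A f \<Longrightarrow> continuous_on A (\<lambda>x. side_height n k (f x))"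
  unfolding side_height_def by (intro continuous_intros)

text \<open>In terms of \<open>a = pi / (2 * n)\<close>, the angles run from \<open>3 * a\<close> to
  \<open>2 * pi - 3 * a\<close>, strictly between \<open>a\<close> and its reflection
  \<open>2 * pi - a\<close>. Angles beyond \<open>pi\<close> are reflected.\<close>

lemma cos_odd_multiple_less:
  assumes "n > 0" "2 \<le> m" "m < 2 * n"
  shows "cos ((2 * real m - 1) * (pi / (2 * real n))) < cos (pi / (2 * real n))"
proof -
  define a where "a = pi / (2 * real n)"
  have a: "a > 0" "2 * real n * a = pi" using assms by (auto simp: a_def)
  have m: "real m \<ge> 2" "real m + 1 \<le> 2 * n" using assms by linarith+
  show ?thesis
  proof (cases "(2 * real m - 1) * a \<le> pi")
    case True
    have "1 * a < (2 * real m - 1) * a" using a m by (intro mult_strict_right_mono) auto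
    with True a show ?thesis by (intro cos_monotone_0_pi) (auto simp: a_def[symmetric])
  next
    case False
    have "cos ((2 * real m - 1) * a) = cos (2 * pi - (2 * real m - 1) * a)" by (simp add: cos_diff)
    also have "\<dots> < cos a"
    proof (rule cos_monotone_0_pi)
      have "2 * pi - (2 * real m - 1) * a = (4 * real n - (2 * real m - 1)) * a" using a by (simp add: algebra_simps)
      moreover have "1 * a < (4 * real n - (2 * real m - 1)) * a" using a m by (intro mult_strict_right_mono) auto
      ultimately show "a < 2 * pi - (2 * real m - 1) * a" by simp
    qed (use a False in auto)
    finally show ?thesis by (simp add: a_def)
  qed
qed

text \<open>Counted from the direction \<open>- pi / 2\<close>, vertices lie at odd and normals at
  even multiples of \<open>pi / (2 * n)\<close>; vertex \<open>k + m\<close> and the normal of side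
  \<open>k\<close> are \<open>2 * m - 1\<close> such steps apart.\<close>

lemma side_height_vertex_add:
  assumes "n > 0"
  shows "side_height n k (vertex n (k + m)) =
    cos ((2 * real m - 1) * (pi / (2 * real n))) / (2 * sin (pi / (2 * real n)))"
proof -
  let ?a = "pi / (2 * real n)"
  have "side_height n k (vertex n (k + m)) = 1 / (2 * sin ?a) *
      Re (cis (- pi / 2 + (2 * real (k + m) + 1) * pi / (2 * real n)) * cis (- (- pi / 2 + (real k + 1) * pi / n)))"
  proof -
    have "Re (of_real c * w) = c * Re w" for c w by simp
    then show ?thesis
      unfolding side_height_def vertex_def side_normal_def by (simp only: cis_cnj mult.assoc)
  qed
  also have "cis (- pi / 2 + (2 * real (k + m) + 1) * pi / (2 * real n)) * cis (- (- pi / 2 + (real k + 1) * pi / n))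
      = cis ((2 * real m - 1) * ?a)"
    unfolding cis_mult using assms by (intro arg_cong[of _ _ cis]) (simp add: field_simps)
  finally show ?thesis by simp
qed

text \<open>Each side spans a supporting line that meets the vertices in the two ends of the side
  only. The exclusive alternative allows passing from indices to heights and back.\<close>

lemma side_height_vertex_cases:
  assumes n: "n > 0"
  shows "(i mod (2 * n) = k mod (2 * n) \<or> i mod (2 * n) = Suc k mod (2 * n)) \<and>
      side_height n k (vertex n i) = apothem n \<or>
    i mod (2 * n) \<noteq> k mod (2 * n) \<and> i mod (2 * n) \<noteq> Suc k mod (2 * n) \<and>
      side_height n k (vertex n i) < apothem n"
proof -
  \<comment> \<open>The residue of \<open>i - k\<close> modulo \<open>2 * n\<close>, written so that
    no natural subtraction is truncated.\<close>
  define m where "m = (i + (2 * n - k mod (2 * n))) mod (2 * n)"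
  have m: "m < 2 * n" using n by (simp add: m_def)
  have "(k + m) mod (2 * n) = (k mod (2 * n) + (i + (2 * n - k mod (2 * n)))) mod (2 * n)"
    unfolding m_def by (simp add: mod_simps)
  also have "k mod (2 * n) + (i + (2 * n - k mod (2 * n))) = i + 2 * n"
    using n mod_less_divisor[of "2 * n" k] by linarith
  finally have im: "i mod (2 * n) = (k + m) mod (2 * n)" by simp
  then have v: "vertex n i = vertex n (k + m)" using n vertex_mod by metis
  have km: "(k + m) mod (2 * n) = (k + j) mod (2 * n) \<longleftrightarrow> m = j" if "j < 2 * n" for j
  proof
    have *: "a = b" if "(k + a) mod (2 * n) = (k + b) mod (2 * n)" "a \<le> b" "b < 2 * n" for a b
    proof -
      have "2 * n dvd (k + b) - (k + a)"
        using that by (subst mod_eq_dvd_iff_nat[symmetric]) auto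
      then have "2 * n dvd b - a" by simp
      moreover have "b - a < 2 * n" using that(3) by linarith
      ultimately have "\<not> b - a > 0" using nat_dvd_not_less by blast
      then show "a = b" using that(2) by simp
    qed
    show "m = j" if "(k + m) mod (2 * n) = (k + j) mod (2 * n)"
      using *[of m j] *[of j m] that m \<open>j < 2 * n\<close> by (cases m j rule: le_cases) auto
  qed auto
  show ?thesis
  proof (cases "m = 0 \<or> m = 1")
    case True
    then have "side_height n k (vertex n i) = apothem n"
      unfolding v side_height_vertex_add[OF n] by (auto simp: apothem_def)
    with True im show ?thesis by auto
  next
    case False
    then have "side_height n k (vertex n i) < apothem n"
      unfolding v side_height_vertex_add[OF n] apothem_def using cos_odd_multiple_less[OF n _ m]
      by (intro divide_strict_right_mono mult_pos_pos sin_half_angle_pos n) auto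
    with False im km[of 0] km[of 1] n show ?thesis by auto
  qed
qed

text \<open>The heights of the vertices \<open>0, \<dots>, n - 1\<close>, which are those on the right, cut the polygon into \<open>n - 1\<close>
  horizontal strips; \<open>strip_bound n k y\<close> is half of the width of the polygon at a height \<open>y\<close> in the
  \<open>k\<close>-th strip.\<close>

definition strip_bound :: "nat \<Rightarrow> nat \<Rightarrow> real \<Rightarrow> real" where
  "strip_bound n k y = (apothem n + y * cos ((real k + 1) * pi / n)) / sin ((real k + 1) * pi / n)"

lemma side_normal_Re_Im:
  "Re (side_normal n k) = sin ((real k + 1) * pi / n)"
  "Im (side_normal n k) = - cos ((real k + 1) * pi / n)"
  by (simp_all add: side_normal_def cos_diff sin_diff cos_add sin_add)

lemma sin_strip_pos:
  assumes "Suc k < n" shows "sin ((real k + 1) * pi / n) > 0"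
proof (rule sin_gt_zero)
  have "(real k + 1) * pi < real n * pi" using assms by (intro mult_strict_right_mono) auto
  then show "(real k + 1) * pi / n < pi" using assms by (simp add: divide_less_eq mult.commute)
qed (use assms in auto)

lemma side_height_le_iff_strip:
  assumes "Suc k < n"
  shows "side_height n k z \<le> apothem n \<longleftrightarrow> Re z \<le> strip_bound n k (Im z)"
    "side_height n k z = apothem n \<longleftrightarrow> Re z = strip_bound n k (Im z)"
  using sin_strip_pos[OF assms]
  by (auto simp: side_height_def side_normal_Re_Im strip_bound_def field_simps)

text \<open>Reflection in the vertical axis exchanges the vertices \<open>k\<close> and
  \<open>2 * n - 1 - k\<close>; the image of the side from \<open>k\<close> to \<open>k + 1\<close>
  is therefore the side that starts at \<open>2 * n - 2 - k\<close>.\<close>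

lemma side_normal_mirror:
  assumes "Suc k < n"
  shows "side_normal n (2 * n - 2 - k) = - cnj (side_normal n k)"
proof -
  have "(real (2 * n - 2 - k) + 1) * pi / n = 2 * pi - (real k + 1) * pi / n"
    using assms by (simp add: of_nat_diff field_simps)
  then show ?thesis by (simp add: complex_eq_iff side_normal_Re_Im cos_diff sin_diff)
qed

lemma vertex_mirror:
  assumes "k < n" shows "vertex n (2 * n - 1 - k) = - cnj (vertex n k)"
proof -
  have "- pi / 2 + (2 * real (2 * n - 1 - k) + 1) * pi / (2 * real n) = pi - (- pi / 2 + (2 * real k + 1) * pi / (2 * real n))"
    using assms by (simp add: of_nat_diff field_simps)
  moreover have "cis (pi - x) = - cnj (cis x)" for x by (simp add: complex_eq_iff cos_diff sin_diff)
  ultimately have "cis (- pi / 2 + (2 * real (2 * n - 1 - k) + 1) * pi / (2 * real n)) =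
      - cnj (cis (- pi / 2 + (2 * real k + 1) * pi / (2 * real n)))"
    by (simp only:)
  then have "vertex n (2 * n - 1 - k) = complex_of_real (1 / (2 * sin (pi / (2 * real n)))) *
      - cnj (cis (- pi / 2 + (2 * real k + 1) * pi / (2 * real n)))"
    by (simp only: vertex_def)
  then show ?thesis unfolding vertex_def by simp
qed

lemma side_height_le_iff_strip_mirror:
  assumes "Suc k < n"
  shows "side_height n (2 * n - 2 - k) z \<le> apothem n \<longleftrightarrow> - Re z \<le> strip_bound n k (Im z)"
    "side_height n (2 * n - 2 - k) z = apothem n \<longleftrightarrow> - Re z = strip_bound n k (Im z)"
  using sin_strip_pos[OF assms] unfolding side_height_def side_normal_mirror[OF assms]
  by (auto simp: side_normal_Re_Im strip_bound_def field_simps)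

lemma vertex_Re_Im:
  "Re (vertex n k) = sin ((2 * real k + 1) * pi / (2 * real n)) / (2 * sin (pi / (2 * real n)))"
  "Im (vertex n k) = - cos ((2 * real k + 1) * pi / (2 * real n)) / (2 * sin (pi / (2 * real n)))"
  by (simp_all add: vertex_def cos_diff sin_diff cos_add sin_add)

lemma vertex_Im_less:
  assumes "i < j" "j < n" shows "Im (vertex n i) < Im (vertex n j)"
proof -
  have "cos ((2 * real j + 1) * pi / (2 * real n)) < cos ((2 * real i + 1) * pi / (2 * real n))"
  proof (rule cos_monotone_0_pi)
    show "(2 * real i + 1) * pi / (2 * real n) < (2 * real j + 1) * pi / (2 * real n)"
      using assms by (intro divide_strict_right_mono mult_strict_right_mono) auto
    have "2 * real j + 1 \<le> 2 * n" using assms by linarith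
    then have "(2 * real j + 1) * pi \<le> (2 * n) * pi" by (intro mult_right_mono) auto
    then show "(2 * real j + 1) * pi / (2 * real n) \<le> pi" using assms by (simp add: field_simps)
  qed (use assms in auto)
  then show ?thesis
    unfolding vertex_Re_Im using sin_half_angle_pos[of n] assms by (intro divide_strict_right_mono) auto
qed

lemma vertex_Re_pos: "k < n \<Longrightarrow> Re (vertex n k) > 0"
  unfolding vertex_Re_Im
proof (intro divide_pos_pos sin_gt_zero)
  assume k: "k < n"
  have "2 * real k + 1 < 2 * n" using k by linarith
  then have "(2 * real k + 1) * pi < (2 * n) * pi" by (intro mult_strict_right_mono) auto
  then show "(2 * real k + 1) * pi / (2 * real n) < pi" using k by (simp add: field_simps)
  show "2 * sin (pi / (2 * real n)) > 0" using sin_half_angle_pos[of n] k by simp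
qed auto

lemma strip_bound_vertex:
  assumes "Suc k < n"
  shows "strip_bound n k (Im (vertex n k)) = Re (vertex n k)"
    "strip_bound n k (Im (vertex n (Suc k))) = Re (vertex n (Suc k))"
  using side_height_vertex_cases[of n k k] side_height_vertex_cases[of n "Suc k" k]
    side_height_le_iff_strip(2)[OF assms] assms by auto

lemma strip_bound_affine:
  "strip_bound n k ((1 - u) * a + u * b) = (1 - u) * strip_bound n k a + u * strip_bound n k b"
  by (simp add: strip_bound_def add_divide_distrib diff_divide_distrib algebra_simps)

lemma strip_parameter:
  assumes "Suc k < n" "Im (vertex n k) \<le> y" "y \<le> Im (vertex n (Suc k))"
  obtains u where "0 \<le> u" "u \<le> 1" "y = (1 - u) * Im (vertex n k) + u * Im (vertex n (Suc k))"
    "strip_bound n k y = (1 - u) * Re (vertex n k) + u * Re (vertex n (Suc k))"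
proof -
  define a b where "a = Im (vertex n k)" and "b = Im (vertex n (Suc k))"
  have ab: "a < b" using vertex_Im_less[of k "Suc k" n] assms by (simp add: a_def b_def)
  define u where "u = (y - a) / (b - a)"
  have "u * (b - a) = y - a" using ab by (simp add: u_def)
  then have "y = (1 - u) * a + u * b" by (simp add: algebra_simps)
  moreover have "0 \<le> u" "u \<le> 1"
    using ab assms(2,3) by (auto simp: u_def a_def[symmetric] b_def[symmetric] field_simps)
  ultimately have "0 \<le> u" "u \<le> 1" "y = (1 - u) * a + u * b" by auto
  then show ?thesis
    using that[of u] strip_bound_affine[of n k u a b] strip_bound_vertex[OF assms(1)]
    by (simp add: a_def b_def)
qed

lemma strip_bound_pos:
  assumes "Suc k < n" "Im (vertex n k) \<le> y" "y \<le> Im (vertex n (Suc k))"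
  shows "strip_bound n k y > 0"
proof -
  obtain u where u: "0 \<le> u" "u \<le> 1" "strip_bound n k y = (1 - u) * Re (vertex n k) + u * Re (vertex n (Suc k))"
    using strip_parameter[OF assms] by blast
  have "Re (vertex n k) > 0" "Re (vertex n (Suc k)) > 0" using vertex_Re_pos assms(1) by auto
  with u show ?thesis
    by (cases "u = 0") (auto intro!: add_nonneg_pos mult_pos_pos mult_nonneg_nonneg)
qed

text \<open>At the height of \<open>z\<close>, side \<open>k\<close> contains a point
  \<open>p\<close> with abscissa \<open>strip_bound n k (Im z)\<close>, and its mirror image
  \<open>- cnj p\<close> lies on the left side; \<open>z\<close> is on the chord between
  them.\<close>

lemma strip_in_hull:
  assumes "Suc k < n" "Im (vertex n k) \<le> Im z" "Im z \<le> Im (vertex n (Suc k))"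
    "\<bar>Re z\<bar> \<le> strip_bound n k (Im z)"
  shows "z \<in> convex hull (range (vertex n))"
proof -
  obtain u where u: "0 \<le> u" "u \<le> 1" "Im z = (1 - u) * Im (vertex n k) + u * Im (vertex n (Suc k))"
      "strip_bound n k (Im z) = (1 - u) * Re (vertex n k) + u * Re (vertex n (Suc k))"
    using strip_parameter[OF assms(1-3)] by blast
  let ?C = "convex hull (range (vertex n))"
  have v: "vertex n i \<in> ?C" for i by (rule hull_inc) auto
  have conv: "(1 - t) *\<^sub>R a + t *\<^sub>R b \<in> ?C" if "a \<in> ?C" "b \<in> ?C" "0 \<le> t" "t \<le> 1" for a b and t :: real
    using convexD[OF convex_convex_hull that(1,2), of "1 - t" t] that by simp
  define p where "p = (1 - u) *\<^sub>R vertex n k + u *\<^sub>R vertex n (Suc k)"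
  have p: "p \<in> ?C" using conv v u by (simp add: p_def)
  have "- cnj p = (1 - u) *\<^sub>R vertex n (2 * n - 1 - k) + u *\<^sub>R vertex n (2 * n - 1 - Suc k)"
    using assms(1) by (simp only: vertex_mirror[of k] vertex_mirror[of "Suc k"] p_def) (simp add: complex_eq_iff)
  then have p': "- cnj p \<in> ?C" using conv v u by simp
  have pz: "Re p = strip_bound n k (Im z)" "Im p = Im z" using u by (simp_all add: p_def)
  have pos: "Re p > 0" using strip_bound_pos[OF assms(1-3)] pz by simp
  define t where "t = (Re z + Re p) / (2 * Re p)"
  have "\<bar>Re z\<bar> \<le> Re p" using assms(4) pz by simp
  then have t: "0 \<le> t" "t \<le> 1" using pos by (auto simp: t_def field_simps)
  have "z = (1 - t) *\<^sub>R (- cnj p) + t *\<^sub>R p"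
    using pos pz by (simp add: complex_eq_iff t_def field_simps)
  with conv[OF p' p t] show ?thesis by simp
qed

lemma convex_combination_side_height:
  "side_height n k ((1 - u) *\<^sub>R z + u *\<^sub>R w) = (1 - u) * side_height n k z + u * side_height n k w"
  by (simp add: side_height_add side_height_scaleR)

lemma side_height_le_of_hull:
  assumes "n > 0" "z \<in> convex hull (range (vertex n))"
  shows "side_height n k z \<le> apothem n"
proof -
  have "convex {z. side_height n k z \<le> apothem n}"
  proof (rule convexI)
    fix x y and u v :: real
    assume *: "x \<in> {z. side_height n k z \<le> apothem n}" "y \<in> {z. side_height n k z \<le> apothem n}"
      "0 \<le> u" "0 \<le> v" "u + v = 1"
    have "side_height n k (u *\<^sub>R x + v *\<^sub>R y) = u * side_height n k x + v * side_height n k y"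
      by (simp add: side_height_add side_height_scaleR)
    also have "\<dots> \<le> u * apothem n + v * apothem n" using * by (intro add_mono mult_left_mono) auto
    also have "\<dots> = apothem n" using * by (simp add: distrib_right[symmetric])
    finally show "u *\<^sub>R x + v *\<^sub>R y \<in> {z. side_height n k z \<le> apothem n}" by simp
  qed
  moreover have "range (vertex n) \<subseteq> {z. side_height n k z \<le> apothem n}"
    using side_height_vertex_cases[OF assms(1)] by (force simp: order_le_less)
  ultimately have "convex hull (range (vertex n)) \<subseteq> {z. side_height n k z \<le> apothem n}"
    by (intro hull_minimal)
  with assms show ?thesis by auto
qed

lemma side_height_top_bottom:
  assumes "n > 0"
  shows "side_height n (n - 1) z = Im z" "side_height n (2 * n - 1) z = - Im z"
proof -
  have "(real (n - 1) + 1) * pi / n = pi" using assms by (simp add: of_nat_diff)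
  then have "side_normal n (n - 1) = \<i>" by (simp add: complex_eq_iff side_normal_Re_Im)
  then show 1: "side_height n (n - 1) z = Im z" by (simp add: side_height_def)
  have "2 * n - 1 = (n - 1) + n" using assms by simp
  with 1 show "side_height n (2 * n - 1) z = - Im z" using side_height_shift[OF assms, of "n - 1"] by simp
qed

lemma apothem_vertex_Im:
  assumes "n > 0" shows "Im (vertex n 0) = - apothem n" "Im (vertex n (n - 1)) = apothem n"
proof -
  show "Im (vertex n 0) = - apothem n" by (simp add: vertex_Re_Im apothem_def)
  have "vertex n (2 * n - 1 - 0) = - cnj (vertex n 0)" using assms by (rule vertex_mirror)
  moreover have "vertex n (2 * n - 1 - 0) = - vertex n (n - 1)"
    using vertex_shift[OF assms, of "n - 1"] assms by (simp add: mult_2 add.commute)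
  ultimately have "Im (vertex n (n - 1)) = - Im (vertex n 0)" by (simp add: complex_eq_iff)
  with \<open>Im (vertex n 0) = - apothem n\<close> show "Im (vertex n (n - 1)) = apothem n" by simp
qed

lemma strip_exists:
  assumes "n \<ge> 2" "- apothem n \<le> y" "y \<le> apothem n"
  obtains k where "Suc k < n" "Im (vertex n k) \<le> y" "y \<le> Im (vertex n (Suc k))"
proof -
  have "\<exists>k. Suc k < n \<and> Im (vertex n k) \<le> y \<and> y \<le> Im (vertex n (Suc k))"
    if "y \<le> Im (vertex n (Suc m))" "Suc m < n" for m
    using that
  proof (induction m)
    case 0
    then show ?case using assms apothem_vertex_Im(1)[of n] by (intro exI[where x = 0]) auto
  next
    case (Suc m)
    then show ?case
      by (cases "y \<le> Im (vertex n (Suc m))") (auto intro: exI[where x = "Suc m"])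
  qed
  from this[of "n - 2"] show ?thesis
    using assms apothem_vertex_Im(2)[of n] that by (auto simp: numeral_2_eq_2 Suc_diff_Suc)
qed

text \<open>For the nontrivial inclusion, the inequalities of the top and bottom sides put the point
  into some strip, and the two slanted sides of that strip bound its abscissa.\<close>

lemma polygon_hull_eq:
  assumes "n \<ge> 2"
  shows "convex hull (range (vertex n)) = {z. \<forall>k. side_height n k z \<le> apothem n}"
proof (intro equalityI subsetI)
  fix z assume "z \<in> {z. \<forall>k. side_height n k z \<le> apothem n}"
  then have z: "side_height n k z \<le> apothem n" for k by simp
  have "- apothem n \<le> Im z" "Im z \<le> apothem n"
    using z[of "n - 1"] z[of "2 * n - 1"] side_height_top_bottom[of n] assms by auto
  then obtain k where k: "Suc k < n" "Im (vertex n k) \<le> Im z" "Im z \<le> Im (vertex n (Suc k))"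
    using strip_exists[OF assms] by blast
  then show "z \<in> convex hull (range (vertex n))"
    using z[of k] z[of "2 * n - 2 - k"] side_height_le_iff_strip(1)[OF k(1)]
      side_height_le_iff_strip_mirror(1)[OF k(1)]
    by (intro strip_in_hull[OF k]) (auto simp: abs_le_iff)
qed (use side_height_le_of_hull assms in auto)

lemma punctured_polygon_iff:
  assumes "n \<ge> 2"
  shows "z \<in> punctured_polygon n \<longleftrightarrow> (\<forall>k. side_height n k z \<le> apothem n) \<and> z \<notin> range (vertex n)"
  by (auto simp: punctured_polygon_def polygon_hull_eq[OF assms])

text \<open>In the frame of the side, the position along it is \<open>Im w\<close>. The inequalities
  of the two neighbouring sides confine it to the interval from -1/2 to 1/2, and the ends are
  excluded as vertices.\<close>

lemma side_eq_if_side_height: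
  assumes n: "n \<ge> 2" and z: "z \<in> punctured_polygon n" "side_height n k z = apothem n"
  shows "z \<in> open_segment (vertex n k) (vertex n (Suc k))"
proof -
  have n0: "n > 0" using n by simp
  have le: "side_height n j z \<le> apothem n" for j
    using z(1) punctured_polygon_iff[OF n] by auto
  have nv: "z \<notin> range (vertex n)" using z(1) punctured_polygon_iff[OF n] by auto
  define w where "w = z * cnj (side_normal n k)"
  have zw: "z = side_normal n k * w"
    by (simp add: w_def mult.left_commute[of _ z] mult.assoc)
  have Rw: "Re w = apothem n" using z(2) by (simp add: w_def side_height_def)
  define a where "a = pi / (2 * real n)"
  have pn: "pi / n = 2 * a" by (simp add: a_def)
  have sa: "sin a > 0" using sin_half_angle_pos[OF n0] by (simp add: a_def)
  have "0 < a" "a < pi / 2" using n by (auto simp: a_def field_simps)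
  then have ca: "cos a > 0" using cos_gt_zero by blast
  have ap: "apothem n = cos a / (2 * sin a)" by (simp add: apothem_def a_def)
  have neigh: "apothem n * cos (j * pi / n) + Im w * sin (j * pi / n) \<le> apothem n" for j :: nat
  proof -
    have "side_height n (k + j) z = Re (w * cnj (cis (j * pi / n)))"
      by (simp add: side_height_def side_normal_add w_def mult.assoc)
    then show ?thesis using le[of "k + j"] Rw by simp
  qed
  have c2: "1 - cos (2 * a) = 2 * (sin a)\<^sup>2" by (simp add: cos_double_sin)
  have s2: "sin (2 * a) = 2 * sin a * cos a" by (simp add: sin_double)
  have up: "t \<le> 1 / 2" if "apothem n * cos (2 * a) + t * sin (2 * a) \<le> apothem n" for t
  proof -
    have "t * sin (2 * a) \<le> apothem n * (1 - cos (2 * a))"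
      using that by (simp add: right_diff_distrib)
    then have "t * (2 * sin a * cos a) \<le> apothem n * (1 - cos (2 * a))" by (simp only: s2)
    also have "\<dots> = sin a * cos a" using sa by (simp add: c2 ap power2_eq_square)
    also have "\<dots> = (1 / 2) * (2 * sin a * cos a)" by simp
    finally show ?thesis using sa ca by (simp add: mult_le_cancel_right del: mult.assoc)
  qed
  have "Im w \<le> 1 / 2" using up[of "Im w"] neigh[of 1] pn by simp
  moreover have "- Im w \<le> 1 / 2"
  proof (rule up)
    \<comment> \<open>Adding \<open>2 * n - 1\<close> to an index plays the part of subtracting 1:
      it reaches the preceding side.\<close>
    have "real (2 * n - 1) * pi / n = 2 * pi - 2 * a" using n by (simp add: a_def of_nat_diff field_simps)
    then show "apothem n * cos (2 * a) + - Im w * sin (2 * a) \<le> apothem n"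
      using neigh[of "2 * n - 1"] by (simp add: cos_diff sin_diff)
  qed
  ultimately have u: "0 \<le> Im w + 1 / 2" "Im w + 1 / 2 \<le> 1" by auto
  have "w = (1 - (Im w + 1 / 2)) *\<^sub>R Complex (apothem n) (- 1 / 2) + (Im w + 1 / 2) *\<^sub>R Complex (apothem n) (1 / 2)"
    using Rw by (simp add: complex_eq_iff algebra_simps)
  then have "z = side_normal n k * ((1 - (Im w + 1 / 2)) *\<^sub>R Complex (apothem n) (- 1 / 2) + (Im w + 1 / 2) *\<^sub>R Complex (apothem n) (1 / 2))"
    using zw by simp
  then have "z = (1 - (Im w + 1 / 2)) *\<^sub>R vertex n k + (Im w + 1 / 2) *\<^sub>R vertex n (Suc k)"
    by (simp only: vertex_eq_normal(1)[OF n0, of k] vertex_eq_normal(2)[OF n0, of k] distrib_left mult_scaleR_right)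
  with u have "z \<in> closed_segment (vertex n k) (vertex n (Suc k))"
    by (auto simp: closed_segment_def intro!: exI[where x = "Im w + 1 / 2"])
  with nv show ?thesis by (auto simp: open_segment_def)
qed

lemma side_heights_on_side:
  assumes n: "n \<ge> 2" and z: "z \<in> open_segment (vertex n k) (vertex n (Suc k))"
  shows "side_height n k z = apothem n" "z \<in> punctured_polygon n"
    "j mod (2 * n) \<noteq> k mod (2 * n) \<Longrightarrow> side_height n j z < apothem n"
proof -
  have n0: "n > 0" using n by simp
  obtain u where u: "0 < u" "u < 1" "z = (1 - u) *\<^sub>R vertex n k + u *\<^sub>R vertex n (Suc k)"
    using z by (auto simp: in_segment)
  have h: "side_height n j z = (1 - u) * side_height n j (vertex n k) + u * side_height n j (vertex n (Suc k))" for j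
    using u by (simp add: convex_combination_side_height)
  have le: "side_height n j (vertex n i) \<le> apothem n" for i j
    using side_height_vertex_cases[OF n0, of i j] by auto
  have ak: "side_height n k (vertex n k) = apothem n" "side_height n k (vertex n (Suc k)) = apothem n"
    using side_height_vertex_cases[OF n0, of k k] side_height_vertex_cases[OF n0, of "Suc k" k] by auto
  show 1: "side_height n k z = apothem n" using h[of k] ak by (simp add: algebra_simps)
  show "z \<in> punctured_polygon n"
    unfolding punctured_polygon_iff[OF n]
  proof (intro conjI allI)
    fix j
    have "side_height n j z \<le> (1 - u) * apothem n + u * apothem n"
      unfolding h[of j] using u le by (intro add_mono mult_left_mono) auto
    then show "side_height n j z \<le> apothem n" by (simp add: algebra_simps)
  next
    show "z \<notin> range (vertex n)"
    proof
      assume "z \<in> range (vertex n)"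
      then obtain i where i: "z = vertex n i" by auto
      with 1 side_height_vertex_cases[OF n0, of i k] have "i mod (2 * n) = k mod (2 * n) \<or> i mod (2 * n) = Suc k mod (2 * n)"
        by auto
      then have "vertex n i = vertex n k \<or> vertex n i = vertex n (Suc k)"
        by (metis vertex_mod[OF n0])
      with i z show False by (auto simp: open_segment_def)
    qed
  qed
  show "side_height n j z < apothem n" if j: "j mod (2 * n) \<noteq> k mod (2 * n)"
  proof -
    \<comment> \<open>Both ends of side \<open>k\<close> on another side \<open>j\<close> would
      force \<open>k = j + 1\<close>, and \<open>k + 1\<close> to be \<open>j\<close> or
      \<open>j + 1\<close>, modulo \<open>2 * n\<close>. This is impossible for
      \<open>2 * n \<ge> 4\<close>.\<close>
    have "side_height n j (vertex n k) < apothem n \<or> side_height n j (vertex n (Suc k)) < apothem n"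
    proof (rule ccontr)
      assume "\<not> ?thesis"
      then have "k mod (2 * n) = Suc j mod (2 * n)" "Suc k mod (2 * n) = j mod (2 * n) \<or> Suc k mod (2 * n) = Suc j mod (2 * n)"
        using side_height_vertex_cases[OF n0, of k j] side_height_vertex_cases[OF n0, of "Suc k" j] j by auto
      then have "Suc (Suc j) mod (2 * n) = j mod (2 * n) \<or> Suc (Suc j) mod (2 * n) = Suc j mod (2 * n)"
        by (metis mod_Suc_eq)
      then show False using n by (auto simp: mod_Suc split: if_splits)
    qed
    then show ?thesis
    proof
      assume *: "side_height n j (vertex n k) < apothem n"
      have "side_height n j z < (1 - u) * apothem n + u * apothem n"
        unfolding h[of j] using u le * by (intro add_less_le_mono mult_left_mono mult_strict_left_mono) auto
      then show ?thesis by (simp add: algebra_simps)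
    next
      assume *: "side_height n j (vertex n (Suc k)) < apothem n"
      have "side_height n j z < (1 - u) * apothem n + u * apothem n"
        unfolding h[of j] using u le * by (intro add_le_less_mono mult_left_mono mult_strict_left_mono) auto
      then show ?thesis by (simp add: algebra_simps)
    qed
  qed
qed

lemma side_height_unique:
  assumes "n \<ge> 2" "z \<in> punctured_polygon n" "side_height n k z = apothem n" "side_height n j z = apothem n"
  shows "j mod (2 * n) = k mod (2 * n)"
proof (rule ccontr)
  assume "\<not> ?thesis"
  from side_heights_on_side(3)[OF assms(1) side_eq_if_side_height[OF assms(1,2,3)] this]
  show False using assms(4) by simp
qed

lemma side_normal_cong: "\<lbrakk>n > 0; j mod (2 * n) = k mod (2 * n)\<rbrakk> \<Longrightarrow> side_normal n j = side_normal n k"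
  using side_normal_mod[of n j] side_normal_mod[of n k] by metis

lemma side_width_cong: "\<lbrakk>n > 0; j mod (2 * n) = k mod (2 * n)\<rbrakk> \<Longrightarrow> side_width n j = side_width n k"
  unfolding side_width_def using side_normal_cong by metis

text \<open>The translation subtracts the sum of the two ends, and opposite vertices are negatives
  of each other; so the point with parameter \<open>u\<close> on the side goes to the point with
  parameter \<open>1 - u\<close> on the opposite one.\<close>

lemma side_translate:
  assumes n: "n \<ge> 2" and z: "z \<in> punctured_polygon n" "side_height n k z = apothem n"
  shows "z - side_width n k \<in> punctured_polygon n" "side_height n (k + n) (z - side_width n k) = apothem n"
proof -
  have n0: "n > 0" using n by simp
  show h: "side_height n (k + n) (z - side_width n k) = apothem n"
    using z(2) by (simp add: side_height_shift[OF n0] side_height_diff side_height_width)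
  obtain u where u: "0 < u" "u < 1" "z = (1 - u) *\<^sub>R vertex n k + u *\<^sub>R vertex n (Suc k)"
    using side_eq_if_side_height[OF n z] by (auto simp: in_segment)
  have "vertex n k \<noteq> vertex n (Suc k)"
    using side_eq_if_side_height[OF n z] by auto
  moreover have "vertex n (Suc (k + n)) = - vertex n (Suc k)" using vertex_shift[OF n0, of "Suc k"] by simp
  moreover have "z - side_width n k = (1 - (1 - u)) *\<^sub>R vertex n (k + n) + (1 - u) *\<^sub>R vertex n (Suc (k + n))"
    using u by (simp add: side_width_eq[OF n0] vertex_shift[OF n0] calculation(2) algebra_simps)
  ultimately have "z - side_width n k \<in> open_segment (vertex n (k + n)) (vertex n (Suc (k + n)))"
    using u by (auto simp: in_segment vertex_shift[OF n0] intro!: exI[where x = "1 - u"])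
  then show "z - side_width n k \<in> punctured_polygon n" by (rule side_heights_on_side(2)[OF n])
qed

section \<open>The gluing of opposite sides\<close>

lemma gluing_iff:
  assumes n: "n \<ge> 2"
  shows "(z, z') \<in> gluing n \<longleftrightarrow> z \<in> punctured_polygon n \<and>
     (z' = z \<or> (\<exists>k. side_height n k z = apothem n \<and> z' = z - side_width n k))"
proof -
  have n0: "n > 0" using n by simp
  have eq: "vertex n (k + n + 1) - vertex n k = - side_width n k" for k
    using vertex_shift[OF n0, of "Suc k"] by (simp add: side_width_eq[OF n0])
  have "z \<in> open_segment (vertex n k) (vertex n (Suc k)) \<longleftrightarrow>
      z \<in> punctured_polygon n \<and> side_height n k z = apothem n" for k
    using side_eq_if_side_height[OF n] side_heights_on_side[OF n] by blast
  then show ?thesis unfolding gluing_def eq by auto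
qed

text \<open>A point that is not a vertex lies on at most one side, so a translated point can only be
  moved back: two nontrivial gluings in a row cancel. This is what makes the relation
  transitive.\<close>

lemma equiv_gluing:
  assumes n: "n \<ge> 2" shows "equiv (punctured_polygon n) (gluing n)"
proof -
  have n0: "n > 0" using n by simp
  have sub: "gluing n \<subseteq> punctured_polygon n \<times> punctured_polygon n"
    using gluing_iff[OF n] side_translate[OF n] by auto
  have opp: "side_width n j = - side_width n k"
    if "z \<in> punctured_polygon n" "side_height n k z = apothem n"
      "side_height n j (z - side_width n k) = apothem n" for z j k
    using side_height_unique[OF n side_translate(1)[OF n that(1,2)] that(3) side_translate(2)[OF n that(1,2)]]
      side_width_cong[OF n0, of "k + n" j] side_width_shift[OF n0, of k] by simp
  have "refl_on (punctured_polygon n) (gluing n)"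
    using gluing_iff[OF n] by (auto simp: refl_on_def)
  moreover have "sym (gluing n)"
  proof (rule symI)
    fix z z' assume zz: "(z, z') \<in> gluing n"
    then consider "z' = z" | k where "side_height n k z = apothem n" "z' = z - side_width n k"
      using gluing_iff[OF n] by auto
    then show "(z', z) \<in> gluing n"
    proof cases
      case 2
      with zz have "z' \<in> punctured_polygon n" "side_height n (k + n) z' = apothem n"
        using side_translate[OF n] gluing_iff[OF n] by auto
      moreover have "z = z' - side_width n (k + n)" using 2 side_width_shift[OF n0] by simp
      ultimately show ?thesis using gluing_iff[OF n] by blast
    qed (use zz in simp)
  qed
  moreover have "trans (gluing n)"
  proof (rule transI)
    fix x y z assume xy: "(x, y) \<in> gluing n" and yz: "(y, z) \<in> gluing n"
    then have x: "x \<in> punctured_polygon n" using gluing_iff[OF n] by auto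
    show "(x, z) \<in> gluing n"
    proof (cases "x = y \<or> y = z")
      case True with xy yz show ?thesis by auto
    next
      case False
      obtain k where k: "side_height n k x = apothem n" "y = x - side_width n k"
        using xy gluing_iff[OF n, of x y] False by auto
      obtain j where j: "side_height n j y = apothem n" "z = y - side_width n j"
        using yz gluing_iff[OF n, of y z] False by auto
      have "z = x" using opp[OF x k(1), of j] j k by simp
      with x show ?thesis using gluing_iff[OF n] by auto
    qed
  qed
  ultimately show ?thesis using sub by (simp add: equiv_def)
qed

lemma glue_class_eq_iff:
  assumes n: "n \<ge> 2" and z: "z \<in> punctured_polygon n" "z' \<in> punctured_polygon n"
  shows "glue_class n z = glue_class n z' \<longleftrightarrow>
     z' = z \<or> (\<exists>k. side_height n k z = apothem n \<and> z' = z - side_width n k)"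
proof -
  have "glue_class n z = glue_class n z' \<longleftrightarrow> (z, z') \<in> gluing n"
    unfolding glue_class_def by (rule eq_equiv_class_iff[OF equiv_gluing[OF n] z])
  with gluing_iff[OF n, of z z'] z(1) show ?thesis by (simp only: simp_thms)
qed

text \<open>A vertex inside a segment would put the end \<open>x\<close> of the segment on both
  sides that meet at this vertex, but a point of the polygon other than a vertex lies on at most one
  side.\<close>

lemma convex_punctured_polygon:
  assumes n: "n \<ge> 2" shows "convex (punctured_polygon n)"
  unfolding convex_alt
proof (intro ballI allI impI)
  fix x y and u :: real
  assume x: "x \<in> punctured_polygon n" and y: "y \<in> punctured_polygon n" and u: "0 \<le> u \<and> u \<le> 1"
  have n0: "n > 0" using n by simp
  let ?z = "(1 - u) *\<^sub>R x + u *\<^sub>R y"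
  have le: "side_height n k x \<le> apothem n" "side_height n k y \<le> apothem n" for k
    using x y punctured_polygon_iff[OF n] by auto
  show "?z \<in> punctured_polygon n"
  proof (cases "u = 0 \<or> u = 1")
    case False
    then have u': "0 < u" "u < 1" using u by auto
    show ?thesis
      unfolding punctured_polygon_iff[OF n]
    proof (intro conjI allI)
      fix k
      have "side_height n k ?z \<le> (1 - u) * apothem n + u * apothem n"
        unfolding convex_combination_side_height using u le by (intro add_mono mult_left_mono) auto
      then show "side_height n k ?z \<le> apothem n" by (simp add: algebra_simps)
    next
      have ext: "side_height n k x = apothem n" if "side_height n k ?z = apothem n" for k
      proof (rule ccontr)
        assume "side_height n k x \<noteq> apothem n"
        then have "side_height n k x < apothem n" using le[of k] by simp
        then have "side_height n k ?z < (1 - u) * apothem n + u * apothem n"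
          unfolding convex_combination_side_height using u' le
          by (intro add_less_le_mono mult_left_mono mult_strict_left_mono) auto
        with that show False by (simp add: algebra_simps)
      qed
      show "?z \<notin> range (vertex n)"
      proof
        assume "?z \<in> range (vertex n)"
        then obtain i where i: "?z = vertex n i" by auto
        \<comment> \<open>The side before side \<open>i\<close>; it ends at vertex
          \<open>i\<close>.\<close>
        let ?j = "i + (2 * n - 1)"
        have ij: "Suc ?j = i + 2 * n" using n by simp
        have "side_height n i ?z = apothem n" "side_height n ?j ?z = apothem n"
          using side_height_vertex_cases[OF n0, of i i] side_height_vertex_cases[OF n0, of i ?j] ij
          by (auto simp: i)
        then have "?j mod (2 * n) = i mod (2 * n)" using side_height_unique[OF n x] ext by blast
        then have "Suc i mod (2 * n) = i mod (2 * n)" using ij by (metis mod_Suc_eq mod_add_self2)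
        then show False using n by (auto simp: mod_Suc split: if_splits)
      qed
    qed
  qed (use x y in auto)
qed

lemma continuous_map_glue_class:
  "continuous_map (top_of_set (punctured_polygon n)) (polygon_topology n) (glue_class n)"
  "quotient_map (top_of_set (punctured_polygon n)) (polygon_topology n) (glue_class n)"
proof -
  show "quotient_map (top_of_set (punctured_polygon n)) (polygon_topology n) (glue_class n)"
    unfolding polygon_topology_def by (rule quotient_map_quotient_topology)
  then show "continuous_map (top_of_set (punctured_polygon n)) (polygon_topology n) (glue_class n)"
    by (rule quotient_imp_continuous_map)
qed

lemma topspace_polygon_topology: "topspace (polygon_topology n) = glue_class n ` punctured_polygon n"
  by (simp add: polygon_topology_def topspace_quotient_topology)

lemma openin_polygon_topology:
  "openin (polygon_topology n) V \<longleftrightarrow> V \<subseteq> glue_class n ` punctured_polygon n \<and>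
     openin (top_of_set (punctured_polygon n)) {z \<in> punctured_polygon n. glue_class n z \<in> V}"
  by (simp add: polygon_topology_def openin_quotient_topology)

section \<open>Affine maps of translation surfaces\<close>

lemma matrix_act_add: "matrix_act A (z + w) = matrix_act A z + matrix_act A w"
  and matrix_act_diff: "matrix_act A (z - w) = matrix_act A z - matrix_act A w"
  and matrix_act_scaleR: "matrix_act A (c *\<^sub>R z) = c *\<^sub>R matrix_act A z"
  by (simp_all add: matrix_act_def complex_eq_iff algebra_simps)

lemma matrix_act_mult: "matrix_act (A ** B) z = matrix_act A (matrix_act B z)"
  by (simp add: matrix_act_def complex_eq_iff matrix_matrix_mult_def sum_2 algebra_simps)

lemma matrix_act_one [simp]: "matrix_act (mat 1) z = z"
  by (simp add: matrix_act_def complex_eq_iff mat_def)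

lemma bounded_linear_matrix_act: "bounded_linear (matrix_act A)"
proof -
  have "linear (matrix_act A)" by (rule linearI) (simp_all only: matrix_act_add matrix_act_scaleR)
  then show ?thesis by (simp only: linear_conv_bounded_linear)
qed

lemma continuous_on_matrix_act [continuous_intros]:
  "continuous_on S f \<Longrightarrow> continuous_on S (\<lambda>x. matrix_act A (f x))"
  by (rule bounded_linear.continuous_on[OF bounded_linear_matrix_act])

text \<open>No sign occurs here, in contrast to \<open>affine_with_derivative\<close>: a translation
  atlas fixes a square root of the differential, so the derivative is a matrix and not a matrix up
  to sign.\<close>

definition locally_affine :: "'b surface \<Rightarrow> ('b \<Rightarrow> 'b) \<Rightarrow> real^2^2 \<Rightarrow> bool" where
  "locally_affine P \<alpha> A \<longleftrightarrow>
     (\<forall>U w V w' x. (U, w) \<in> atlas P \<longrightarrow> (V, w') \<in> atlas P \<longrightarrow> x \<in> U \<longrightarrow> \<alpha> x \<in> V \<longrightarrow>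
        (\<exists>W c. openin (surface_topology P) W \<and> x \<in> W \<and> W \<subseteq> {y \<in> U. \<alpha> y \<in> V} \<and>
           (\<forall>y \<in> W. w' (\<alpha> y) = matrix_act A (w y) + c)))"

lemma locally_affineE:
  assumes "locally_affine P \<alpha> A" "(U, w) \<in> atlas P" "(V, w') \<in> atlas P" "x \<in> U" "\<alpha> x \<in> V"
  obtains W c where "openin (surface_topology P) W" "x \<in> W" "W \<subseteq> U" "\<And>y. y \<in> W \<Longrightarrow> \<alpha> y \<in> V"
    "\<And>y. y \<in> W \<Longrightarrow> w' (\<alpha> y) = matrix_act A (w y) + c"
proof -
  obtain W c where "openin (surface_topology P) W" "x \<in> W" "W \<subseteq> {y \<in> U. \<alpha> y \<in> V}"
      "\<forall>y \<in> W. w' (\<alpha> y) = matrix_act A (w y) + c"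
    using assms(1)[unfolded locally_affine_def, rule_format, OF assms(2-5)] by (elim exE conjE) (rule that)
  then show ?thesis by (intro that[of W c]) auto
qed

definition affine_automorphism :: "'b surface \<Rightarrow> ('b \<Rightarrow> 'b) \<Rightarrow> real^2^2 \<Rightarrow> bool" where
  "affine_automorphism P \<alpha> A \<longleftrightarrow>
     homeomorphic_map (surface_topology P) (surface_topology P) \<alpha> \<and> locally_affine P \<alpha> A"

text \<open>The last condition, that the identity has derivative \<open>mat 1\<close> between any
  two charts, expresses that transition maps are locally translations.\<close>

definition translation_surface :: "'b surface \<Rightarrow> bool" where
  "translation_surface P \<longleftrightarrow>
     (\<forall>(U, w) \<in> atlas P. coordinate_on (surface_topology P) U w) \<and>
     \<Union> (fst ` atlas P) = points P \<and> locally_affine P (\<lambda>x. x) (mat 1)"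

lemma translation_surface_chart:
  assumes "translation_surface P" "x \<in> points P"
  obtains U w where "(U, w) \<in> atlas P" "x \<in> U"
proof -
  have "x \<in> \<Union> (fst ` atlas P)" using assms unfolding translation_surface_def by simp
  then show ?thesis using that by auto
qed

lemma translation_surface_open:
  assumes "translation_surface P" "(U, w) \<in> atlas P"
  shows "openin (surface_topology P) U"
  using assms unfolding translation_surface_def coordinate_on_def by auto

lemma affine_automorphism_compose:
  assumes P: "translation_surface P" and \<alpha>: "affine_automorphism P \<alpha> A" and \<beta>: "affine_automorphism P \<beta> B"
  shows "affine_automorphism P (\<beta> \<circ> \<alpha>) (B ** A)"
  unfolding affine_automorphism_def
proof
  let ?T = "surface_topology P"
  have ca: "continuous_map ?T ?T \<alpha>" using \<alpha> by (simp add: affine_automorphism_def homeomorphic_imp_continuous_map)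
  show "homeomorphic_map ?T ?T (\<beta> \<circ> \<alpha>)"
    using \<alpha> \<beta> by (auto simp: affine_automorphism_def intro: homeomorphic_map_compose)
  show "locally_affine P (\<beta> \<circ> \<alpha>) (B ** A)"
    unfolding locally_affine_def
  proof (intro allI impI)
    fix U w V w' x assume ch: "(U, w) \<in> atlas P" "(V, w') \<in> atlas P" "x \<in> U" "(\<beta> \<circ> \<alpha>) x \<in> V"
    have "x \<in> points P" using translation_surface_open[OF P ch(1)] ch(3) openin_subset by blast
    then have "\<alpha> x \<in> points P" using ca by (auto simp: continuous_map_def)
    then obtain Z u where Z: "(Z, u) \<in> atlas P" "\<alpha> x \<in> Z" using translation_surface_chart[OF P] by blast
    have la: "locally_affine P \<alpha> A" "locally_affine P \<beta> B" using \<alpha> \<beta> by (auto simp: affine_automorphism_def)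
    obtain W c where W: "openin ?T W" "x \<in> W" "W \<subseteq> U" "\<And>y. y \<in> W \<Longrightarrow> \<alpha> y \<in> Z"
        "\<And>y. y \<in> W \<Longrightarrow> u (\<alpha> y) = matrix_act A (w y) + c"
      using locally_affineE[OF la(1) ch(1) Z(1) ch(3) Z(2)] by metis
    have "\<beta> (\<alpha> x) \<in> V" using ch(4) by simp
    then obtain W' c' where W': "openin ?T W'" "\<alpha> x \<in> W'" "W' \<subseteq> Z" "\<And>y. y \<in> W' \<Longrightarrow> \<beta> y \<in> V"
        "\<And>y. y \<in> W' \<Longrightarrow> w' (\<beta> y) = matrix_act B (u y) + c'"
      using locally_affineE[OF la(2) Z(1) ch(2) Z(2)] by metis
    let ?W = "W \<inter> {y \<in> topspace ?T. \<alpha> y \<in> W'}"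
    have "openin ?T ?W" using openin_Int[OF W(1) openin_continuous_map_preimage[OF ca W'(1)]] .
    moreover have "x \<in> ?W" using W W' \<open>x \<in> points P\<close> by auto
    moreover have "?W \<subseteq> {y \<in> U. (\<beta> \<circ> \<alpha>) y \<in> V}" using W W' by auto
    moreover have "\<forall>y \<in> ?W. w' ((\<beta> \<circ> \<alpha>) y) = matrix_act (B ** A) (w y) + (matrix_act B c + c')"
      using W W' by (auto simp: matrix_act_mult matrix_act_add)
    ultimately show "\<exists>W c. openin ?T W \<and> x \<in> W \<and> W \<subseteq> {y \<in> U. (\<beta> \<circ> \<alpha>) y \<in> V} \<and>
           (\<forall>y \<in> W. w' ((\<beta> \<circ> \<alpha>) y) = matrix_act (B ** A) (w y) + c)"
      by (intro exI conjI)
  qed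
qed

lemma affine_automorphism_inverse:
  assumes P: "translation_surface P" and \<alpha>: "affine_automorphism P \<alpha> A"
    and \<beta>: "homeomorphic_maps (surface_topology P) (surface_topology P) \<alpha> \<beta>" and BA: "B ** A = mat 1"
  shows "affine_automorphism P \<beta> B"
  unfolding affine_automorphism_def
proof
  let ?T = "surface_topology P"
  show "homeomorphic_map ?T ?T \<beta>" using \<beta> homeomorphic_maps_map by blast
  have cb: "continuous_map ?T ?T \<beta>" and ab: "\<And>y. y \<in> topspace ?T \<Longrightarrow> \<alpha> (\<beta> y) = y"
    using \<beta> by (auto simp: homeomorphic_maps_def)
  show "locally_affine P \<beta> B"
    unfolding locally_affine_def
  proof (intro allI impI)
    fix U w V w' x assume ch: "(U, w) \<in> atlas P" "(V, w') \<in> atlas P" "x \<in> U" "\<beta> x \<in> V"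
    have UP: "U \<subseteq> topspace ?T" using translation_surface_open[OF P ch(1)] openin_subset by blast
    then have x: "x \<in> points P" using ch(3) by blast
    have la: "locally_affine P \<alpha> A" using \<alpha> by (auto simp: affine_automorphism_def)
    have "\<alpha> (\<beta> x) \<in> U" using ab[OF x] ch(3) by simp
    then obtain W c where W: "openin ?T W" "\<beta> x \<in> W" "W \<subseteq> V" "\<And>y. y \<in> W \<Longrightarrow> \<alpha> y \<in> U"
        "\<And>y. y \<in> W \<Longrightarrow> w (\<alpha> y) = matrix_act A (w' y) + c"
      using locally_affineE[OF la ch(2,1,4)] by metis
    let ?W = "{y \<in> topspace ?T. \<beta> y \<in> W}"
    have "openin ?T ?W" by (rule openin_continuous_map_preimage[OF cb W(1)])
    moreover have "x \<in> ?W" using x W(2) by simp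
    moreover have "?W \<subseteq> {y \<in> U. \<beta> y \<in> V}" using W(3,4) ab by force
    moreover have "w' (\<beta> y) = matrix_act B (w y) + (- matrix_act B c)" if "y \<in> ?W" for y
    proof -
      have "w y = matrix_act A (w' (\<beta> y)) + c" using W(5)[of "\<beta> y"] ab[of y] that by simp
      then have "matrix_act B (w y) = w' (\<beta> y) + matrix_act B c"
        using BA by (simp add: matrix_act_add matrix_act_mult[symmetric])
      then show ?thesis by simp
    qed
    ultimately show "\<exists>W c. openin ?T W \<and> x \<in> W \<and> W \<subseteq> {y \<in> U. \<beta> y \<in> V} \<and>
           (\<forall>y \<in> W. w' (\<beta> y) = matrix_act B (w y) + c)" by blast
  qed
qed

section \<open>Maps of the polygon surface defined on the polygon\<close>

lemma openin_top_of_set_iff_eventually: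
  "openin (top_of_set S) M \<longleftrightarrow> M \<subseteq> S \<and> (\<forall>a \<in> M. \<forall>\<^sub>F z in at a within S. z \<in> M)"
proof
  assume "openin (top_of_set S) M"
  then obtain G where "open G" "M = S \<inter> G" by (auto simp: openin_open)
  then show "M \<subseteq> S \<and> (\<forall>a \<in> M. \<forall>\<^sub>F z in at a within S. z \<in> M)"
    unfolding eventually_at_topological by auto
next
  assume M: "M \<subseteq> S \<and> (\<forall>a \<in> M. \<forall>\<^sub>F z in at a within S. z \<in> M)"
  show "openin (top_of_set S) M"
  proof (subst openin_subopen, intro ballI)
    fix a assume a: "a \<in> M"
    then obtain G where G: "open G" "a \<in> G" "\<forall>z \<in> G. z \<noteq> a \<longrightarrow> z \<in> S \<longrightarrow> z \<in> M"
      using M unfolding eventually_at_topological by auto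
    then have "openin (top_of_set S) (S \<inter> G)" "a \<in> S \<inter> G" "S \<inter> G \<subseteq> M"
      using a M by (auto simp: openin_open)
    then show "\<exists>T. openin (top_of_set S) T \<and> a \<in> T \<and> T \<subseteq> M" by blast
  qed
qed

lemma polygon_surface_simps [simp]:
  "surface_topology (polygon_surface n) = polygon_topology n"
  by (simp add: polygon_surface_def)

lemma polygon_atlas_iff:
  "(U, w) \<in> atlas (polygon_surface n) \<longleftrightarrow> coordinate_on (polygon_topology n) U w \<and>
     (\<forall>a \<in> punctured_polygon n. glue_class n a \<in> U \<longrightarrow>
        (\<forall>\<^sub>F z in at a within punctured_polygon n. w (glue_class n z) - z = w (glue_class n a) - a))"
  by (simp add: polygon_surface_def)

text \<open>The difference between \<open>w' (\<alpha> y)\<close> and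
  \<open>matrix_act A (w y)\<close> has to be locally constant on the quotient. Its level sets are
  open there as soon as their preimages in the polygon are, and in the polygon \<open>w\<close> may
  locally be replaced by the coordinate \<open>z\<close>.\<close>

lemma locally_affine_polygonI:
  assumes cont: "continuous_map (polygon_topology n) (polygon_topology n) \<alpha>"
    and ev: "\<And>a V w. \<lbrakk>a \<in> punctured_polygon n; (V, w) \<in> atlas (polygon_surface n); \<alpha> (glue_class n a) \<in> V\<rbrakk> \<Longrightarrow>
      \<forall>\<^sub>F z in at a within punctured_polygon n.
        w (\<alpha> (glue_class n z)) - matrix_act A z = w (\<alpha> (glue_class n a)) - matrix_act A a"
  shows "locally_affine (polygon_surface n) \<alpha> A"
  unfolding locally_affine_def
proof (intro allI impI)
  fix U w V w' x
  assume ch: "(U, w) \<in> atlas (polygon_surface n)" "(V, w') \<in> atlas (polygon_surface n)" "x \<in> U" "\<alpha> x \<in> V"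
  let ?S = "punctured_polygon n" and ?T = "polygon_topology n"
  have "openin ?T U" "openin ?T V" using ch by (auto simp: polygon_atlas_iff coordinate_on_def)
  define W0 where "W0 = U \<inter> {y \<in> topspace ?T. \<alpha> y \<in> V}"
  have W0: "openin ?T W0"
    unfolding W0_def using openin_Int[OF \<open>openin ?T U\<close> openin_continuous_map_preimage[OF cont \<open>openin ?T V\<close>]] .
  define F where "F y = w' (\<alpha> y) - matrix_act A (w y)" for y
  define W where "W = {y \<in> W0. F y = F x}"
  have pre: "openin (top_of_set ?S) {z \<in> ?S. glue_class n z \<in> W0}" 
    using W0 by (simp add: openin_polygon_topology)
  have "openin (top_of_set ?S) {z \<in> ?S. glue_class n z \<in> W}"
    unfolding openin_top_of_set_iff_eventually
  proof (intro conjI ballI)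
    fix a assume "a \<in> {z \<in> ?S. glue_class n z \<in> W}"
    then have a: "a \<in> ?S" "glue_class n a \<in> W0" "F (glue_class n a) = F x" by (auto simp: W_def)
    have e1: "\<forall>\<^sub>F z in at a within ?S. z \<in> {z \<in> ?S. glue_class n z \<in> W0}"
      using pre a unfolding openin_top_of_set_iff_eventually by blast
    have aU: "glue_class n a \<in> U" "\<alpha> (glue_class n a) \<in> V" using a(2) by (auto simp: W0_def)
    have e2: "\<forall>\<^sub>F z in at a within ?S. w (glue_class n z) - z = w (glue_class n a) - a"
      using ch(1) a(1) aU(1) by (simp add: polygon_atlas_iff)
    show "\<forall>\<^sub>F z in at a within ?S. z \<in> {z \<in> ?S. glue_class n z \<in> W}"
      using e1 e2 ev[OF a(1) ch(2) aU(2)]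
    proof eventually_elim
      case (elim z)
      have wz: "w (glue_class n z) = w (glue_class n a) - a + z" using elim(2) by (simp add: algebra_simps)
      have "matrix_act A (w (glue_class n z)) =
          matrix_act A (w (glue_class n a)) - matrix_act A a + matrix_act A z"
        by (simp only: wz matrix_act_add matrix_act_diff)
      then have e1: "matrix_act A (w (glue_class n z)) - matrix_act A (w (glue_class n a)) =
          matrix_act A z - matrix_act A a" by simp
      have "F (glue_class n z) - F (glue_class n a) =
          (w' (\<alpha> (glue_class n z)) - matrix_act A z - (w' (\<alpha> (glue_class n a)) - matrix_act A a)) -
          (matrix_act A (w (glue_class n z)) - matrix_act A (w (glue_class n a)) - (matrix_act A z - matrix_act A a))"
        by (simp add: F_def)
      then have "F (glue_class n z) = F (glue_class n a)" unfolding e1 elim(3) by simp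
      with elim(1) a(3) show ?case by (simp add: W_def)
    qed
  qed auto
  moreover have "W \<subseteq> glue_class n ` ?S"
    using openin_subset[OF W0] by (auto simp: W_def topspace_polygon_topology)
  ultimately have "openin ?T W" by (simp add: openin_polygon_topology)
  moreover have "x \<in> W" using ch(3,4) openin_subset[OF \<open>openin ?T U\<close>] by (auto simp: W_def W0_def)
  moreover have "W \<subseteq> {y \<in> U. \<alpha> y \<in> V}" by (auto simp: W_def W0_def)
  moreover have "\<forall>y \<in> W. w' (\<alpha> y) = matrix_act A (w y) + F x" by (auto simp: W_def F_def algebra_simps)
  ultimately show "\<exists>W c. openin (surface_topology (polygon_surface n)) W \<and> x \<in> W \<and>
      W \<subseteq> {y \<in> U. \<alpha> y \<in> V} \<and> (\<forall>y \<in> W. w' (\<alpha> y) = matrix_act A (w y) + c)" 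
    by (intro exI[where x = W] exI[where x = "F x"]) simp
qed

lemma locally_affine_polygon_id: "locally_affine (polygon_surface n) (\<lambda>x. x) (mat 1)"
  by (rule locally_affine_polygonI) (auto simp: polygon_atlas_iff)

text \<open>The pieces share the linear part \<open>A\<close> and differ by translations. Continuity
  is the closed pasting lemma. For affinity near \<open>a\<close>, only the pieces through
  \<open>a\<close> matter; on each of them the constant is determined by the value at
  \<open>a\<close>, so the constants agree.\<close>

lemma polygon_cut_and_paste:
  fixes b :: "'i \<Rightarrow> complex"
  assumes fin: "finite I" and closed: "\<And>i. i \<in> I \<Longrightarrow> closed (Q i)"
    and cover: "\<And>z. z \<in> punctured_polygon n \<Longrightarrow> \<exists>i \<in> I. z \<in> Q i"
    and into: "\<And>i z. \<lbrakk>i \<in> I; z \<in> punctured_polygon n; z \<in> Q i\<rbrakk> \<Longrightarrow> matrix_act A z + b i \<in> punctured_polygon n"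
    and compat: "\<And>i j z z'. \<lbrakk>i \<in> I; j \<in> I; z \<in> punctured_polygon n; z' \<in> punctured_polygon n;
       z \<in> Q i; z' \<in> Q j; glue_class n z = glue_class n z'\<rbrakk> \<Longrightarrow>
       glue_class n (matrix_act A z + b i) = glue_class n (matrix_act A z' + b j)"
  obtains \<alpha> where "continuous_map (polygon_topology n) (polygon_topology n) \<alpha>"
    "locally_affine (polygon_surface n) \<alpha> A"
    "\<And>i z. \<lbrakk>i \<in> I; z \<in> punctured_polygon n; z \<in> Q i\<rbrakk> \<Longrightarrow>
       \<alpha> (glue_class n z) = glue_class n (matrix_act A z + b i)"
proof -
  let ?S = "punctured_polygon n" and ?T = "polygon_topology n"
  define R where "R c d \<longleftrightarrow> (\<exists>i \<in> I. \<exists>z \<in> ?S. z \<in> Q i \<and> glue_class n z = c \<and> glue_class n (matrix_act A z + b i) = d)" for c d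
  define \<alpha> where "\<alpha> c = (SOME d. R c d)" for c
  have \<alpha>: "\<alpha> (glue_class n z) = glue_class n (matrix_act A z + b i)"
    if z: "i \<in> I" "z \<in> ?S" "z \<in> Q i" for i z
    unfolding \<alpha>_def
  proof (rule some_equality)
    show "R (glue_class n z) (glue_class n (matrix_act A z + b i))" using z by (auto simp: R_def)
    show "d = glue_class n (matrix_act A z + b i)" if Rd: "R (glue_class n z) d" for d
    proof -
      obtain j z' where "j \<in> I" "z' \<in> ?S" "z' \<in> Q j" "glue_class n z' = glue_class n z"
          "glue_class n (matrix_act A z' + b j) = d"
        using Rd unfolding R_def by blast
      with compat[of j i z' z] z show ?thesis by simp
    qed
  qed
  have "continuous_map (top_of_set ?S) ?T (\<alpha> \<circ> glue_class n)"
  proof (rule pasting_lemma_closed[where I = I and T = "\<lambda>i. ?S \<inter> Q i"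
        and f = "\<lambda>i. glue_class n \<circ> (\<lambda>z. matrix_act A z + b i)"])
    show "closedin (top_of_set ?S) (?S \<inter> Q i)" if "i \<in> I" for i
      using closed[OF that] by (rule closedin_closed_Int)
    show "continuous_map (subtopology (top_of_set ?S) (?S \<inter> Q i)) ?T
        (glue_class n \<circ> (\<lambda>z. matrix_act A z + b i))" if "i \<in> I" for i
    proof (rule continuous_map_compose[OF _ continuous_map_glue_class(1)])
      show "continuous_map (subtopology (top_of_set ?S) (?S \<inter> Q i)) (top_of_set ?S)
          (\<lambda>z. matrix_act A z + b i)"
        unfolding subtopology_subtopology
        using into[OF that] by (auto simp: continuous_map_in_subtopology intro!: continuous_intros)
    qed
    show "(glue_class n \<circ> (\<lambda>z. matrix_act A z + b i)) z = (glue_class n \<circ> (\<lambda>z. matrix_act A z + b j)) z"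
      if "i \<in> I" "j \<in> I" "z \<in> topspace (top_of_set ?S) \<inter> (?S \<inter> Q i) \<inter> (?S \<inter> Q j)" for i j z
      using compat[of i j z z] that by auto
    show "\<exists>j. j \<in> I \<and> z \<in> ?S \<inter> Q j \<and> (\<alpha> \<circ> glue_class n) z = (glue_class n \<circ> (\<lambda>z. matrix_act A z + b j)) z"
      if "z \<in> topspace (top_of_set ?S)" for z
      using cover[of z] that \<alpha> by auto
  qed (rule fin)
  then have cont: "continuous_map ?T ?T \<alpha>"
    by (rule continuous_compose_quotient_map[OF continuous_map_glue_class(2)])
  moreover have "locally_affine (polygon_surface n) \<alpha> A"
  proof (rule locally_affine_polygonI[OF cont])
    fix a V w assume a: "a \<in> ?S" and V: "(V, w) \<in> atlas (polygon_surface n)" and aV: "\<alpha> (glue_class n a) \<in> V"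
    have "\<forall>\<^sub>F z in at a within ?S. z \<in> Q i \<longrightarrow>
        w (\<alpha> (glue_class n z)) - matrix_act A z = w (\<alpha> (glue_class n a)) - matrix_act A a" if i: "i \<in> I" for i
    proof (cases "a \<in> Q i")
      case False
      have "open (- Q i)" using closed[OF i] by (rule open_Compl)
      with False have "\<forall>\<^sub>F z in at a within ?S. z \<in> - Q i"
        unfolding eventually_at_topological by blast
      then show ?thesis by eventually_elim simp
    next
      case True
      let ?m = "\<lambda>z. matrix_act A z + b i"
      have ma: "?m a \<in> ?S" "glue_class n (?m a) \<in> V" using into[OF i a True] \<alpha>[OF i a True] aV by auto
      then have "\<forall>\<^sub>F u in at (?m a) within ?S. w (glue_class n u) - u = w (glue_class n (?m a)) - ?m a"
        using V by (simp add: polygon_atlas_iff)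
      then obtain E where E: "open E" "?m a \<in> E"
          "\<forall>u \<in> E. u \<noteq> ?m a \<longrightarrow> u \<in> ?S \<longrightarrow> w (glue_class n u) - u = w (glue_class n (?m a)) - ?m a"
        unfolding eventually_at_topological by blast
      have "open (?m -` E)"
        by (rule open_vimage[OF E(1)]) (intro continuous_intros)
      then have "\<forall>\<^sub>F z in at a within ?S. z \<in> ?m -` E \<and> z \<in> ?S"
        unfolding eventually_at_topological using E(2) by (intro exI[where x = "?m -` E"]) auto
      then show ?thesis
      proof eventually_elim
        case (elim z)
        show ?case
        proof
          assume z: "z \<in> Q i"
          have "w (glue_class n (?m z)) - ?m z = w (glue_class n (?m a)) - ?m a"
            using E(3) elim into[OF i _ z] by (cases "?m z = ?m a") auto
          then show "w (\<alpha> (glue_class n z)) - matrix_act A z = w (\<alpha> (glue_class n a)) - matrix_act A a"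
            using \<alpha>[OF i _ z] \<alpha>[OF i a True] elim by (simp add: algebra_simps)
        qed
      qed
    qed
    then have "\<forall>\<^sub>F z in at a within ?S. \<forall>i \<in> I. z \<in> Q i \<longrightarrow>
        w (\<alpha> (glue_class n z)) - matrix_act A z = w (\<alpha> (glue_class n a)) - matrix_act A a"
      by (intro eventually_ball_finite fin ballI)
    moreover have "\<forall>\<^sub>F z in at a within ?S. z \<in> ?S" by (simp add: eventually_at_filter)
    ultimately show "\<forall>\<^sub>F z in at a within ?S.
        w (\<alpha> (glue_class n z)) - matrix_act A z = w (\<alpha> (glue_class n a)) - matrix_act A a"
    proof eventually_elim
      case (elim z)
      with cover[of z] show ?case by blast
    qed
  qed
  ultimately show ?thesis using that \<alpha> by blast
qed

section \<open>Charts of the polygon surface\<close>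

text \<open>Here \<open>\<omega>\<close> develops the saturated set \<open>Op\<close> into the plane
  by local translations, and \<open>\<kappa>\<close> is the inverse on the level of the surface.
  Saturation makes \<open>\<omega>\<close> descend to the quotient.\<close>

lemma polygon_chartI:
  assumes N: "open N" and Op: "openin (top_of_set (punctured_polygon n)) Op"
    and sat: "\<And>z z'. \<lbrakk>z \<in> Op; z' \<in> punctured_polygon n; glue_class n z' = glue_class n z\<rbrakk> \<Longrightarrow> z' \<in> Op \<and> \<omega> z' = \<omega> z"
    and loc: "\<And>a. a \<in> Op \<Longrightarrow> \<forall>\<^sub>F z in at a within punctured_polygon n. \<omega> z - z = \<omega> a - a"
    and \<omega>: "\<And>z. z \<in> Op \<Longrightarrow> \<omega> z \<in> N \<and> \<kappa> (\<omega> z) = glue_class n z"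
    and onto: "\<And>b. b \<in> N \<Longrightarrow> \<exists>z \<in> Op. \<omega> z = b"
    and \<kappa>: "continuous_map (top_of_set N) (polygon_topology n) \<kappa>"
  shows "\<exists>w. (glue_class n ` Op, w) \<in> atlas (polygon_surface n)"
proof -
  let ?S = "punctured_polygon n" and ?T = "polygon_topology n"
  let ?U = "glue_class n ` Op"
  have OpS: "Op \<subseteq> ?S" using Op by (rule openin_imp_subset)
  define w where "w c = \<omega> (SOME z. z \<in> Op \<and> glue_class n z = c)" for c
  have w: "w (glue_class n z) = \<omega> z" if "z \<in> Op" for z
  proof -
    define z' where "z' = (SOME z'. z' \<in> Op \<and> glue_class n z' = glue_class n z)"
    have "z' \<in> Op \<and> glue_class n z' = glue_class n z"
      unfolding z'_def by (rule someI[where x = z]) (simp add: that)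
    then have "\<omega> z' = \<omega> z" using sat[OF that, of z'] OpS by blast
    then show ?thesis by (simp add: w_def z'_def)
  qed
  have pre: "{z \<in> ?S. glue_class n z \<in> ?U} = Op"
    using sat OpS by blast
  have U: "openin ?T ?U"
    unfolding openin_polygon_topology pre using Op OpS by auto
  have img: "w ` ?U = N"
    using w \<omega> onto by (force simp: image_iff)
  have "homeomorphic_maps (subtopology ?T ?U) (top_of_set N) w \<kappa>"
    unfolding homeomorphic_maps_def
  proof (intro conjI ballI)
    show "continuous_map (top_of_set N) (subtopology ?T ?U) \<kappa>"
      unfolding continuous_map_in_subtopology
    proof
      show "\<kappa> \<in> topspace (top_of_set N) \<rightarrow> ?U" using onto \<omega> by fastforce
    qed (rule \<kappa>)
    have "openin (subtopology ?T ?U) {c \<in> ?U. w c \<in> G}" if G: "open G" for G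
    proof -
      have eq: "{z \<in> ?S. glue_class n z \<in> {c \<in> ?U. w c \<in> G}} = {z \<in> Op. \<omega> z \<in> G}"
      proof -
        have "{z \<in> ?S. glue_class n z \<in> {c \<in> ?U. w c \<in> G}} = {z \<in> Op. w (glue_class n z) \<in> G}"
          using pre by blast
        also have "\<dots> = {z \<in> Op. \<omega> z \<in> G}" using w by auto
        finally show ?thesis .
      qed
      have "openin (top_of_set ?S) {z \<in> Op. \<omega> z \<in> G}"
        unfolding openin_top_of_set_iff_eventually
      proof (intro conjI ballI)
        fix a assume a: "a \<in> {z \<in> Op. \<omega> z \<in> G}"
        have e1: "\<forall>\<^sub>F z in at a within ?S. z \<in> Op"
          using Op a unfolding openin_top_of_set_iff_eventually by blast
        have "open ((\<lambda>z. z + (\<omega> a - a)) -` G)" by (rule open_vimage[OF G]) (intro continuous_intros)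
        then have e2: "\<forall>\<^sub>F z in at a within ?S. z + (\<omega> a - a) \<in> G"
          unfolding eventually_at_topological using a by (intro exI[where x = "(\<lambda>z. z + (\<omega> a - a)) -` G"]) auto
        have "a \<in> Op" using a by simp
        from e1 e2 loc[OF this] show "\<forall>\<^sub>F z in at a within ?S. z \<in> {z \<in> Op. \<omega> z \<in> G}"
        proof eventually_elim
          case (elim z)
          have "\<omega> z = z + (\<omega> a - a)" using elim(3) by (simp add: algebra_simps)
          with elim show ?case by simp
        qed
      qed (use OpS in auto)
      then have "openin ?T {c \<in> ?U. w c \<in> G}"
        unfolding openin_polygon_topology eq using OpS by auto
      then show ?thesis using U by (simp add: openin_open_subtopology)
    qed
    then have "continuous_map (subtopology ?T ?U) euclidean w"
      using openin_subset[OF U] by (auto simp: continuous_map_def Int_absorb1)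
    then show "continuous_map (subtopology ?T ?U) (top_of_set N) w"
      using img openin_subset[OF U] by (auto simp: continuous_map_in_subtopology)
    show "\<kappa> (w x) = x" if "x \<in> topspace (subtopology ?T ?U)" for x
      using that w \<omega> by auto
    show "w (\<kappa> b) = b" if "b \<in> topspace (top_of_set N)" for b
      using that onto[of b] w \<omega> by auto
  qed
  then have "homeomorphic_map (subtopology ?T ?U) (top_of_set N) w"
    by (auto simp: homeomorphic_map_maps)
  then have "coordinate_on ?T ?U w" using U N by (simp add: coordinate_on_def img)
  moreover have "\<forall>\<^sub>F z in at a within ?S. w (glue_class n z) - z = w (glue_class n a) - a"
    if "a \<in> ?S" "glue_class n a \<in> ?U" for a
  proof -
    have a: "a \<in> Op" using that pre by blast
    have e1: "\<forall>\<^sub>F z in at a within ?S. z \<in> Op"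
      using Op a unfolding openin_top_of_set_iff_eventually by blast
    from e1 loc[OF a] show ?thesis by eventually_elim (simp add: w a)
  qed
  ultimately show ?thesis by (auto simp: polygon_atlas_iff)
qed

text \<open>The predicate \<open>P\<close> selects residues of sides that avoid \<open>a\<close>.
  There are only finitely many residues, so one radius serves for all.\<close>

lemma side_heights_less_near:
  assumes n: "n > 0" and less: "\<And>j. P (j mod (2 * n)) \<Longrightarrow> side_height n j a < apothem n"
  obtains e where "e > 0" "\<And>z j. \<lbrakk>z \<in> ball a e; P (j mod (2 * n))\<rbrakk> \<Longrightarrow> side_height n j z < apothem n"
proof -
  let ?J = "{j. j < 2 * n \<and> P j}"
  have "open (\<Inter>j \<in> ?J. {z. side_height n j z < apothem n})"
    by (intro open_INT ballI open_Collect_less continuous_intros) auto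
  moreover have "a \<in> (\<Inter>j \<in> ?J. {z. side_height n j z < apothem n})" using less by auto
  ultimately obtain e where e: "e > 0" "ball a e \<subseteq> (\<Inter>j \<in> ?J. {z. side_height n j z < apothem n})"
    using openE by blast
  show ?thesis
  proof (rule that[OF e(1)])
    fix z j assume zj: "z \<in> ball a e" "P (j mod (2 * n))"
    then have "j mod (2 * n) \<in> ?J" using n by simp
    with e(2) zj(1) have "side_height n (j mod (2 * n)) z < apothem n" by blast
    then show "side_height n j z < apothem n" by (simp only: side_height_mod[OF n])
  qed
qed

text \<open>Every vertex lies on two different sides, so strict inequality for all sides but one
  already excludes the vertices.\<close>

lemma mem_punctured_polygonI:
  assumes n: "n \<ge> 2" and le: "side_height n k z \<le> apothem n"
    and less: "\<And>j. j mod (2 * n) \<noteq> k mod (2 * n) \<Longrightarrow> side_height n j z < apothem n"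
  shows "z \<in> punctured_polygon n"
  unfolding punctured_polygon_iff[OF n]
proof (intro conjI allI)
  have n0: "n > 0" using n by simp
  show "side_height n j z \<le> apothem n" for j
  proof (cases "j mod (2 * n) = k mod (2 * n)")
    case True
    have "side_height n j z = side_height n k z"
      using side_height_mod[OF n0, of j z] side_height_mod[OF n0, of k z] by (simp only: True)
    with le show ?thesis by simp
  qed (use less[of j] in simp)
  show "z \<notin> range (vertex n)"
  proof
    assume "z \<in> range (vertex n)"
    then obtain i where i: "z = vertex n i" by auto
    let ?j = "i + (2 * n - 1)"
    have ij: "Suc ?j = i + 2 * n" using n by simp
    have "side_height n i z = apothem n" "side_height n ?j z = apothem n"
      using side_height_vertex_cases[OF n0, of i i] side_height_vertex_cases[OF n0, of i ?j] ij
      by (auto simp: i)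
    then have "i mod (2 * n) = k mod (2 * n)" "?j mod (2 * n) = k mod (2 * n)"
      using less[of i] less[of ?j] by (metis less_irrefl)+
    then have "Suc i mod (2 * n) = i mod (2 * n)" using ij by (metis mod_Suc_eq mod_add_self2)
    then show False using n by (auto simp: mod_Suc split: if_splits)
  qed
qed

lemma polygon_interior_chart:
  assumes n: "n \<ge> 2" and a: "\<And>k. side_height n k a < apothem n"
  shows "\<exists>U w. (U, w) \<in> atlas (polygon_surface n) \<and> glue_class n a \<in> U"
proof -
  let ?S = "punctured_polygon n"
  have n0: "n > 0" using n by simp
  obtain e where e0: "e > 0" "\<And>z j. \<lbrakk>z \<in> ball a e; True\<rbrakk> \<Longrightarrow> side_height n j z < apothem n"
    by (rule side_heights_less_near[OF n0, where P = "\<lambda>_. True" and a = a]) (simp add: a, rule that)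
  note e = e0(1) e0(2)[OF _ TrueI]
  have sub: "ball a e \<subseteq> ?S"
  proof
    fix z assume z: "z \<in> ball a e"
    show "z \<in> ?S" by (rule mem_punctured_polygonI[OF n less_imp_le[OF e(2)[OF z, of 0]] e(2)[OF z]])
  qed
  have "\<exists>w. (glue_class n ` ball a e, w) \<in> atlas (polygon_surface n)"
  proof (rule polygon_chartI[where N = "ball a e" and \<omega> = "\<lambda>z. z" and \<kappa> = "glue_class n"])
    show "openin (top_of_set ?S) (ball a e)" 
      unfolding openin_open using sub by (intro exI[where x = "ball a e"]) auto
    show "z' \<in> ball a e \<and> z' = z" if "z \<in> ball a e" "z' \<in> ?S" "glue_class n z' = glue_class n z" for z z'
    proof -
      have "z \<in> ?S" using that(1) sub by blast
      from glue_class_eq_iff[OF n this that(2)] that(3) have "z' = z \<or> (\<exists>k. side_height n k z = apothem n)" by auto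
      moreover have "side_height n k z \<noteq> apothem n" for k using e(2)[OF that(1), of k] by simp
      ultimately show ?thesis using that(1) by simp
    qed
    show "continuous_map (top_of_set (ball a e)) (polygon_topology n) (glue_class n)"
      by (rule continuous_map_from_subtopology_mono[OF continuous_map_glue_class(1) sub])
  qed auto
  moreover have "glue_class n a \<in> glue_class n ` ball a e" using e(1) by auto
  ultimately show ?thesis by blast
qed

text \<open>A neighbourhood of a point on a side consists of two half-discs, one at \<open>a\<close>
  and one at its translate \<open>a - v\<close> on the opposite side. Moving the second by
  \<open>v\<close> completes a disc in the plane.\<close>

lemma polygon_side_chart:
  assumes n: "n \<ge> 2" and a: "a \<in> punctured_polygon n" "side_height n k a = apothem n"
  shows "\<exists>U w. (U, w) \<in> atlas (polygon_surface n) \<and> glue_class n a \<in> U"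
proof -
  let ?S = "punctured_polygon n" and ?T = "polygon_topology n"
  define v where "v = side_width n k"
  define ap where "ap = apothem n"
  define h where "h = side_height n k"
  have n0: "n > 0" using n by simp
  have ap: "ap > 0" using apothem_pos[OF n] by (simp add: ap_def)
  have a': "a - v \<in> ?S" "side_height n (k + n) (a - v) = ap"
    using side_translate[OF n a] by (auto simp: v_def ap_def)
  obtain e1 where e1: "e1 > 0" "\<And>z j. \<lbrakk>z \<in> ball a e1; j mod (2 * n) \<noteq> k mod (2 * n)\<rbrakk> \<Longrightarrow> side_height n j z < ap"
    using side_heights_less_near[OF n0, of "\<lambda>j. j \<noteq> k mod (2 * n)" a]
      side_heights_on_side(3)[OF n side_eq_if_side_height[OF n a]] unfolding ap_def by blast
  obtain e2 where e2: "e2 > 0" "\<And>z j. \<lbrakk>z \<in> ball (a - v) e2; j mod (2 * n) \<noteq> (k + n) mod (2 * n)\<rbrakk> \<Longrightarrow> side_height n j z < ap"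
    using side_heights_less_near[OF n0, of "\<lambda>j. j \<noteq> (k + n) mod (2 * n)" "a - v"]
      side_heights_on_side(3)[OF n side_eq_if_side_height[OF n a'[unfolded ap_def]]] unfolding ap_def by blast
  \<comment> \<open>The translation has length \<open>2 * ap\<close>, so a radius of at most
    \<open>ap\<close> keeps the two half-discs apart and \<open>\<omega>\<close>
    unambiguous.\<close>
  define e where "e = min ap (min e1 e2)"
  have e: "e > 0" using ap e1 e2 by (simp add: e_def)
  have near: "side_height n j z < ap" if "z \<in> ball a e" "j mod (2 * n) \<noteq> k mod (2 * n)" for z j
    using e1(2)[of z j] that by (simp add: e_def)
  have near': "side_height n j z < ap" if "z + v \<in> ball a e" "j mod (2 * n) \<noteq> (k + n) mod (2 * n)" for z j
  proof -
    have "dist (a - v) z = dist a (z + v)" by (simp add: dist_norm algebra_simps)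
    then show ?thesis using e2(2)[of z j] that by (simp add: e_def)
  qed
  have hv: "h (z + v) = h z + 2 * ap" "h (z - v) = h z - 2 * ap" for z
    by (simp_all add: h_def v_def ap_def side_height_add side_height_diff side_height_width)
  have hk: "side_height n (k + n) z = - h z" for z by (simp add: h_def side_height_shift[OF n0])
  have nv: "norm v = 2 * ap" using ap by (simp add: v_def ap_def side_width_def norm_mult)
  have disj: "\<not> (z \<in> ball a e \<and> z + v \<in> ball a e)" for z
  proof
    assume "z \<in> ball a e \<and> z + v \<in> ball a e"
    then have "norm (a - z) + norm (a - (z + v)) < e + e" by (simp add: dist_norm)
    moreover have "v = (a - z) - (a - (z + v))" by simp
    then have "norm v \<le> norm (a - z) + norm (a - (z + v))" by (metis norm_triangle_ineq4)
    ultimately show False using nv by (simp add: e_def)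
  qed
  have memS: "z \<in> ?S \<longleftrightarrow> h z \<le> ap" if "z \<in> ball a e" for z
    using mem_punctured_polygonI[OF n, of k z] near[OF that] punctured_polygon_iff[OF n, of z]
    unfolding h_def ap_def by blast
  have memS': "z \<in> ?S \<longleftrightarrow> h (z + v) \<ge> ap" if "z + v \<in> ball a e" for z
  proof -
    have "h (z + v) \<ge> ap \<longleftrightarrow> side_height n (k + n) z \<le> apothem n"
      unfolding hv hk by (auto simp: ap_def)
    then show ?thesis
      using mem_punctured_polygonI[OF n, of "k + n" z] near'[OF that] punctured_polygon_iff[OF n, of z]
      unfolding ap_def by blast
  qed
  define Op where "Op = {z \<in> ?S. z \<in> ball a e \<or> z + v \<in> ball a e}"
  define \<omega> where "\<omega> z = (if z \<in> ball a e then z else z + v)" for z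
  define \<kappa> where "\<kappa> b = (if h b \<le> ap then glue_class n b else (glue_class n \<circ> (\<lambda>b. b - v)) b)" for b
  have glue_v: "glue_class n (z - v) = glue_class n z" if "z \<in> ?S" "h z = ap" for z
    using glue_class_eq_iff[OF n that(1), of "z - v"] side_translate[OF n that(1), of k] that(2)
    unfolding h_def ap_def v_def by auto
  have wv: "side_width n j = v" if "j mod (2 * n) = k mod (2 * n)" for j
    unfolding v_def using side_width_cong[OF n0 that] .
  have wv': "side_width n j = - v" if "j mod (2 * n) = (k + n) mod (2 * n)" for j
    unfolding v_def using side_width_cong[OF n0 that] side_width_shift[OF n0, of k] by simp
  have "\<exists>w. (glue_class n ` Op, w) \<in> atlas (polygon_surface n)"
  proof (rule polygon_chartI[where N = "ball a e" and \<omega> = \<omega> and \<kappa> = \<kappa>])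
    have "open (ball a e \<union> (\<lambda>z. z + v) -` ball a e)"
      by (intro open_Un open_ball open_vimage continuous_intros)
    moreover have "Op = ?S \<inter> (ball a e \<union> (\<lambda>z. z + v) -` ball a e)" by (auto simp: Op_def)
    ultimately show "openin (top_of_set ?S) Op" by (auto simp: openin_open)
    show "z' \<in> Op \<and> \<omega> z' = \<omega> z" if z: "z \<in> Op" "z' \<in> ?S" "glue_class n z' = glue_class n z" for z z'
    proof (cases "z' = z")
      case False
      have zS: "z \<in> ?S" using z(1) by (simp add: Op_def)
      obtain j where j: "side_height n j z = apothem n" "z' = z - side_width n j"
        using glue_class_eq_iff[OF n zS z(2)] z(3) False by auto
      show ?thesis
      proof (cases "z \<in> ball a e")
        case True
        then have "j mod (2 * n) = k mod (2 * n)" using near[OF True, of j] j(1) by (auto simp: ap_def)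
        then have "z' + v = z" using j(2) wv by simp
        with True z(2) disj[of z'] show ?thesis by (auto simp: Op_def \<omega>_def)
      next
        case F: False
        then have zv: "z + v \<in> ball a e" using z(1) by (simp add: Op_def)
        then have "j mod (2 * n) = (k + n) mod (2 * n)" using near'[OF zv, of j] j(1) by (auto simp: ap_def)
        then have "z' = z + v" using j(2) wv' by simp
        with F zv z(2) show ?thesis by (auto simp: Op_def \<omega>_def)
      qed
    qed (use z in auto)
    show "\<forall>\<^sub>F z in at c within ?S. \<omega> z - z = \<omega> c - c" if c: "c \<in> Op" for c
    proof (cases "c \<in> ball a e")
      case True
      then have "\<forall>\<^sub>F z in at c within ?S. z \<in> ball a e"
        unfolding eventually_at_topological by (intro exI[where x = "ball a e"]) auto
      then show ?thesis by eventually_elim (use True in \<open>simp add: \<omega>_def\<close>)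
    next
      case False
      then have "c + v \<in> ball a e" using c by (simp add: Op_def)
      moreover have "open ((\<lambda>z. z + v) -` ball a e)" by (intro open_ball open_vimage continuous_intros)
      ultimately have "\<forall>\<^sub>F z in at c within ?S. z + v \<in> ball a e"
        unfolding eventually_at_topological by (intro exI[where x = "(\<lambda>z. z + v) -` ball a e"]) auto
      then show ?thesis
      proof eventually_elim
        case (elim z)
        with disj[of z] False show ?case by (simp add: \<omega>_def)
      qed
    qed
    show "\<omega> z \<in> ball a e \<and> \<kappa> (\<omega> z) = glue_class n z" if z: "z \<in> Op" for z
    proof (cases "z \<in> ball a e")
      case True
      have "h z \<le> ap" using memS[OF True] z by (simp add: Op_def)
      with True show ?thesis by (simp add: \<omega>_def \<kappa>_def)
    next
      case False
      then have zv: "z + v \<in> ball a e" "z \<in> ?S" using z by (auto simp: Op_def)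
      have ge: "h (z + v) \<ge> ap" using memS'[OF zv(1)] zv(2) by simp
      have "\<kappa> (z + v) = glue_class n z"
      proof (cases "h (z + v) \<le> ap")
        case True
        then have "z + v \<in> ?S" using memS[OF zv(1)] by simp
        then have "glue_class n (z + v - v) = glue_class n (z + v)" using True ge by (intro glue_v) auto
        then show ?thesis using True by (simp add: \<kappa>_def)
      qed (simp add: \<kappa>_def)
      with zv False show ?thesis by (simp add: \<omega>_def)
    qed
    show "\<exists>z \<in> Op. \<omega> z = b" if b: "b \<in> ball a e" for b
    proof (cases "h b \<le> ap")
      case True
      then show ?thesis using memS[OF b] b by (intro bexI[where x = b]) (auto simp: Op_def \<omega>_def)
    next
      case False
      then have "b - v \<in> Op" using memS'[of "b - v"] b by (auto simp: Op_def)
      moreover have "\<omega> (b - v) = b" using disj[of "b - v"] b by (simp add: \<omega>_def)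
      ultimately show ?thesis by blast
    qed
    show "continuous_map (top_of_set (ball a e)) ?T \<kappa>"
      unfolding \<kappa>_def
    proof (rule continuous_map_cases_le)
      show "continuous_map (top_of_set (ball a e)) euclideanreal h"
        unfolding h_def by (auto intro!: continuous_intros)
      have sub: "{x \<in> topspace (top_of_set (ball a e)). h x \<le> ap} \<subseteq> ?S" using memS by auto
      show "continuous_map (subtopology (top_of_set (ball a e)) {x \<in> topspace (top_of_set (ball a e)). h x \<le> ap})
          ?T (glue_class n)"
        unfolding subtopology_subtopology
        by (rule continuous_map_from_subtopology_mono[OF continuous_map_glue_class(1)]) (use sub in auto)
      have sub': "z - v \<in> ?S" if "z \<in> ball a e" "ap \<le> h z" for z using memS'[of "z - v"] that by simp
      show "continuous_map (subtopology (top_of_set (ball a e)) {x \<in> topspace (top_of_set (ball a e)). ap \<le> h x})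
          ?T (glue_class n \<circ> (\<lambda>b. b - v))"
        unfolding subtopology_subtopology
      proof (rule continuous_map_compose[OF _ continuous_map_glue_class(1)])
        show "continuous_map (top_of_set (ball a e \<inter> {x \<in> topspace (top_of_set (ball a e)). ap \<le> h x}))
            (top_of_set ?S) (\<lambda>b. b - v)"
          using sub' by (auto simp: continuous_map_in_subtopology intro!: continuous_intros)
      qed
      show "glue_class n x = (glue_class n \<circ> (\<lambda>b. b - v)) x" if "x \<in> topspace (top_of_set (ball a e))" "h x = ap" for x
        using glue_v[of x] memS[of x] that by simp
    qed auto
  qed auto
  moreover have "a \<in> Op" using a e by (simp add: Op_def)
  ultimately show ?thesis by blast
qed

lemma translation_surface_polygon:
  assumes n: "n \<ge> 2" shows "translation_surface (polygon_surface n)"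
  unfolding translation_surface_def
proof (intro conjI)
  show "\<forall>(U, w) \<in> atlas (polygon_surface n). coordinate_on (surface_topology (polygon_surface n)) U w"
    by (auto simp: polygon_atlas_iff)
  have "x \<in> \<Union> (fst ` atlas (polygon_surface n))" if x: "x \<in> points (polygon_surface n)" for x
  proof -
    obtain a where a: "a \<in> punctured_polygon n" "x = glue_class n a"
      using x by (auto simp: topspace_polygon_topology)
    then have le: "side_height n k a \<le> apothem n" for k using punctured_polygon_iff[OF n] by auto
    have "\<exists>U w. (U, w) \<in> atlas (polygon_surface n) \<and> glue_class n a \<in> U"
    proof (cases "\<exists>k. side_height n k a = apothem n")
      case True
      then show ?thesis using polygon_side_chart[OF n a(1)] by blast
    next
      case False
      with le have "side_height n k a < apothem n" for k by (metis order_le_less)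
      then show ?thesis by (rule polygon_interior_chart[OF n])
    qed
    with a(2) show ?thesis by force
  qed
  moreover have "U \<subseteq> points (polygon_surface n)" if "(U, w) \<in> atlas (polygon_surface n)" for U w
    using that by (auto simp: polygon_atlas_iff coordinate_on_def dest: openin_subset)
  ultimately show "\<Union> (fst ` atlas (polygon_surface n)) = points (polygon_surface n)" by force
  show "locally_affine (polygon_surface n) (\<lambda>x. x) (mat 1)" by (rule locally_affine_polygon_id)
qed

section \<open>Rotation and horizontal shear of the polygon surface\<close>

definition mult_matrix :: "complex \<Rightarrow> real^2^2" where
  "mult_matrix c = vector [vector [Re c, - Im c], vector [Im c, Re c]]"

lemma matrix_act_mult_matrix: "matrix_act (mult_matrix c) z = c * z"
  by (simp add: matrix_act_def mult_matrix_def complex_eq_iff)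

lemma rotation_matrix_eq: "rotation_matrix n = mult_matrix (cis (pi / n))"
  by (simp add: rotation_matrix_def mult_matrix_def)

text \<open>All multiples of the basic angle are treated at once, so that the inverse of one step is
  available as \<open>2 * n - 1\<close> steps.\<close>

lemma polygon_rotation_map:
  fixes j :: nat
  assumes n: "n \<ge> 2"
  obtains \<alpha> where "continuous_map (polygon_topology n) (polygon_topology n) \<alpha>"
    "locally_affine (polygon_surface n) \<alpha> (mult_matrix (cis (j * pi / n)))"
    "\<And>z. z \<in> punctured_polygon n \<Longrightarrow> cis (j * pi / n) * z \<in> punctured_polygon n \<and>
       \<alpha> (glue_class n z) = glue_class n (cis (j * pi / n) * z)"
proof -
  let ?S = "punctured_polygon n"
  define c where "c = cis (j * pi / n)"
  have n0: "n > 0" using n by simp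
  have c: "c * cnj c = 1" "c \<noteq> 0" by (simp_all add: c_def cis_cnj cis_mult)
  have normal: "side_normal n (k + j) = side_normal n k * c" for k
    by (simp add: c_def side_normal_add)
  have height: "side_height n (k + j) (c * z) = side_height n k z" for k z
  proof -
    have "c * z * cnj (side_normal n k * c) = (c * cnj c) * (z * cnj (side_normal n k))"
      by (simp only: complex_cnj_mult mult_ac)
    also have "\<dots> = z * cnj (side_normal n k)" by (simp only: c(1) mult_1_left)
    finally show ?thesis unfolding side_height_def normal by (simp only:)
  qed
  have width: "side_width n (k + j) = c * side_width n k" for k
    by (simp add: side_width_def normal)
  have vert: "vertex n (k + j) = c * vertex n k" for k
    by (simp add: vertex_eq_normal(1)[OF n0] normal)
  \<comment> \<open>The index of the side that the rotation carries to side \<open>k\<close>,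
    shifted by a multiple of the period to stay among the natural numbers.\<close>
  define s where "s k = k + 2 * n * j - j" for k
  have s: "(s k + j) mod (2 * n) = k mod (2 * n)" for k
  proof -
    have "1 * j \<le> (2 * n) * j" using n0 by (intro mult_right_mono) auto
    then have "s k + j = k + 2 * n * j" unfolding s_def by linarith
    then show ?thesis by simp
  qed
  have into: "c * z \<in> ?S" if z: "z \<in> ?S" for z
    unfolding punctured_polygon_iff[OF n]
  proof (intro conjI allI)
    show "side_height n k (c * z) \<le> apothem n" for k
    proof -
      have "side_height n k (c * z) = side_height n (s k + j) (c * z)"
        using side_height_mod[OF n0, of k] side_height_mod[OF n0, of "s k + j"] by (simp only: s)
      also have "\<dots> = side_height n (s k) z" by (rule height)
      finally show ?thesis using z punctured_polygon_iff[OF n] by simp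
    qed
    show "c * z \<notin> range (vertex n)"
    proof
      assume "c * z \<in> range (vertex n)"
      then obtain i where "c * z = vertex n i" by auto
      also have "\<dots> = vertex n (s i + j)"
        using vertex_mod[OF n0, of i] vertex_mod[OF n0, of "s i + j"] by (simp only: s)
      also have "\<dots> = c * vertex n (s i)" by (rule vert)
      finally have "z = vertex n (s i)" using c by simp
      with z punctured_polygon_iff[OF n] show False by auto
    qed
  qed
  have compat: "glue_class n (c * z) = glue_class n (c * z')"
    if z: "z \<in> ?S" "z' \<in> ?S" "glue_class n z = glue_class n z'" for z z'
  proof (cases "z' = z")
    case False
    then obtain k where k: "side_height n k z = apothem n" "z' = z - side_width n k"
      using glue_class_eq_iff[OF n z(1,2)] z(3) by auto
    then have "side_height n (k + j) (c * z) = apothem n" "c * z' = c * z - side_width n (k + j)"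
      by (simp_all add: height width right_diff_distrib)
    then show ?thesis using glue_class_eq_iff[OF n into[OF z(1)] into[OF z(2)]] by blast
  qed simp
  obtain \<alpha> where \<alpha>: "continuous_map (polygon_topology n) (polygon_topology n) \<alpha>"
    "locally_affine (polygon_surface n) \<alpha> (mult_matrix c)"
    "\<And>i z. \<lbrakk>i \<in> {0::nat}; z \<in> ?S; z \<in> UNIV\<rbrakk> \<Longrightarrow>
       \<alpha> (glue_class n z) = glue_class n (matrix_act (mult_matrix c) z + 0)"
  proof (rule polygon_cut_and_paste[where I = "{0::nat}" and Q = "\<lambda>_. UNIV" and A = "mult_matrix c"
        and b = "\<lambda>_. 0" and n = n])
    show "glue_class n (matrix_act (mult_matrix c) z + 0) = glue_class n (matrix_act (mult_matrix c) z' + 0)"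
      if "z \<in> ?S" "z' \<in> ?S" "glue_class n z = glue_class n z'" for z z'
      using compat[OF that] by (simp add: matrix_act_mult_matrix)
    show "matrix_act (mult_matrix c) z + 0 \<in> ?S" if "z \<in> ?S" for z
      using into[OF that] by (simp add: matrix_act_mult_matrix)
  qed auto
  show ?thesis
  proof (rule that)
    show "continuous_map (polygon_topology n) (polygon_topology n) \<alpha>" by (rule \<alpha>(1))
    show "locally_affine (polygon_surface n) \<alpha> (mult_matrix (cis (j * pi / n)))"
      using \<alpha>(2) by (simp only: c_def)
    show "cis (j * pi / n) * z \<in> ?S \<and> \<alpha> (glue_class n z) = glue_class n (cis (j * pi / n) * z)" if "z \<in> ?S" for z
      using \<alpha>(3)[of 0 z] into[OF that] that unfolding c_def[symmetric] by (simp add: matrix_act_mult_matrix)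
  qed
qed

lemma polygon_rotation:
  assumes n: "n \<ge> 2"
  obtains \<alpha> where "affine_automorphism (polygon_surface n) \<alpha> (rotation_matrix n)"
proof -
  let ?S = "punctured_polygon n" and ?T = "polygon_topology n"
  obtain \<alpha> where \<alpha>: "continuous_map ?T ?T \<alpha>"
    "locally_affine (polygon_surface n) \<alpha> (mult_matrix (cis (real 1 * pi / n)))"
    "\<And>z. z \<in> ?S \<Longrightarrow> cis (real 1 * pi / n) * z \<in> ?S \<and> \<alpha> (glue_class n z) = glue_class n (cis (real 1 * pi / n) * z)"
    by (rule polygon_rotation_map[OF n, of 1], rule that)
  obtain \<beta> where \<beta>: "continuous_map ?T ?T \<beta>"
    "\<And>z. z \<in> ?S \<Longrightarrow> cis (real (2 * n - 1) * pi / n) * z \<in> ?S \<and> \<beta> (glue_class n z) = glue_class n (cis (real (2 * n - 1) * pi / n) * z)"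
    by (rule polygon_rotation_map[OF n, of "2 * n - 1"], rule that)
  have "real 1 * pi / n + real (2 * n - 1) * pi / n = 2 * pi" using n by (simp add: of_nat_diff field_simps)
  then have "cis (real 1 * pi / n) * cis (real (2 * n - 1) * pi / n) = 1" unfolding cis_mult by simp
  then have c: "cis (real 1 * pi / n) * (cis (real (2 * n - 1) * pi / n) * z) = z"
      "cis (real (2 * n - 1) * pi / n) * (cis (real 1 * pi / n) * z) = z" for z
    by (metis mult.assoc mult.commute mult_1)+
  have "homeomorphic_maps ?T ?T \<alpha> \<beta>"
    unfolding homeomorphic_maps_def
  proof (intro conjI ballI)
    fix x assume "x \<in> topspace ?T"
    then obtain z where z: "z \<in> ?S" "x = glue_class n z" by (auto simp: topspace_polygon_topology)
    show "\<beta> (\<alpha> x) = x" using \<alpha>(3)[OF z(1)] \<beta>(2) c z(2) by metis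
    show "\<alpha> (\<beta> x) = x" using \<beta>(2)[OF z(1)] \<alpha>(3) c z(2) by metis
  qed (use \<alpha>(1) \<beta>(1) in auto)
  then have "homeomorphic_map ?T ?T \<alpha>" by (auto simp: homeomorphic_map_maps)
  then have "affine_automorphism (polygon_surface n) \<alpha> (rotation_matrix n)"
    using \<alpha>(2) by (simp add: affine_automorphism_def rotation_matrix_eq)
  then show thesis by (rule that)
qed

section \<open>Horizontal strips and their tilings\<close>

lemma strip_hull_iff:
  assumes n: "n \<ge> 2" and k: "Suc k < n" "Im (vertex n k) \<le> Im z" "Im z \<le> Im (vertex n (Suc k))"
  shows "z \<in> convex hull (range (vertex n)) \<longleftrightarrow> \<bar>Re z\<bar> \<le> strip_bound n k (Im z)"
proof
  assume "z \<in> convex hull (range (vertex n))"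
  then have "side_height n j z \<le> apothem n" for j using side_height_le_of_hull n by simp
  from this[of k] this[of "2 * n - 2 - k"] show "\<bar>Re z\<bar> \<le> strip_bound n k (Im z)"
    using side_height_le_iff_strip(1)[OF k(1)] side_height_le_iff_strip_mirror(1)[OF k(1)] by (simp add: abs_le_iff)
qed (rule strip_in_hull[OF k])

text \<open>Conjugation is the mirror in the vertical axis followed by the half-turn, which adds
  \<open>n\<close> to the indices. It therefore turns strip \<open>k\<close> into strip
  \<open>n - 2 - k\<close>.\<close>

lemma vertex_conj:
  assumes "k < n" shows "vertex n (n - 1 - k) = cnj (vertex n k)"
proof -
  have "vertex n (2 * n - 1 - k) = vertex n ((n - 1 - k) + n)"
    using assms by (simp add: mult_2)
  also have "\<dots> = - vertex n (n - 1 - k)" using assms by (intro vertex_shift) simp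
  finally show ?thesis using vertex_mirror[OF assms] by simp
qed

lemma side_normal_conj:
  assumes "Suc k < n" shows "side_normal n (n - 2 - k) = cnj (side_normal n k)"
proof -
  have "(real (n - 2 - k) + 1) * pi / n = pi - (real k + 1) * pi / n"
    using assms by (simp add: of_nat_diff field_simps)
  then show ?thesis by (simp add: complex_eq_iff side_normal_Re_Im)
qed

lemma side_width_conj:
  assumes "Suc k < n"
  shows "side_width n (n - 2 - k) = cnj (side_width n k)"
    "side_width n (2 * n - 2 - k) = - cnj (side_width n k)"
  using side_normal_conj[OF assms] side_normal_mirror[OF assms] by (simp_all add: side_width_def)

lemma strip_bound_conj:
  assumes "Suc k < n" shows "strip_bound n (n - 2 - k) y = strip_bound n k (- y)"
proof -
  have "(real (n - 2 - k) + 1) * pi / n = pi - (real k + 1) * pi / n"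
    using assms by (simp add: of_nat_diff field_simps)
  then show ?thesis by (simp add: strip_bound_def)
qed

text \<open>The half-turn \<open>z \<mapsto> side_width n k - z\<close> about the midpoint of side
  \<open>k\<close> preserves the line of the side, and abscissas on that line are given by
  \<open>strip_bound\<close>.\<close>

lemma strip_bound_sum:
  assumes "Suc k < n"
  shows "strip_bound n k y + strip_bound n k (Im (side_width n k) - y) = Re (side_width n k)"
proof -
  let ?s = "sin ((real k + 1) * pi / n)" and ?c = "cos ((real k + 1) * pi / n)"
  have w: "Re (side_width n k) = 2 * apothem n * ?s" "Im (side_width n k) = - 2 * apothem n * ?c"
    by (simp_all add: side_width_def side_normal_Re_Im)
  have "?c * ?c = 1 - ?s * ?s" using sin_cos_squared_add[of "(real k + 1) * pi / n"] by (simp add: power2_eq_square)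
  moreover have "2 * apothem n + (- 2 * apothem n * ?c) * ?c = 2 * apothem n * (1 - ?c * ?c)"
    by (simp add: right_diff_distrib)
  ultimately have "2 * apothem n + (- 2 * apothem n * ?c) * ?c = 2 * apothem n * ?s * ?s" by simp
  moreover have "strip_bound n k y + strip_bound n k (Im (side_width n k) - y) =
      (2 * apothem n + (- 2 * apothem n * ?c) * ?c) / ?s"
    unfolding strip_bound_def w by (simp add: add_divide_distrib[symmetric] algebra_simps)
  ultimately show ?thesis using sin_strip_pos[OF assms] by (simp add: w)
qed

text \<open>The height of the strip is \<open>Re (side_normal n k)\<close>, as sides have length 1,
  and \<open>Re (side_width n k)\<close> is \<open>2 * apothem n\<close>, that is
  \<open>cot (pi / (2 * n))\<close>, times this height. The ratio is the same for all strips, which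
  is the origin of the constant in \<open>shear_matrix\<close>.\<close>

lemma shear_strip:
  assumes "n > 0"
  shows "2 * cot (pi / (2 * real n)) * (Im (vertex n (Suc k)) - Im (vertex n k)) = 2 * Re (side_width n k)"
proof -
  have "vertex n (Suc k) - vertex n k = side_normal n k * (Complex (apothem n) (1 / 2) - Complex (apothem n) (- 1 / 2))"
    by (simp only: vertex_eq_normal(1)[OF assms, of k] vertex_eq_normal(2)[OF assms, of k] right_diff_distrib)
  also have "Complex (apothem n) (1 / 2) - Complex (apothem n) (- 1 / 2) = \<i>" by (simp add: complex_eq_iff)
  finally have "Im (vertex n (Suc k) - vertex n k) = Re (side_normal n k)" by simp
  then show ?thesis by (simp add: side_width_def apothem_def cot_def)
qed

text \<open>Continuing the polygon horizontally across the sides of its \<open>k\<close>-th strip, we meet alternately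
  translates of the \<open>(n - 2 - k)\<close>-th and of the \<open>k\<close>-th strip; \<open>tile_shift n k j\<close> is the translation that
  carries the polygon to the \<open>j\<close>-th of them.\<close>

definition tile_shift :: "nat \<Rightarrow> nat \<Rightarrow> int \<Rightarrow> complex" where
  "tile_shift n k j = Complex (j * Re (side_width n k)) (if even j then 0 else Im (side_width n k))"

text \<open>Half of the width of the \<open>j\<close>-th tile at height \<open>y\<close>. An odd
  tile is strip \<open>n - 2 - k\<close> moved vertically by \<open>Im (side_width n k)\<close>, and
  conjugation turns its bound into that of strip \<open>k\<close> at the reflected height.\<close>

definition tile_bound :: "nat \<Rightarrow> nat \<Rightarrow> int \<Rightarrow> real \<Rightarrow> real" where
  "tile_bound n k j y = strip_bound n k (if even j then y else Im (side_width n k) - y)"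

definition in_strip :: "nat \<Rightarrow> nat \<Rightarrow> complex \<Rightarrow> bool" where
  "in_strip n k z \<longleftrightarrow> Suc k < n \<and> Im (vertex n k) \<le> Im z \<and> Im z \<le> Im (vertex n (Suc k))"

definition tile_strip :: "nat \<Rightarrow> nat \<Rightarrow> int \<Rightarrow> nat" where
  "tile_strip n k j = (if even j then k else n - 2 - k)"

lemma Im_vertex_conj:
  assumes "Suc k < n"
  shows "Im (vertex n (n - 2 - k)) = - Im (vertex n (Suc k))"
    "Im (vertex n (Suc (n - 2 - k))) = - Im (vertex n k)"
proof -
  have "n - 2 - k = n - 1 - Suc k" "Suc (n - 2 - k) = n - 1 - k" using assms by auto
  then show "Im (vertex n (n - 2 - k)) = - Im (vertex n (Suc k))"
    "Im (vertex n (Suc (n - 2 - k))) = - Im (vertex n k)"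
    using vertex_conj[of k n] vertex_conj[of "Suc k" n] assms by simp_all
qed

lemma Im_side_width: "n > 0 \<Longrightarrow> Im (side_width n k) = Im (vertex n k) + Im (vertex n (Suc k))"
  by (simp add: side_width_eq)

lemma in_strip_tile:
  assumes "in_strip n k \<zeta>"
  shows "in_strip n (tile_strip n k j) (\<zeta> - tile_shift n k j)"
    "Im (\<zeta> - tile_shift n k j) - Im (vertex n (tile_strip n k j)) = Im \<zeta> - Im (vertex n k)"
    "strip_bound n (tile_strip n k j) (Im (\<zeta> - tile_shift n k j)) = tile_bound n k j (Im \<zeta>)"
proof -
  have k: "Suc k < n" "Im (vertex n k) \<le> Im \<zeta>" "Im \<zeta> \<le> Im (vertex n (Suc k))"
    using assms by (auto simp: in_strip_def)
  have n: "n > 0" "Suc (n - 2 - k) < n" using k(1) by auto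
  define m where "m = n - 2 - k"
  have m: "Suc m < n" "Im (vertex n m) = - Im (vertex n (Suc k))" "Im (vertex n (Suc m)) = - Im (vertex n k)"
      "\<And>y. strip_bound n m y = strip_bound n k (- y)"
    unfolding m_def using n(2) Im_vertex_conj[OF k(1)] strip_bound_conj[OF k(1)] by blast+
  have w: "Im (side_width n k) = Im (vertex n k) + Im (vertex n (Suc k))" by (rule Im_side_width[OF n(1)])
  have "in_strip n (tile_strip n k j) (\<zeta> - tile_shift n k j) \<and>
    Im (\<zeta> - tile_shift n k j) - Im (vertex n (tile_strip n k j)) = Im \<zeta> - Im (vertex n k) \<and>
    strip_bound n (tile_strip n k j) (Im (\<zeta> - tile_shift n k j)) = tile_bound n k j (Im \<zeta>)"
  proof (cases "even j")
    case True
    then show ?thesis using k by (simp add: in_strip_def tile_strip_def tile_shift_def tile_bound_def)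
  next
    case False
    then have "tile_strip n k j = m" "Im (tile_shift n k j) = Im (side_width n k)"
      "tile_bound n k j (Im \<zeta>) = strip_bound n k (Im (side_width n k) - Im \<zeta>)"
      by (simp_all add: tile_strip_def m_def tile_shift_def tile_bound_def)
    then show ?thesis using k m w by (simp add: in_strip_def)
  qed
  then show "in_strip n (tile_strip n k j) (\<zeta> - tile_shift n k j)"
    "Im (\<zeta> - tile_shift n k j) - Im (vertex n (tile_strip n k j)) = Im \<zeta> - Im (vertex n k)"
    "strip_bound n (tile_strip n k j) (Im (\<zeta> - tile_shift n k j)) = tile_bound n k j (Im \<zeta>)"
    by simp_all
qed

lemma tile_bound_pos:
  assumes "in_strip n k \<zeta>" shows "tile_bound n k j (Im \<zeta>) > 0"
proof -
  have "strip_bound n (tile_strip n k j) (Im (\<zeta> - tile_shift n k j)) > 0"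
    using in_strip_tile(1)[OF assms, of j] by (intro strip_bound_pos) (auto simp: in_strip_def)
  then show ?thesis by (simp only: in_strip_tile(3)[OF assms])
qed

text \<open>This says that neighbouring tiles abut: their half-widths add up to the distance of
  their centres.\<close>

lemma tile_bound_sum:
  assumes "Suc k < n" "odd (j - j')"
  shows "tile_bound n k j y + tile_bound n k j' y = Re (side_width n k)"
  using strip_bound_sum[OF assms(1), of y] assms(2) unfolding tile_bound_def by (cases "even j") auto

lemma tile_hull_iff:
  assumes "n \<ge> 2" "in_strip n k \<zeta>"
  shows "\<zeta> - tile_shift n k j \<in> convex hull (range (vertex n)) \<longleftrightarrow>
    \<bar>Re \<zeta> - j * Re (side_width n k)\<bar> \<le> tile_bound n k j (Im \<zeta>)"
proof -
  have "Re (\<zeta> - tile_shift n k j) = Re \<zeta> - j * Re (side_width n k)" by (simp add: tile_shift_def)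
  moreover have "\<zeta> - tile_shift n k j \<in> convex hull (range (vertex n)) \<longleftrightarrow>
      \<bar>Re (\<zeta> - tile_shift n k j)\<bar> \<le> strip_bound n (tile_strip n k j) (Im (\<zeta> - tile_shift n k j))"
    using in_strip_tile(1)[OF assms(2)] by (intro strip_hull_iff assms(1)) (auto simp: in_strip_def)
  ultimately show ?thesis by (simp only: in_strip_tile(3)[OF assms(2)])
qed

lemma tile_shift_step:
  assumes "Suc k < n"
  shows "tile_shift n k (j + 1) - tile_shift n k j = side_width n (tile_strip n k j)"
    "tile_shift n k (j - 1) - tile_shift n k j = side_width n (2 * n - 2 - tile_strip n k j)"
proof -
  have k': "Suc (n - 2 - k) < n" using assms by simp
  have c: "side_width n (2 * n - 2 - (n - 2 - k)) = - side_width n k"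
    using side_width_conj(2)[OF k'] side_width_conj(1)[OF assms] by simp
  show "tile_shift n k (j + 1) - tile_shift n k j = side_width n (tile_strip n k j)"
    using side_width_conj[OF assms]
    by (cases "even j") (auto simp: tile_shift_def tile_strip_def complex_eq_iff algebra_simps)
  show "tile_shift n k (j - 1) - tile_shift n k j = side_width n (2 * n - 2 - tile_strip n k j)"
    using side_width_conj[OF assms] c
    by (cases "even j") (auto simp: tile_shift_def tile_strip_def complex_eq_iff algebra_simps)
qed

lemma tile_shift_conj:
  assumes "Suc k < n"
  shows "tile_shift n (tile_strip n k j) (- j) = - tile_shift n k j"
    "side_width n k + tile_shift n (n - 2 - k) j = tile_shift n k (j + 1)"
proof -
  show "tile_shift n (tile_strip n k j) (- j) = - tile_shift n k j"
    using side_width_conj(1)[OF assms] by (simp add: tile_shift_def tile_strip_def complex_eq_iff)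
  show "side_width n k + tile_shift n (n - 2 - k) j = tile_shift n k (j + 1)"
    using side_width_conj(1)[OF assms] by (simp add: tile_shift_def complex_eq_iff distrib_right)
qed

text \<open>Half-widths are smaller than the distance of neighbouring centres, so only equal or
  adjacent tiles can share a point. A point of two adjacent tiles is on their common side, and its
  two positions in the polygon are those glued along that side.\<close>

lemma tile_overlap:
  assumes n: "n \<ge> 2" and strip: "in_strip n k \<zeta>"
    and j: "\<zeta> - tile_shift n k j \<in> punctured_polygon n"
    and j': "\<zeta> - tile_shift n k j' \<in> convex hull (range (vertex n))"
  shows "\<zeta> - tile_shift n k j' \<in> punctured_polygon n"
    "glue_class n (\<zeta> - tile_shift n k j') = glue_class n (\<zeta> - tile_shift n k j)"
proof -
  let ?z = "\<zeta> - tile_shift n k j" and ?\<rho> = "Re (side_width n k)" and ?r = "\<lambda>j. tile_bound n k j (Im \<zeta>)"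
  have k: "Suc k < n" using strip by (simp add: in_strip_def)
  have "?z \<in> convex hull (range (vertex n))" using j by (simp add: punctured_polygon_def)
  then have bj: "\<bar>Re \<zeta> - j * ?\<rho>\<bar> \<le> ?r j" by (simp only: tile_hull_iff[OF n strip])
  have bj': "\<bar>Re \<zeta> - j' * ?\<rho>\<bar> \<le> ?r j'" using j' by (simp only: tile_hull_iff[OF n strip])
  have lt: "?r i < ?\<rho>" for i
    using tile_bound_sum[OF k, of i "i + 1" "Im \<zeta>"] tile_bound_pos[OF strip, of "i + 1"] by simp
  have strip': "Suc (tile_strip n k j) < n" using in_strip_tile(1)[OF strip, of j] by (simp add: in_strip_def)
  have move: "\<zeta> - tile_shift n k j' \<in> punctured_polygon n \<and>
      glue_class n (\<zeta> - tile_shift n k j') = glue_class n ?z"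
    if "side_height n i ?z = apothem n" "tile_shift n k j' - tile_shift n k j = side_width n i" for i
  proof -
    have eq: "\<zeta> - tile_shift n k j' = ?z - side_width n i" by (simp add: that(2)[symmetric])
    have S: "?z - side_width n i \<in> punctured_polygon n" by (rule side_translate(1)[OF n j that(1)])
    show ?thesis unfolding eq using S glue_class_eq_iff[OF n j S] that(1) by auto
  qed
  have Rez: "Re ?z = Re \<zeta> - j * ?\<rho>" by (simp add: tile_shift_def)
  have "\<zeta> - tile_shift n k j' \<in> punctured_polygon n \<and>
      glue_class n (\<zeta> - tile_shift n k j') = glue_class n ?z"
  proof -
    consider "j' = j" | "j' = j + 1" | "j' = j - 1" | "\<bar>j' - j\<bar> \<ge> 2" by linarith
    then show ?thesis
    proof cases
      case 1
      then show ?thesis using j by simp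
    next
      case 2
      have "?r j + ?r j' = ?\<rho>" using tile_bound_sum[OF k, of j j' "Im \<zeta>"] 2 by simp
      then have "Re \<zeta> - j * ?\<rho> = ?r j" using bj bj' 2 by (simp add: algebra_simps abs_le_iff)
      then have "side_height n (tile_strip n k j) ?z = apothem n"
        using side_height_le_iff_strip(2)[OF strip'] in_strip_tile(3)[OF strip] Rez by simp
      then show ?thesis using tile_shift_step(1)[OF k, of j] 2 by (intro move) auto
    next
      case 3
      have "?r j + ?r j' = ?\<rho>" using tile_bound_sum[OF k, of j j' "Im \<zeta>"] 3 by simp
      then have "- (Re \<zeta> - j * ?\<rho>) = ?r j" using bj bj' 3 by (simp add: algebra_simps abs_le_iff)
      then have "side_height n (2 * n - 2 - tile_strip n k j) ?z = apothem n"
        using side_height_le_iff_strip_mirror(2)[OF strip'] in_strip_tile(3)[OF strip] Rez by simp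
      then show ?thesis using tile_shift_step(2)[OF k, of j] 3 by (intro move) auto
    next
      case 4
      have \<rho>: "?\<rho> > 0" using lt[of j] tile_bound_pos[OF strip, of j] by simp
      have "2 * ?\<rho> \<le> real_of_int \<bar>j' - j\<bar> * ?\<rho>" using 4 \<rho> by (intro mult_right_mono) linarith+
      also have "\<dots> = \<bar>(Re \<zeta> - j * ?\<rho>) - (Re \<zeta> - j' * ?\<rho>)\<bar>"
        using \<rho> by (simp add: abs_mult left_diff_distrib[symmetric])
      also have "\<dots> \<le> ?r j + ?r j'" using bj bj' by linarith
      finally show ?thesis using lt[of j] lt[of j'] by simp
    qed
  qed
  then show "\<zeta> - tile_shift n k j' \<in> punctured_polygon n"
    "glue_class n (\<zeta> - tile_shift n k j') = glue_class n ?z" by auto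
qed

lemma tile_exists:
  assumes n: "n \<ge> 2" and strip: "in_strip n k \<zeta>"
  obtains j where "\<zeta> - tile_shift n k j \<in> convex hull (range (vertex n))"
proof -
  let ?\<rho> = "Re (side_width n k)" and ?r = "\<lambda>j. tile_bound n k j (Im \<zeta>)"
  have k: "Suc k < n" using strip by (simp add: in_strip_def)
  have r: "?r 0 + ?r 1 = ?\<rho>" using tile_bound_sum[OF k, of 0 1] by simp
  have pos: "?r 0 > 0" "?r 1 > 0" using tile_bound_pos[OF strip] by auto
  \<comment> \<open>Tiles \<open>2 * m\<close> and \<open>2 * m + 1\<close> together form a period
    of length \<open>2 * ?\<rho>\<close>; it starts at the left edge of the even tile,
    \<open>?r 0\<close> before its centre.\<close>
  define m where "m = \<lfloor>(Re \<zeta> + ?r 0) / (2 * ?\<rho>)\<rfloor>"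
  have "of_int m \<le> (Re \<zeta> + ?r 0) / (2 * ?\<rho>)" "(Re \<zeta> + ?r 0) / (2 * ?\<rho>) < of_int m + 1"
    by (simp_all add: m_def)
  then have m: "of_int m * (2 * ?\<rho>) \<le> Re \<zeta> + ?r 0" "Re \<zeta> + ?r 0 < (of_int m + 1) * (2 * ?\<rho>)"
    using r pos by (simp_all add: field_simps)
  have par: "?r (2 * m) = ?r 0" "?r (2 * m + 1) = ?r 1" by (simp_all add: tile_bound_def)
  show ?thesis
  proof (cases "Re \<zeta> - of_int (2 * m) * ?\<rho> \<le> ?r 0")
    case True
    with m(1) have "\<bar>Re \<zeta> - of_int (2 * m) * ?\<rho>\<bar> \<le> ?r (2 * m)" unfolding par by (simp add: abs_le_iff algebra_simps)
    then show ?thesis using that tile_hull_iff[OF n strip] by blast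
  next
    case False
    then have "\<bar>Re \<zeta> - of_int (2 * m + 1) * ?\<rho>\<bar> \<le> ?r (2 * m + 1)"
      using m(2) r unfolding par by (simp add: abs_le_iff algebra_simps)
    then show ?thesis using that tile_hull_iff[OF n strip] by blast
  qed
qed

section \<open>The horizontal twist as a piecewise affine map\<close>

definition twist_matrix :: "nat \<Rightarrow> real \<Rightarrow> real^2^2" where
  "twist_matrix n \<sigma> = vector [vector [1, \<sigma> * (2 * cot (pi / (2 * real n)))], vector [0, 1]]"

text \<open>The constant term of the piece \<open>(k, j)\<close>: shear with the bottom of strip
  \<open>k\<close> fixed, then go back from the \<open>j\<close>-th tile to the polygon. All pieces
  have the linear part \<open>twist_matrix n \<sigma>\<close>.\<close>

definition twist_offset :: "nat \<Rightarrow> real \<Rightarrow> nat \<Rightarrow> int \<Rightarrow> complex" where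
  "twist_offset n \<sigma> k j =
     - of_real (\<sigma> * (2 * cot (pi / (2 * real n))) * Im (vertex n k)) - tile_shift n k j"

definition strip_shear :: "nat \<Rightarrow> real \<Rightarrow> nat \<Rightarrow> complex \<Rightarrow> complex" where
  "strip_shear n \<sigma> k z =
     z + of_real (\<sigma> * (2 * cot (pi / (2 * real n))) * (Im z - Im (vertex n k)))"

lemma matrix_act_twist:
  "matrix_act (twist_matrix n \<sigma>) z + twist_offset n \<sigma> k j = strip_shear n \<sigma> k z - tile_shift n k j"
  by (simp add: matrix_act_def twist_matrix_def twist_offset_def strip_shear_def complex_eq_iff algebra_simps)

lemma Im_strip_shear [simp]: "Im (strip_shear n \<sigma> k z) = Im z"
  by (simp add: strip_shear_def)

lemma in_strip_shear [simp]: "in_strip n k (strip_shear n \<sigma> k z) \<longleftrightarrow> in_strip n k z"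
  by (simp add: in_strip_def)

lemma in_strip_unique:
  assumes "in_strip n k z" "in_strip n k' z" "k < k'"
  shows "Im z = Im (vertex n (Suc k))" "Im z = Im (vertex n k')"
proof -
  have "Im (vertex n (Suc k)) \<le> Im (vertex n k')"
    using vertex_Im_less[of "Suc k" k' n] assms by (cases "Suc k = k'") (auto simp: in_strip_def)
  with assms show "Im z = Im (vertex n (Suc k))" "Im z = Im (vertex n k')" by (auto simp: in_strip_def)
qed

text \<open>The vertices on the left are at the same heights as those on the right, and these
  heights bound the strips. Hence a horizontal motion inside a strip never reaches a
  puncture.\<close>

lemma vertex_Im_not_between:
  assumes "Suc k < n" "Im (vertex n k) < y" "y < Im (vertex n (Suc k))"
  shows "y \<noteq> Im (vertex n i)"
proof -
  have n0: "n > 0" using assms by simp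
  have le: "Im (vertex n a) \<le> Im (vertex n b)" if "a \<le> b" "b < n" for a b
    using vertex_Im_less[of a b n] that by (cases "a = b") auto
  have small: "y \<noteq> Im (vertex n m)" if "m < n" for m
    using le[of m k] le[of "Suc k" m] that assms by (cases "m \<le> k") auto
  define m where "m = i mod (2 * n)"
  have m: "m < 2 * n" "vertex n i = vertex n m" using n0 vertex_mod[OF n0] by (auto simp: m_def)
  show ?thesis
  proof (cases "m < n")
    case False
    have "Im (vertex n (2 * n - 1 - (2 * n - 1 - m))) = Im (vertex n (2 * n - 1 - m))"
      using vertex_mirror[of "2 * n - 1 - m" n] False m n0 by simp
    moreover have "2 * n - 1 - (2 * n - 1 - m) = m" using m by simp
    ultimately show ?thesis using small[of "2 * n - 1 - m"] m False by auto
  qed (use small m in auto)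
qed

lemma in_strip_exists:
  assumes n: "n \<ge> 2" and z: "z \<in> punctured_polygon n"
  shows "\<exists>k. in_strip n k z"
proof -
  have "side_height n (n - 1) z \<le> apothem n" "side_height n (2 * n - 1) z \<le> apothem n"
    using z punctured_polygon_iff[OF n] by auto
  then have "- apothem n \<le> Im z" "Im z \<le> apothem n" using side_height_top_bottom[of n] n by auto
  then show ?thesis using strip_exists[OF n] unfolding in_strip_def by metis
qed

text \<open>From the bottom to the top of a strip, the shear grows to the width of two tiles. This is the
  circumference of the cylinder that contains the strip, or twice the circumference if the strip is
  a rectangle. Hence the shears of the strips fit together to a map of the polygon surface that fixes
  the horizontal lines through the vertices. The case \<open>\<sigma> = - 1\<close> is the inverse map.\<close>

locale polygon_twist =
  fixes n :: nat and \<sigma> :: real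
  assumes n: "n \<ge> 2" and \<sigma>: "\<sigma> = 1 \<or> \<sigma> = - 1"
begin

lemma strip_shear_top:
  assumes "Im z = Im (vertex n (Suc k))"
  shows "strip_shear n \<sigma> k z - tile_shift n k (2 * \<lfloor>\<sigma>\<rfloor>) = z"
proof -
  \<comment> \<open>Tile indices are integers while \<open>\<sigma>\<close> is real; being 1 or -1,
    it equals its floor.\<close>
  obtain i :: int where "\<sigma> = of_int i" using \<sigma> by (metis of_int_1 of_int_minus)
  then have s: "of_int \<lfloor>\<sigma>\<rfloor> = \<sigma>" by simp
  have "\<sigma> * (2 * cot (pi / (2 * real n))) * (Im z - Im (vertex n k)) = \<sigma> * (2 * Re (side_width n k))"
    using shear_strip[of n k] n assms by simp
  then show ?thesis
    by (simp add: strip_shear_def tile_shift_def complex_eq_iff s)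
qed

lemma strip_shear_bottom:
  assumes "Im z = Im (vertex n k)" shows "strip_shear n \<sigma> k z - tile_shift n k 0 = z"
  using assms by (simp add: strip_shear_def tile_shift_def complex_eq_iff)

lemma polygon_subset_hull: "z \<in> punctured_polygon n \<Longrightarrow> z \<in> convex hull (range (vertex n))"
  by (simp add: punctured_polygon_def)

text \<open>At the bottom and the top of the strip, the tiles 0 and
  \<open>2 * \<lfloor>\<sigma>\<rfloor>\<close> give back \<open>z\<close> itself; strictly between
  them, no vertex has the height in question.\<close>

lemma twist_tile_exists:
  assumes z: "z \<in> punctured_polygon n" "in_strip n k z"
  obtains j where "strip_shear n \<sigma> k z - tile_shift n k j \<in> punctured_polygon n"
proof -
  consider "Im z = Im (vertex n k)" | "Im z = Im (vertex n (Suc k))"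
    | "Im (vertex n k) < Im z" "Im z < Im (vertex n (Suc k))"
    using z(2) unfolding in_strip_def by linarith
  then show ?thesis
  proof cases
    case 1
    then show ?thesis using that[of 0] z strip_shear_bottom by simp
  next
    case 2
    then show ?thesis using that[of "2 * \<lfloor>\<sigma>\<rfloor>"] z strip_shear_top by simp
  next
    case 3
    obtain j where j: "strip_shear n \<sigma> k z - tile_shift n k j \<in> convex hull (range (vertex n))"
      using tile_exists[OF n, of k "strip_shear n \<sigma> k z"] z(2) by auto
    let ?w = "strip_shear n \<sigma> k z - tile_shift n k j" and ?k = "tile_strip n k j"
    have k: "Suc k < n" using z(2) by (simp add: in_strip_def)
    have w: "Im ?w - Im (vertex n ?k) = Im z - Im (vertex n k)" "in_strip n ?k ?w"
      using in_strip_tile(1,2)[of n k "strip_shear n \<sigma> k z" j] z(2) by auto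
    have "Im (vertex n (Suc ?k)) - Im (vertex n ?k) = Im (vertex n (Suc k)) - Im (vertex n k)"
      using Im_vertex_conj[OF k] by (simp add: tile_strip_def)
    with w(1) 3 have "Im (vertex n ?k) < Im ?w" "Im ?w < Im (vertex n (Suc ?k))" by linarith+
    then have "Im ?w \<noteq> Im (vertex n i)" for i
      using vertex_Im_not_between[of ?k n "Im ?w" i] w(2) by (simp add: in_strip_def)
    then have "?w \<notin> range (vertex n)" by (metis rangeE)
    with j show ?thesis by (intro that[of j]) (simp add: punctured_polygon_def)
  qed
qed

text \<open>One tile in which the image avoids the vertices is known, and
  \<open>tile_overlap\<close> passes from it to every other tile that contains the image.\<close>

lemma twist_into:
  assumes z: "z \<in> punctured_polygon n" "in_strip n k z"
    and j: "strip_shear n \<sigma> k z - tile_shift n k j \<in> convex hull (range (vertex n))"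
  shows "strip_shear n \<sigma> k z - tile_shift n k j \<in> punctured_polygon n"
proof -
  obtain j0 where j0: "strip_shear n \<sigma> k z - tile_shift n k j0 \<in> punctured_polygon n"
    using twist_tile_exists[OF z] .
  have "in_strip n k (strip_shear n \<sigma> k z)" using z(2) by simp
  then show ?thesis by (rule tile_overlap(1)[OF n _ j0 j])
qed

lemma twist_compat_same:
  assumes z: "z \<in> punctured_polygon n" "in_strip n k z"
    and j: "strip_shear n \<sigma> k z - tile_shift n k j \<in> convex hull (range (vertex n))"
      "strip_shear n \<sigma> k z - tile_shift n k j' \<in> convex hull (range (vertex n))"
  shows "glue_class n (strip_shear n \<sigma> k z - tile_shift n k j') =
    glue_class n (strip_shear n \<sigma> k z - tile_shift n k j)"
proof -
  have "in_strip n k (strip_shear n \<sigma> k z)" using z(2) by simp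
  then show ?thesis by (rule tile_overlap(2)[OF n _ twist_into[OF z j(1)] j(2)])
qed

text \<open>One of the tiles returns \<open>z\<close> itself, and the choice of the tile does not
  affect the class.\<close>

lemma twist_fixes_boundary:
  assumes z: "z \<in> punctured_polygon n" "in_strip n k z"
    and y: "Im z = Im (vertex n k) \<or> Im z = Im (vertex n (Suc k))"
    and j: "strip_shear n \<sigma> k z - tile_shift n k j \<in> convex hull (range (vertex n))"
  shows "glue_class n (strip_shear n \<sigma> k z - tile_shift n k j) = glue_class n z"
proof -
  have "\<exists>j0. strip_shear n \<sigma> k z - tile_shift n k j0 = z"
    using y by (elim disjE) (rule exI, erule strip_shear_bottom, rule exI, erule strip_shear_top)
  then obtain j0 where j0: "strip_shear n \<sigma> k z - tile_shift n k j0 = z" by (rule exE)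
  have "strip_shear n \<sigma> k z - tile_shift n k j0 \<in> convex hull (range (vertex n))"
    unfolding j0 by (rule polygon_subset_hull[OF z(1)])
  from twist_compat_same[OF z this j] show ?thesis unfolding j0 .
qed

lemma twist_compat_point:
  assumes z: "z \<in> punctured_polygon n" "in_strip n k z" "in_strip n k' z"
    and j: "strip_shear n \<sigma> k z - tile_shift n k j \<in> convex hull (range (vertex n))"
      "strip_shear n \<sigma> k' z - tile_shift n k' j' \<in> convex hull (range (vertex n))"
  shows "glue_class n (strip_shear n \<sigma> k z - tile_shift n k j) =
    glue_class n (strip_shear n \<sigma> k' z - tile_shift n k' j')"
proof (cases "k = k'")
  case True
  show ?thesis using twist_compat_same[OF z(1,2) j(2)[folded True] j(1)] unfolding True .
next
  case False
  have "Im z = Im (vertex n k) \<or> Im z = Im (vertex n (Suc k))"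
    "Im z = Im (vertex n k') \<or> Im z = Im (vertex n (Suc k'))"
    using in_strip_unique[OF z(2,3)] in_strip_unique[OF z(3,2)] False by linarith+
  then show ?thesis using twist_fixes_boundary[OF z(1,2) _ j(1)] twist_fixes_boundary[OF z(1,3) _ j(2)] by simp
qed

text \<open>Gluing along a slanted side keeps the height above the bottom of the strip, so both
  points are sheared by the same amount and their images differ by \<open>side_width n i\<close>.
  This is one step of the tiling: tile \<open>j'\<close> seen from \<open>z'\<close> is tile
  \<open>j' + 1\<close> seen from \<open>z\<close>.\<close>

lemma twist_compat_right_side:
  assumes z: "z \<in> punctured_polygon n" "in_strip n k z"
    and z': "z' \<in> punctured_polygon n" "in_strip n k' z'" "z' = z - side_width n i"
    and i: "Suc i < n" "side_height n i z = apothem n"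
    and j: "strip_shear n \<sigma> k z - tile_shift n k j \<in> convex hull (range (vertex n))"
      "strip_shear n \<sigma> k' z' - tile_shift n k' j' \<in> convex hull (range (vertex n))"
  shows "glue_class n (strip_shear n \<sigma> k z - tile_shift n k j) =
    glue_class n (strip_shear n \<sigma> k' z' - tile_shift n k' j')"
proof -
  let ?i = "n - 2 - i"
  have n0: "n > 0" using n by simp
  obtain u where u: "0 < u" "u < 1" "z = (1 - u) *\<^sub>R vertex n i + u *\<^sub>R vertex n (Suc i)"
    using side_eq_if_side_height[OF n z(1) i(2)] by (auto simp: in_segment)
  let ?d = "Im (vertex n (Suc i)) - Im (vertex n i)"
  have "?d > 0" using vertex_Im_less[of i "Suc i" n] i(1) by simp
  then have "u * ?d > 0" "(1 - u) * ?d > 0" using u by auto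
  moreover have "Im z = Im (vertex n i) + u * ?d" "Im z = Im (vertex n (Suc i)) - (1 - u) * ?d"
    unfolding u(3) by (simp_all add: algebra_simps)
  ultimately have Imz: "Im (vertex n i) < Im z" "Im z < Im (vertex n (Suc i))" by linarith+
  have Imz': "Im (vertex n ?i) < Im z'" "Im z' < Im (vertex n (Suc ?i))"
    using Imz Im_vertex_conj[OF i(1)] Im_side_width[OF n0, of i] by (auto simp: z'(3))
  have uniq: "l = m" if "in_strip n l w" "Im (vertex n m) < Im w" "Im w < Im (vertex n (Suc m))" "Suc m < n"
    for l m w
  proof -
    have "in_strip n m w" using that by (simp add: in_strip_def)
    with in_strip_unique[OF that(1) this] in_strip_unique[OF this that(1)] that(2,3) show ?thesis
      by (cases l m rule: linorder_cases) auto
  qed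
  have k: "k = i" by (rule uniq[OF z(2) Imz i(1)])
  have k': "k' = ?i" by (rule uniq[OF z'(2) Imz']) (use i(1) in simp)
  have "strip_shear n \<sigma> k' z' = strip_shear n \<sigma> k z - side_width n i"
    using Im_vertex_conj(1)[OF i(1)] Im_side_width[OF n0, of i] unfolding k k' strip_shear_def z'(3) by simp
  then have eq: "strip_shear n \<sigma> k' z' - tile_shift n k' j' = strip_shear n \<sigma> k z - tile_shift n k (j' + 1)"
    using tile_shift_conj(2)[OF i(1), of j'] unfolding k k' by (simp add: diff_diff_eq)
  show ?thesis
    unfolding eq by (rule twist_compat_same[OF z j(2)[unfolded eq] j(1)])
qed

lemma twist_compat:
  assumes z: "z \<in> punctured_polygon n" "in_strip n k z"
    and z': "z' \<in> punctured_polygon n" "in_strip n k' z'" "glue_class n z = glue_class n z'"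
    and j: "strip_shear n \<sigma> k z - tile_shift n k j \<in> convex hull (range (vertex n))"
      "strip_shear n \<sigma> k' z' - tile_shift n k' j' \<in> convex hull (range (vertex n))"
  shows "glue_class n (strip_shear n \<sigma> k z - tile_shift n k j) =
    glue_class n (strip_shear n \<sigma> k' z' - tile_shift n k' j')"
proof (cases "z' = z")
  case True
  then show ?thesis using twist_compat_point[OF z(1,2)] z' j by simp
next
  case False
  have n0: "n > 0" using n by simp
  obtain i0 where i0: "side_height n i0 z = apothem n" "z' = z - side_width n i0"
    using glue_class_eq_iff[OF n z(1) z'(1)] z'(3) False by auto
  define i where "i = i0 mod (2 * n)"
  have i: "i < 2 * n" "side_height n i z = apothem n" "z' = z - side_width n i"
    using n0 i0 side_height_mod[OF n0, of i0] side_width_cong[OF n0, of i i0] by (auto simp: i_def)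
  have horizontal: "glue_class n (strip_shear n \<sigma> l w - tile_shift n l m) = glue_class n w"
    if "w \<in> punctured_polygon n" "in_strip n l w" "\<bar>Im w\<bar> = apothem n"
      "strip_shear n \<sigma> l w - tile_shift n l m \<in> convex hull (range (vertex n))" for w l m
  proof (rule twist_fixes_boundary[OF that(1,2) _ that(4)])
    have l: "Suc l < n" "Im (vertex n l) \<le> Im w" "Im w \<le> Im (vertex n (Suc l))"
      using that(2) by (auto simp: in_strip_def)
    have "Im (vertex n 0) \<le> Im (vertex n l)"
      using vertex_Im_less[of 0 l n] l(1) by (cases "l = 0") simp_all
    moreover have "Im (vertex n (Suc l)) \<le> Im (vertex n (n - 1))"
    proof (cases "Suc l = n - 1")
      case False
      then have "Suc l < n - 1" "n - 1 < n" using l(1) by auto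
      then show ?thesis using vertex_Im_less[of "Suc l" "n - 1" n] by simp
    qed simp
    ultimately have "Im w = Im (vertex n l) \<or> Im w = Im (vertex n (Suc l))"
      using l that(3) unfolding apothem_vertex_Im[OF n0] by linarith
    then show "Im w = Im (vertex n l) \<or> Im w = Im (vertex n (Suc l))" .
  qed
  \<comment> \<open>Right sides have indices below \<open>n - 1\<close>, the horizontal ones are
    \<open>n - 1\<close> and \<open>2 * n - 1\<close>, and a left side is handled by exchanging the
    roles of the two glued points.\<close>
  consider "Suc i < n" | "i = n - 1 \<or> i = 2 * n - 1" | "n \<le> i" "i < 2 * n - 1" using i(1) by linarith
  then show ?thesis
  proof cases
    case 1
    then show ?thesis using twist_compat_right_side[OF z z'(1,2) i(3)] i j by blast
  next
    case 2
    then have "(\<forall>w. side_height n i w = Im w) \<or> (\<forall>w. side_height n i w = - Im w)"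
      by (elim disjE) (simp_all only: side_height_top_bottom[OF n0] simp_thms)
    then have "\<bar>Im z\<bar> = apothem n \<and> \<bar>Im z'\<bar> = apothem n"
      using i(2) apothem_pos[OF n] side_height_width[of n i] unfolding i(3) by auto
    then show ?thesis using horizontal[OF z _ j(1)] horizontal[OF z'(1,2) _ j(2)] z'(3) by simp
  next
    case 3
    define m where "m = i - n"
    have m: "Suc m < n" "i = m + n" using 3 by (auto simp: m_def)
    have "z = z' - side_width n m" using i(3) side_width_shift[OF n0, of m] m by simp
    moreover have "side_height n m z' = apothem n"
      using i(2) side_height_shift[OF n0, of m z] side_height_diff[of n m z "side_width n i"]
        side_width_shift[OF n0, of m] side_height_width[of n m] side_height_add[of n m z "side_width n m"]
      unfolding i(3) m(2) by simp
    ultimately show ?thesis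
      using twist_compat_right_side[OF z'(1,2) z _ m(1) _ j(2,1)] by simp
  qed
qed

text \<open>In units of \<open>Re (side_width n k)\<close>, the point starts less than 1 from the
  centre, the shear adds at most 2, and a tile reaches less than 1 from its own centre; so the index
  is below 4 in absolute value. This makes the number of pieces finite.\<close>

lemma twist_index_bound:
  assumes z: "z \<in> punctured_polygon n" "in_strip n k z"
    and j: "strip_shear n \<sigma> k z - tile_shift n k j \<in> convex hull (range (vertex n))"
  shows "\<bar>j\<bar> \<le> 3"
proof -
  let ?\<rho> = "Re (side_width n k)" and ?\<zeta> = "strip_shear n \<sigma> k z"
  have n0: "n > 0" using n by simp
  have k: "Suc k < n" "Im (vertex n k) \<le> Im z" "Im z \<le> Im (vertex n (Suc k))" using z(2) by (auto simp: in_strip_def)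
  have lt: "tile_bound n k i (Im z) < ?\<rho>" for i
    using tile_bound_sum[OF k(1), of i "i + 1" "Im z"] tile_bound_pos[OF z(2), of "i + 1"] by simp
  have \<rho>: "?\<rho> > 0" using lt[of j] tile_bound_pos[OF z(2), of j] by simp
  have "\<bar>Re z\<bar> \<le> tile_bound n k 0 (Im z)"
    using strip_hull_iff[OF n k] polygon_subset_hull[OF z(1)] by (simp add: tile_bound_def)
  then have 1: "\<bar>Re z\<bar> < ?\<rho>" using lt[of 0] by simp
  let ?t = "2 * cot (pi / (2 * real n))"
  have t: "?t * (Im (vertex n (Suc k)) - Im (vertex n k)) = 2 * ?\<rho>" by (rule shear_strip[OF n0])
  have "Im (vertex n k) < Im (vertex n (Suc k))" using k(1) by (intro vertex_Im_less) auto
  then have tpos: "?t > 0" using t \<rho> by (metis diff_gt_0_iff_gt mult_pos_pos zero_less_mult_pos2 zero_less_numeral)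
  have "?t * (Im z - Im (vertex n k)) \<le> ?t * (Im (vertex n (Suc k)) - Im (vertex n k))"
    using k tpos by (intro mult_left_mono) auto
  moreover have "?t * (Im z - Im (vertex n k)) \<ge> 0" using k tpos by simp
  ultimately have "\<bar>\<sigma> * ?t * (Im z - Im (vertex n k))\<bar> \<le> 2 * ?\<rho>" using t \<sigma> by auto
  then have 2: "\<bar>Re ?\<zeta>\<bar> < 3 * ?\<rho>" using 1 by (simp add: strip_shear_def)
  have "\<bar>Re ?\<zeta> - j * ?\<rho>\<bar> \<le> tile_bound n k j (Im z)"
    using tile_hull_iff[OF n, of k ?\<zeta> j] z(2) j by simp
  with 2 lt[of j] have "\<bar>j * ?\<rho>\<bar> < 4 * ?\<rho>" by linarith
  then have "\<bar>real_of_int j\<bar> < 4" using \<rho> by (simp add: abs_mult)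
  then show ?thesis by linarith
qed

lemma twist_map:
  obtains \<alpha> where "continuous_map (polygon_topology n) (polygon_topology n) \<alpha>"
    "locally_affine (polygon_surface n) \<alpha> (twist_matrix n \<sigma>)"
    "\<And>z k j. \<lbrakk>z \<in> punctured_polygon n; in_strip n k z;
        strip_shear n \<sigma> k z - tile_shift n k j \<in> convex hull (range (vertex n))\<rbrakk> \<Longrightarrow>
       \<alpha> (glue_class n z) = glue_class n (strip_shear n \<sigma> k z - tile_shift n k j)"
proof -
  let ?S = "punctured_polygon n" and ?C = "convex hull (range (vertex n))"
  define I where "I = {0..n} \<times> {-3..3::int}"
  \<comment> \<open>The convex hull occurs here because the pieces must be closed and the punctured
    polygon is not; \<open>twist_into\<close> takes care of the vertices.\<close>
  define Q where "Q kj = {z. in_strip n (fst kj) z \<and>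
      matrix_act (twist_matrix n \<sigma>) z + twist_offset n \<sigma> (fst kj) (snd kj) \<in> ?C}" for kj
  have Q: "z \<in> Q (k, j) \<longleftrightarrow> in_strip n k z \<and> strip_shear n \<sigma> k z - tile_shift n k j \<in> ?C" for z k j
    by (simp add: Q_def matrix_act_twist)
  have n0: "n > 0" using n by simp
  have "range (vertex n) = vertex n ` {..<2 * n}"
  proof (intro equalityI subsetI)
    fix v assume "v \<in> range (vertex n)"
    then obtain i where "v = vertex n (i mod (2 * n))" using vertex_mod[OF n0] by auto
    then show "v \<in> vertex n ` {..<2 * n}" using n0 by auto
  qed auto
  then have "finite (range (vertex n))" by (metis finite_imageI finite_lessThan)
  then have C: "closed ?C" by (intro compact_imp_closed finite_imp_compact_convex_hull)
  have closedQ: "closed (Q kj)" for kj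
  proof (cases "Suc (fst kj) < n")
    case True
    have "Q kj = {z. Im (vertex n (fst kj)) \<le> Im z} \<inter> {z. Im z \<le> Im (vertex n (Suc (fst kj)))} \<inter>
        (\<lambda>z. matrix_act (twist_matrix n \<sigma>) z + twist_offset n \<sigma> (fst kj) (snd kj)) -` ?C"
      using True by (auto simp: Q_def in_strip_def)
    moreover have "closed \<dots>"
      by (intro closed_Int closed_Collect_le closed_vimage C continuous_intros)
    ultimately show ?thesis by simp
  next
    case False
    then have "Q kj = {}" by (auto simp: Q_def in_strip_def)
    then show ?thesis by simp
  qed
  have cover: "\<exists>kj \<in> I. z \<in> Q kj" if z: "z \<in> ?S" for z
  proof -
    obtain k where k: "in_strip n k z" using in_strip_exists[OF n z] by auto
    obtain j where "strip_shear n \<sigma> k z - tile_shift n k j \<in> ?S" using twist_tile_exists[OF z k] .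
    then have "strip_shear n \<sigma> k z - tile_shift n k j \<in> ?C" by (rule polygon_subset_hull)
    moreover from twist_index_bound[OF z k this] have "(k, j) \<in> I"
      using k by (auto simp: I_def in_strip_def)
    ultimately show ?thesis using k Q by blast
  qed
  obtain \<alpha> where \<alpha>: "continuous_map (polygon_topology n) (polygon_topology n) \<alpha>"
    "locally_affine (polygon_surface n) \<alpha> (twist_matrix n \<sigma>)"
    "\<And>kj z. \<lbrakk>kj \<in> I; z \<in> ?S; z \<in> Q kj\<rbrakk> \<Longrightarrow> \<alpha> (glue_class n z) =
       glue_class n (matrix_act (twist_matrix n \<sigma>) z + twist_offset n \<sigma> (fst kj) (snd kj))"
  proof (rule polygon_cut_and_paste[where I = I and Q = Q and A = "twist_matrix n \<sigma>" and n = n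
        and b = "\<lambda>kj. twist_offset n \<sigma> (fst kj) (snd kj)"])
    show "matrix_act (twist_matrix n \<sigma>) z + twist_offset n \<sigma> (fst kj) (snd kj) \<in> ?S"
      if "kj \<in> I" "z \<in> ?S" "z \<in> Q kj" for kj z
      using that twist_into[of z "fst kj" "snd kj"] Q[of z "fst kj" "snd kj"] by (simp add: matrix_act_twist)
    show "glue_class n (matrix_act (twist_matrix n \<sigma>) z + twist_offset n \<sigma> (fst kj) (snd kj)) =
        glue_class n (matrix_act (twist_matrix n \<sigma>) z' + twist_offset n \<sigma> (fst kj') (snd kj'))"
      if "kj \<in> I" "kj' \<in> I" "z \<in> ?S" "z' \<in> ?S" "z \<in> Q kj" "z' \<in> Q kj'" "glue_class n z = glue_class n z'"
      for kj kj' z z'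
      using twist_compat[of z "fst kj" z' "fst kj'" "snd kj" "snd kj'"] that
        Q[of z "fst kj" "snd kj"] Q[of z' "fst kj'" "snd kj'"] by (simp add: matrix_act_twist)
    show "finite I" by (simp add: I_def)
  qed (use closedQ cover in auto)
  show ?thesis
  proof (rule that[OF \<alpha>(1,2)])
    fix z k j assume z: "z \<in> ?S" "in_strip n k z" "strip_shear n \<sigma> k z - tile_shift n k j \<in> ?C"
    have "(k, j) \<in> I" using twist_index_bound[OF z] z(2) by (auto simp: I_def in_strip_def)
    then show "\<alpha> (glue_class n z) = glue_class n (strip_shear n \<sigma> k z - tile_shift n k j)"
      using \<alpha>(3)[of "(k, j)" z] z Q by (simp add: matrix_act_twist)
  qed
qed

text \<open>The image has kept its height above the bottom of the strip, so the opposite shear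
  undoes the first one; seen from strip \<open>tile_strip n k j\<close>, the way back is tile
  \<open>- j\<close>.\<close>

lemma twist_inverse_step:
  assumes z: "z \<in> punctured_polygon n" "in_strip n k z"
  defines "w j \<equiv> strip_shear n \<sigma> k z - tile_shift n k j"
  shows "strip_shear n (- \<sigma>) (tile_strip n k j) (w j) - tile_shift n (tile_strip n k j) (- j) = z"
proof -
  have k: "Suc k < n" using z by (simp add: in_strip_def)
  have "Im (w j) - Im (vertex n (tile_strip n k j)) = Im z - Im (vertex n k)"
    using in_strip_tile(2)[of n k "strip_shear n \<sigma> k z" j] z(2) by (simp add: w_def)
  then have "strip_shear n (- \<sigma>) (tile_strip n k j) (w j) =
      w j - of_real (\<sigma> * (2 * cot (pi / (2 * real n))) * (Im z - Im (vertex n k)))"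
    by (simp only: strip_shear_def) simp
  then show ?thesis unfolding tile_shift_conj(1)[OF k] by (simp add: w_def strip_shear_def)
qed

end

lemma polygon_shear:
  assumes n: "n \<ge> 2"
  obtains \<alpha> where "affine_automorphism (polygon_surface n) \<alpha> (shear_matrix n)"
proof -
  let ?S = "punctured_polygon n" and ?T = "polygon_topology n" and ?C = "convex hull (range (vertex n))"
  interpret p: polygon_twist n 1 by unfold_locales (use n in auto)
  interpret m: polygon_twist n "- 1" by unfold_locales (use n in auto)
  obtain \<alpha> where \<alpha>: "continuous_map ?T ?T \<alpha>"
    "locally_affine (polygon_surface n) \<alpha> (twist_matrix n 1)"
    "\<And>z k j. \<lbrakk>z \<in> ?S; in_strip n k z; strip_shear n 1 k z - tile_shift n k j \<in> ?C\<rbrakk> \<Longrightarrow>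
       \<alpha> (glue_class n z) = glue_class n (strip_shear n 1 k z - tile_shift n k j)"
    by (rule p.twist_map, rule that)
  obtain \<beta> where \<beta>: "continuous_map ?T ?T \<beta>"
    "\<And>z k j. \<lbrakk>z \<in> ?S; in_strip n k z; strip_shear n (- 1) k z - tile_shift n k j \<in> ?C\<rbrakk> \<Longrightarrow>
       \<beta> (glue_class n z) = glue_class n (strip_shear n (- 1) k z - tile_shift n k j)"
    by (rule m.twist_map, rule that)
  have "homeomorphic_maps ?T ?T \<alpha> \<beta>"
    unfolding homeomorphic_maps_def
  proof (intro conjI ballI)
    fix x assume "x \<in> topspace ?T"
    then obtain z where z: "z \<in> ?S" "x = glue_class n z" by (auto simp: topspace_polygon_topology)
    obtain k where k: "in_strip n k z" using in_strip_exists[OF n z(1)] by auto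
    show "\<beta> (\<alpha> x) = x"
    proof -
      obtain j where j: "strip_shear n 1 k z - tile_shift n k j \<in> ?S" using p.twist_tile_exists[OF z(1) k] .
      have strip': "in_strip n (tile_strip n k j) (strip_shear n 1 k z - tile_shift n k j)"
        using in_strip_tile(1)[of n k "strip_shear n 1 k z" j] k by simp
      have inv: "strip_shear n (- 1) (tile_strip n k j) (strip_shear n 1 k z - tile_shift n k j) -
          tile_shift n (tile_strip n k j) (- j) = z"
        using p.twist_inverse_step[OF z(1) k, of j] by simp
      have "\<beta> (glue_class n (strip_shear n 1 k z - tile_shift n k j)) = glue_class n z"
        using \<beta>(2)[OF j strip', of "- j"] p.polygon_subset_hull[OF z(1)] unfolding inv by simp
      with \<alpha>(3)[OF z(1) k p.polygon_subset_hull[OF j]] z(2) show ?thesis by simp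
    qed
    show "\<alpha> (\<beta> x) = x"
    proof -
      obtain j where j: "strip_shear n (- 1) k z - tile_shift n k j \<in> ?S" using m.twist_tile_exists[OF z(1) k] .
      have strip': "in_strip n (tile_strip n k j) (strip_shear n (- 1) k z - tile_shift n k j)"
        using in_strip_tile(1)[of n k "strip_shear n (- 1) k z" j] k by simp
      have inv: "strip_shear n 1 (tile_strip n k j) (strip_shear n (- 1) k z - tile_shift n k j) -
          tile_shift n (tile_strip n k j) (- j) = z"
        using m.twist_inverse_step[OF z(1) k, of j] by simp
      have "\<alpha> (glue_class n (strip_shear n (- 1) k z - tile_shift n k j)) = glue_class n z"
        using \<alpha>(3)[OF j strip', of "- j"] p.polygon_subset_hull[OF z(1)] unfolding inv by simp
      with \<beta>(2)[OF z(1) k p.polygon_subset_hull[OF j]] z(2) show ?thesis by simp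
    qed
  qed (use \<alpha>(1) \<beta>(1) in auto)
  then have "homeomorphic_map ?T ?T \<alpha>" by (auto simp: homeomorphic_map_maps)
  moreover have "twist_matrix n 1 = shear_matrix n" by (simp add: twist_matrix_def shear_matrix_def)
  ultimately have "affine_automorphism (polygon_surface n) \<alpha> (shear_matrix n)"
    using \<alpha>(2) by (simp add: affine_automorphism_def)
  then show thesis by (rule that)
qed

section \<open>Coverings of translation surfaces\<close>

lemma coordinate_on_openD: "coordinate_on T U z \<Longrightarrow> openin T U"
  by (simp add: coordinate_on_def)

lemma coordinate_on_subset_topspace: "coordinate_on T U z \<Longrightarrow> U \<subseteq> topspace T"
  by (rule openin_subset) (rule coordinate_on_openD)

lemma coordinate_on_inj:
  assumes "coordinate_on T U z" shows "inj_on z U"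
proof -
  have "homeomorphic_map (subtopology T U) (top_of_set (z ` U)) z" using assms by (simp add: coordinate_on_def)
  then have "inj_on z (topspace (subtopology T U))" by (simp add: homeomorphic_eq_everything_map)
  then show ?thesis using coordinate_on_subset_topspace[OF assms] by (simp add: Int_absorb1)
qed

lemma coordinate_on_open_image:
  assumes c: "coordinate_on T U z" and E: "openin T E" "E \<subseteq> U"
  shows "open (z ` E)"
proof -
  have h: "homeomorphic_map (subtopology T U) (top_of_set (z ` U)) z" and o: "open (z ` U)"
    using c by (simp_all add: coordinate_on_def)
  have "openin (subtopology T U) E" using E by (auto simp: openin_subtopology_alt)
  then have "openin (top_of_set (z ` U)) (z ` E)"
    using h by (simp add: homeomorphic_eq_everything_map open_map_def)
  then show ?thesis using o openin_open_eq by blast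
qed

lemma coordinate_on_open_preimage:
  assumes c: "coordinate_on T U z" and G: "open G" shows "openin T {u \<in> U. z u \<in> G}"
proof -
  have U: "U \<subseteq> topspace T" using coordinate_on_subset_topspace[OF c] .
  have "continuous_map (subtopology T U) (top_of_set (z ` U)) z"
    using c by (simp add: coordinate_on_def homeomorphic_imp_continuous_map)
  then have "continuous_map (subtopology T U) euclidean z" by (rule continuous_map_into_fulltopology)
  from openin_continuous_map_preimage[OF this, of G] G
  have "openin (subtopology T U) {u \<in> U. z u \<in> G}" using U by (simp add: Int_absorb1)
  then show ?thesis using coordinate_on_openD[OF c] by (simp add: openin_open_subtopology)
qed

locale translation_covering =
  fixes X :: "'a surface" and P :: "'b surface" and p :: "'a \<Rightarrow> 'b"
  assumes RX: "riemann_surface X" and TP: "translation_surface P" and cov: "finite_unramified_covering X P p"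
begin

abbreviation "TX \<equiv> surface_topology X"
abbreviation "TY \<equiv> surface_topology P"

lemma X_chart:
  assumes "(U, z) \<in> atlas X" shows "coordinate_on TX U z"
proof -
  have "\<forall>(U, z) \<in> atlas X. coordinate_on TX U z" using RX by (simp add: riemann_surface_def)
  with assms show ?thesis by (auto dest: bspec)
qed

lemma X_chart_exists:
  assumes "x \<in> points X" obtains U z where "(U, z) \<in> atlas X" "x \<in> U"
proof -
  have "\<Union> (fst ` atlas X) = points X" using RX by (simp add: riemann_surface_def)
  with assms have "x \<in> \<Union> (fst ` atlas X)" by (simp only:)
  then show ?thesis using that by auto
qed

lemma P_chart:
  assumes "(V, w) \<in> atlas P" shows "coordinate_on TY V w"
proof -
  have "\<forall>(U, z) \<in> atlas P. coordinate_on TY U z" using TP by (simp add: translation_surface_def)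
  with assms show ?thesis by (auto dest: bspec)
qed

lemma cov_map: "covering_map TX TY p" and cont_p: "continuous_map TX TY p" and hol_p: "holomorphic_map X P p"
proof -
  show "covering_map TX TY p" and "holomorphic_map X P p"
    using cov by (simp_all add: finite_unramified_covering_def)
  then show "continuous_map TX TY p" unfolding covering_map_def by (elim conjE)
qed

lemma p_points: "x \<in> points X \<Longrightarrow> p x \<in> points P"
  using cont_p by (auto simp: continuous_map_def)

lemma P_chart_exists:
  assumes "x \<in> points X" obtains V w where "(V, w) \<in> atlas P" "p x \<in> V"
  using translation_surface_chart[OF TP p_points[OF assms]] .

text \<open>On a sheet \<open>p\<close> is injective, so its coordinate expression is an injective
  holomorphic function; here the topological covering property enters the complex analysis.\<close>

lemma chart_comparison:
  assumes ch: "(U, z) \<in> atlas X" "(V, w) \<in> atlas P" "x \<in> U" "p x \<in> V"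
  obtains E where "openin TX E" "x \<in> E" "E \<subseteq> U" "\<And>y. y \<in> E \<Longrightarrow> p y \<in> V"
    "(w \<circ> p \<circ> inv_into U z) holomorphic_on z ` E" "inj_on (w \<circ> p \<circ> inv_into U z) (z ` E)"
    "\<And>y. y \<in> E \<Longrightarrow> (w \<circ> p \<circ> inv_into U z) (z y) = w (p y)"
proof -
  have U: "coordinate_on TX U z" by (rule X_chart[OF ch(1)])
  have V: "coordinate_on TY V w" by (rule P_chart[OF ch(2)])
  have x: "x \<in> topspace TX" using ch(3) coordinate_on_subset_topspace[OF U] by blast
  obtain D where D: "p x \<in> D" "evenly_covered TX TY p D"
    by (rule covering_map_evenly_covered[OF cov_map p_points[OF x]])
  obtain S q where S: "openin TX S" "x \<in> S" "\<And>u. u \<in> S \<Longrightarrow> q (p u) = u"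
    by (rule evenly_coveredE[OF D(2) x D(1)], rule that)
  define E where "E = (U \<inter> S) \<inter> {y \<in> topspace TX. p y \<in> V}"
  have inv: "inv_into U z (z y) = y" if "y \<in> U" for y using coordinate_on_inj[OF U] that by simp
  have val: "(w \<circ> p \<circ> inv_into U z) (z y) = w (p y)" if "y \<in> E" for y
    using inv[of y] that by (simp add: E_def)
  show ?thesis
  proof (rule that[of E])
    show "openin TX E"
      unfolding E_def using openin_Int[OF openin_Int[OF coordinate_on_openD[OF U] S(1)]
        openin_continuous_map_preimage[OF cont_p coordinate_on_openD[OF V]]] .
    show "x \<in> E" using ch x S(2) by (simp add: E_def)
    have "(w \<circ> p \<circ> inv_into U z) holomorphic_on z ` {y \<in> U. p y \<in> V}"
      using hol_p ch(1,2) unfolding holomorphic_map_def by blast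
    then show "(w \<circ> p \<circ> inv_into U z) holomorphic_on z ` E"
      by (rule holomorphic_on_subset) (auto simp: E_def)
    show "inj_on (w \<circ> p \<circ> inv_into U z) (z ` E)"
    proof (rule inj_onI)
      fix s t assume "s \<in> z ` E" "t \<in> z ` E" "(w \<circ> p \<circ> inv_into U z) s = (w \<circ> p \<circ> inv_into U z) t"
      then obtain y y' where y: "y \<in> E" "s = z y" "y' \<in> E" "t = z y'" "w (p y) = w (p y')"
        using val by auto
      have "p y = p y'"
        by (rule inj_onD[OF coordinate_on_inj[OF V] y(5)]) (use y in \<open>auto simp: E_def\<close>)
      moreover have "q (p y) = y" "q (p y') = y'" using y by (auto simp: E_def intro!: S(3))
      ultimately have "y = y'" by metis
      then show "s = t" using y by simp
    qed
  qed (use val in \<open>auto simp: E_def\<close>)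
qed

text \<open>An injective holomorphic function has no critical points.\<close>

lemma deriv_chart_nonzero:
  assumes "(U, z) \<in> atlas X" "(V, w) \<in> atlas P" "x \<in> U" "p x \<in> V"
  shows "((w \<circ> p \<circ> inv_into U z) has_field_derivative deriv (w \<circ> p \<circ> inv_into U z) (z x)) (at (z x))"
    "deriv (w \<circ> p \<circ> inv_into U z) (z x) \<noteq> 0"
proof -
  obtain E where E: "openin TX E" "x \<in> E" "E \<subseteq> U"
      "(w \<circ> p \<circ> inv_into U z) holomorphic_on z ` E" "inj_on (w \<circ> p \<circ> inv_into U z) (z ` E)"
    by (rule chart_comparison[OF assms], rule that)
  have o: "open (z ` E)" by (rule coordinate_on_open_image[OF X_chart[OF assms(1)] E(1,3)])
  have m: "z x \<in> z ` E" using E(2) by simp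
  show "((w \<circ> p \<circ> inv_into U z) has_field_derivative deriv (w \<circ> p \<circ> inv_into U z) (z x)) (at (z x))"
    by (rule holomorphic_derivI[OF E(4) o m])
  show "deriv (w \<circ> p \<circ> inv_into U z) (z x) \<noteq> 0"
    by (rule holomorphic_injective_imp_regular[OF E(4) o E(5) m])
qed

definition pulled_back_qdiff :: "'a qdiff" where
  "pulled_back_qdiff = pullback_qdiff P p (\<lambda>c x. 1)"

text \<open>The definition of \<open>pullback_qdiff\<close> takes some chart around
  \<open>p x\<close>. Any other chart differs from it by a translation near \<open>p x\<close>,
  which does not change the derivative.\<close>

lemma pullback_value:
  assumes ch: "(U, z) \<in> atlas X" "(V, w) \<in> atlas P" "x \<in> U" "p x \<in> V"
  shows "pulled_back_qdiff (U, z) x = (deriv (w \<circ> p \<circ> inv_into U z) (z x))\<^sup>2"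
proof -
  define c where "c = (SOME c. c \<in> atlas P \<and> p x \<in> fst c)"
  have "c \<in> atlas P \<and> p x \<in> fst c" unfolding c_def by (rule someI[where x = "(V, w)"]) (use ch in simp)
  then obtain V0 w0 where c: "c = (V0, w0)" "(V0, w0) \<in> atlas P" "p x \<in> V0" by (cases c) auto
  have q: "pulled_back_qdiff (U, z) x = (deriv (w0 \<circ> p \<circ> inv_into U z) (z x))\<^sup>2"
    unfolding pulled_back_qdiff_def pullback_qdiff_def by (simp add: c_def[symmetric] c(1))
  have "locally_affine P (\<lambda>x. x) (mat 1)" using TP by (simp add: translation_surface_def)
  from locally_affineE[OF this ch(2) c(2) ch(4) c(3)] obtain W k where W: "openin TY W" "p x \<in> W"
      "\<And>y. y \<in> W \<Longrightarrow> w0 y = matrix_act (mat 1) (w y) + k" by metis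
  have U: "coordinate_on TX U z" by (rule X_chart[OF ch(1)])
  have x: "x \<in> topspace TX" using ch(3) coordinate_on_subset_topspace[OF U] by blast
  let ?E = "U \<inter> {y \<in> topspace TX. p y \<in> W}"
  have "openin TX ?E"
    using openin_Int[OF coordinate_on_openD[OF U] openin_continuous_map_preimage[OF cont_p W(1)]] .
  then have o: "open (z ` ?E)" by (rule coordinate_on_open_image[OF U]) auto
  have m: "z x \<in> z ` ?E" using ch(3) x W(2) by simp
  have "\<forall>\<^sub>F t in nhds (z x). (w0 \<circ> p \<circ> inv_into U z) t = (w \<circ> p \<circ> inv_into U z) t + k"
    using eventually_nhds_in_open[OF o m]
  proof eventually_elim
    case (elim t)
    then obtain y where y: "y \<in> U" "p y \<in> W" "t = z y" by auto
    have "inv_into U z t = y" using coordinate_on_inj[OF U] y by simp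
    then show ?case using W(3)[OF y(2)] by simp
  qed
  then have "deriv (w0 \<circ> p \<circ> inv_into U z) (z x) = deriv (\<lambda>t. (w \<circ> p \<circ> inv_into U z) t + k) (z x)"
    by (intro deriv_cong_ev refl)
  also have "\<dots> = deriv (w \<circ> p \<circ> inv_into U z) (z x)"
    using DERIV_add[OF deriv_chart_nonzero(1)[OF ch] DERIV_const[of k]] by (intro DERIV_imp_deriv) simp
  finally show ?thesis using q by simp
qed

lemma nonzero_points_eq: "nonzero_points X pulled_back_qdiff = points X"
proof -
  have "pulled_back_qdiff c x \<noteq> 0" if x: "x \<in> points X" and c: "c \<in> atlas X" "x \<in> fst c" for x c
  proof -
    obtain U z where "c = (U, z)" by (cases c)
    then have ch: "(U, z) \<in> atlas X" "x \<in> U" using c by auto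
    obtain V w where V: "(V, w) \<in> atlas P" "p x \<in> V" using P_chart_exists[OF x] .
    show ?thesis
      using pullback_value[OF ch(1) V(1) ch(2) V(2)] deriv_chart_nonzero(2)[OF ch(1) V(1) ch(2) V(2)]
      by (simp add: \<open>c = (U, z)\<close>)
  qed
  then show ?thesis by (auto simp: nonzero_points_def)
qed

text \<open>The derivatives of \<open>\<zeta>\<close> and \<open>w \<circ> p\<close> in a coordinate
  have the same square, so on a disc their quotient is continuous with values 1 or -1, hence a
  constant \<open>s\<close>. Then the difference of \<open>\<zeta>\<close> and \<open>s\<close>
  times \<open>w \<circ> p\<close> has derivative 0.\<close>

lemma flat_chart:
  assumes fl: "(D, \<zeta>) \<in> flat_structure X pulled_back_qdiff" "x \<in> D" and V: "(V, w) \<in> atlas P" "p x \<in> V"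
  obtains E s c where "openin TX E" "x \<in> E" "E \<subseteq> D" "\<And>y. y \<in> E \<Longrightarrow> p y \<in> V" "s = 1 \<or> s = - 1"
    "\<And>y. y \<in> E \<Longrightarrow> \<zeta> y = s * w (p y) + c"
proof -
  have D: "coordinate_on TX D \<zeta>" and fd: "\<And>U z y. \<lbrakk>(U, z) \<in> atlas X; y \<in> U; y \<in> D\<rbrakk> \<Longrightarrow>
      \<exists>d. ((\<zeta> \<circ> inv_into U z) has_field_derivative d) (at (z y)) \<and> d\<^sup>2 = pulled_back_qdiff (U, z) y"
    using fl(1) unfolding flat_structure_def by fast+
  have x: "x \<in> points X" using fl(2) coordinate_on_subset_topspace[OF D] by blast
  obtain U z where U: "(U, z) \<in> atlas X" "x \<in> U" using X_chart_exists[OF x] .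
  let ?\<phi> = "w \<circ> p \<circ> inv_into U z" and ?F = "\<zeta> \<circ> inv_into U z"
  obtain E where E: "openin TX E" "x \<in> E" "E \<subseteq> U" "\<And>y. y \<in> E \<Longrightarrow> p y \<in> V"
      "?\<phi> holomorphic_on z ` E" "\<And>y. y \<in> E \<Longrightarrow> ?\<phi> (z y) = w (p y)"
    by (rule chart_comparison[OF U(1) V(1) U(2) V(2)], rule that)
  have Uc: "coordinate_on TX U z" by (rule X_chart[OF U(1)])
  have inv: "inv_into U z (z y) = y" if "y \<in> U" for y using coordinate_on_inj[OF Uc] that by simp
  have ED: "openin TX (E \<inter> D)" by (rule openin_Int[OF E(1) coordinate_on_openD[OF D]])
  have "open (z ` (E \<inter> D))" by (rule coordinate_on_open_image[OF Uc ED]) (use E(3) in auto)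
  moreover have "z x \<in> z ` (E \<inter> D)" using E(2) fl(2) by simp
  ultimately obtain e where e: "e > 0" "ball (z x) e \<subseteq> z ` (E \<inter> D)" using openE by blast
  let ?B = "ball (z x) e"
  have der: "\<exists>d. (?F has_field_derivative d) (at t) \<and> d\<^sup>2 = (deriv ?\<phi> t)\<^sup>2 \<and> deriv ?\<phi> t \<noteq> 0 \<and>
      (?\<phi> has_field_derivative deriv ?\<phi> t) (at t)" if tB: "t \<in> ?B" for t
  proof -
    obtain y where y: "y \<in> E" "y \<in> D" "t = z y" using e(2) tB by blast
    have yU: "y \<in> U" using y(1) E(3) by blast
    have yV: "p y \<in> V" by (rule E(4)[OF y(1)])
    show ?thesis
      using fd[OF U(1) yU y(2)] pullback_value[OF U(1) V(1) yU yV] deriv_chart_nonzero[OF U(1) V(1) yU yV]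
      unfolding y(3) by auto
  qed
  have "?F holomorphic_on ?B"
    unfolding holomorphic_on_def using der by (metis field_differentiable_at_within field_differentiable_def)
  then have "deriv ?F holomorphic_on ?B" by (intro holomorphic_deriv) auto
  moreover have "?\<phi> holomorphic_on ?B" using E(5) e(2) by (elim holomorphic_on_subset) auto
  then have "deriv ?\<phi> holomorphic_on ?B" by (intro holomorphic_deriv) auto
  moreover have dF: "(deriv ?F t)\<^sup>2 = (deriv ?\<phi> t)\<^sup>2" "deriv ?\<phi> t \<noteq> 0" if "t \<in> ?B" for t
    using der[OF that] DERIV_imp_deriv by metis+
  ultimately have "continuous_on ?B (\<lambda>t. deriv ?F t / deriv ?\<phi> t)"
    by (intro continuous_on_divide holomorphic_on_imp_continuous_on) auto
  then have "connected ((\<lambda>t. deriv ?F t / deriv ?\<phi> t) ` ?B)"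
    by (intro connected_continuous_image) auto
  moreover have sub: "(\<lambda>t. deriv ?F t / deriv ?\<phi> t) ` ?B \<subseteq> {1, - 1}"
  proof
    fix h assume "h \<in> (\<lambda>t. deriv ?F t / deriv ?\<phi> t) ` ?B"
    then obtain t where t: "t \<in> ?B" "h = deriv ?F t / deriv ?\<phi> t" by auto
    have "h\<^sup>2 = 1" using dF[OF t(1)] by (simp add: t(2) power_divide)
    then show "h \<in> {1, - 1}" by (simp add: power2_eq_1_iff)
  qed
  then have "finite ((\<lambda>t. deriv ?F t / deriv ?\<phi> t) ` ?B)" by (rule finite_subset) simp
  ultimately have "(\<lambda>t. deriv ?F t / deriv ?\<phi> t) ` ?B = {} \<or> (\<exists>s. (\<lambda>t. deriv ?F t / deriv ?\<phi> t) ` ?B = {s})"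
    using connected_finite_iff_sing by blast
  moreover have "z x \<in> ?B" using e(1) by simp
  ultimately obtain s where s: "(\<lambda>t. deriv ?F t / deriv ?\<phi> t) ` ?B = {s}" by blast
  then have s1: "s = 1 \<or> s = - 1" using sub by auto
  have sd: "deriv ?F t = s * deriv ?\<phi> t" if t: "t \<in> ?B" for t
  proof -
    have "deriv ?F t / deriv ?\<phi> t = s" using s t by blast
    then show ?thesis using dF(2)[OF t] by (simp add: field_simps)
  qed
  have "\<exists>c. \<forall>t \<in> ?B. ?F t - s * ?\<phi> t = c"
  proof (rule has_field_derivative_zero_constant)
    fix t assume t: "t \<in> ?B"
    obtain d where d: "(?F has_field_derivative d) (at t)" "(?\<phi> has_field_derivative deriv ?\<phi> t) (at t)"
      using der[OF t] by blast
    have "((\<lambda>t. ?F t - s * ?\<phi> t) has_field_derivative d - s * deriv ?\<phi> t) (at t)"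
      by (rule DERIV_diff[OF d(1) DERIV_cmult[OF d(2)]])
    moreover have "d = s * deriv ?\<phi> t" using DERIV_imp_deriv[OF d(1)] sd[OF t] by simp
    ultimately show "((\<lambda>t. ?F t - s * ?\<phi> t) has_field_derivative 0) (at t within ?B)"
      by (simp add: has_field_derivative_at_within)
  qed simp
  then obtain c where c: "\<And>t. t \<in> ?B \<Longrightarrow> ?F t - s * ?\<phi> t = c" by blast
  let ?E = "(E \<inter> D) \<inter> {u \<in> U. z u \<in> ?B}"
  show ?thesis
  proof (rule that[of ?E s c])
    show "openin TX ?E" by (rule openin_Int[OF ED coordinate_on_open_preimage[OF Uc open_ball]])
    show "\<zeta> y = s * w (p y) + c" if "y \<in> ?E" for y
      using c[of "z y"] that E(6)[of y] inv[of y] by (auto simp: algebra_simps)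
  qed (use E(2,3,4) fl(2) U(2) e(1) s1 in auto)
qed

text \<open>By \<open>flat_chart\<close>, flat charts of \<open>X\<close> are charts of
  \<open>P\<close> up to signs \<open>s1\<close>, \<open>s2\<close> and constants, so
  \<open>f\<close> inherits the matrix of \<open>\<beta>\<close> with the sign
  \<open>s1 * s2\<close>.\<close>

lemma lift_affine_with_derivative:
  assumes f: "continuous_map TX TX f" and \<beta>: "locally_affine P \<beta> A"
    and pf: "\<And>x. x \<in> points X \<Longrightarrow> p (f x) = \<beta> (p x)"
  shows "affine_with_derivative X pulled_back_qdiff f A"
proof -
  have "\<exists>W s c. openin TX W \<and> x \<in> W \<and> W \<subseteq> {y \<in> U. f y \<in> V} \<and> s \<in> {1, -1} \<and>
           (\<forall>y \<in> W. w (f y) = s * matrix_act A (z y) + c)"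
    if ch: "(U, z) \<in> flat_structure X pulled_back_qdiff" "(V, w) \<in> flat_structure X pulled_back_qdiff" "x \<in> U" "f x \<in> V" for U z V w x
  proof -
    have "coordinate_on TX U z" using ch(1) by (simp add: flat_structure_def)
    then have x: "x \<in> points X" using ch(3) coordinate_on_subset_topspace by blast
    have fx: "f x \<in> points X" using f x by (auto simp: continuous_map_def)
    obtain U0 u0 where U0: "(U0, u0) \<in> atlas P" "p x \<in> U0" using P_chart_exists[OF x] .
    obtain V0 v0 where V0: "(V0, v0) \<in> atlas P" "p (f x) \<in> V0" using P_chart_exists[OF fx] .
    obtain E1 s1 c1 where E1: "openin TX E1" "x \<in> E1" "E1 \<subseteq> U" "s1 = 1 \<or> s1 = - 1"
        "\<And>y. y \<in> E1 \<Longrightarrow> z y = s1 * u0 (p y) + c1"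
      by (rule flat_chart[OF ch(1,3) U0], rule that)
    obtain E2 s2 c2 where E2: "openin TX E2" "f x \<in> E2" "E2 \<subseteq> V" "s2 = 1 \<or> s2 = - 1"
        "\<And>y. y \<in> E2 \<Longrightarrow> w y = s2 * v0 (p y) + c2"
      by (rule flat_chart[OF ch(2,4) V0], rule that)
    have "\<beta> (p x) \<in> V0" using pf[OF x] V0(2) by simp
    then obtain W c0 where W: "openin TY W" "p x \<in> W" "\<And>y. y \<in> W \<Longrightarrow> v0 (\<beta> y) = matrix_act A (u0 y) + c0"
      using locally_affineE[OF \<beta> U0(1) V0(1) U0(2)] by metis
    let ?W = "E1 \<inter> {y \<in> topspace TX. f y \<in> E2} \<inter> {y \<in> topspace TX. p y \<in> W}"
    have oW: "openin TX ?W"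
      by (rule openin_Int[OF openin_Int[OF E1(1) openin_continuous_map_preimage[OF f E2(1)]]
            openin_continuous_map_preimage[OF cont_p W(1)]])
    have eq: "w (f y) = (s1 * s2) * matrix_act A (z y) + (s2 * (c0 - s1 * matrix_act A c1) + c2)" if y: "y \<in> ?W" for y
    proof -
      have "w (f y) = s2 * (matrix_act A (u0 (p y)) + c0) + c2"
        using E2(5)[of "f y"] pf[of y] W(3)[of "p y"] y by simp
      moreover have "matrix_act A (z y) = s1 * matrix_act A (u0 (p y)) + matrix_act A c1"
      proof -
        have "matrix_act A (- 1 * v) = - 1 * matrix_act A v" for v
          by (simp add: matrix_act_def complex_eq_iff)
        then show ?thesis using E1(4) E1(5)[of y] y by (auto simp: matrix_act_add)
      qed
      moreover have "s1 * s1 = 1" using E1(4) by auto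
      ultimately show ?thesis by (simp add: algebra_simps)
    qed
    have "s1 * s2 \<in> {1, - 1}" using E1(4) E2(4) by auto
    moreover have "?W \<subseteq> {y \<in> U. f y \<in> V}" "x \<in> ?W" using E1(2,3) E2(2,3) x W(2) by auto
    ultimately show ?thesis using oW eq by (intro exI conjI ballI) assumption+
  qed
  then show ?thesis unfolding affine_with_derivative_def by blast
qed

text \<open>In conformal charts \<open>f\<close> is locally \<open>h \<circ> L\<close>: the affine
  map between charts of \<open>P\<close> is preceded by the holomorphic \<open>p\<close> and
  followed by a local inverse \<open>h\<close> of \<open>p\<close>. Its derivative has the form
  treated in \<open>affine_derivative_imp_quasiconformal_at\<close>, with the same bound at every
  point.\<close>

lemma lift_quasiconformal:
  assumes f: "homeomorphic_map TX TX f" and \<beta>: "locally_affine P \<beta> A" and A: "det A = 1"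
    and pf: "\<And>x. x \<in> points X \<Longrightarrow> p (f x) = \<beta> (p x)"
  shows "quasiconformal_homeo X f"
proof -
  have cf: "continuous_map TX TX f" using f by (rule homeomorphic_imp_continuous_map)
  have "orientation_preserving_at (w \<circ> f \<circ> inv_into U z) (z x) \<and>
        dilatation_bounded_at (dilatation_bound A) (w \<circ> f \<circ> inv_into U z) (z x)"
    if ch: "(U, z) \<in> atlas X" "(V, w) \<in> atlas X" "x \<in> U" "f x \<in> V" for U z V w x
  proof -
    let ?g = "w \<circ> f \<circ> inv_into U z"
    have Uc: "coordinate_on TX U z" and Vc: "coordinate_on TX V w" using X_chart ch by auto
    have x: "x \<in> points X" using ch(3) coordinate_on_subset_topspace[OF Uc] by blast
    have fx: "f x \<in> points X" using cf x by (auto simp: continuous_map_def)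
    obtain U0 u0 where U0: "(U0, u0) \<in> atlas P" "p x \<in> U0" using P_chart_exists[OF x] .
    obtain V0 v0 where V0: "(V0, v0) \<in> atlas P" "p (f x) \<in> V0" using P_chart_exists[OF fx] .
    let ?\<phi> = "u0 \<circ> p \<circ> inv_into U z" and ?\<psi> = "v0 \<circ> p \<circ> inv_into V w"
    obtain E1 where E1: "openin TX E1" "x \<in> E1" "E1 \<subseteq> U" "?\<phi> holomorphic_on z ` E1"
        "\<And>y. y \<in> E1 \<Longrightarrow> ?\<phi> (z y) = u0 (p y)"
      by (rule chart_comparison[OF ch(1) U0(1) ch(3) U0(2)], rule that)
    obtain E2 where E2: "openin TX E2" "f x \<in> E2" "E2 \<subseteq> V" "?\<psi> holomorphic_on w ` E2"
        "inj_on ?\<psi> (w ` E2)" "\<And>y. y \<in> E2 \<Longrightarrow> ?\<psi> (w y) = v0 (p y)"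
      by (rule chart_comparison[OF ch(2) V0(1) ch(4) V0(2)], rule that)
    have o2: "open (w ` E2)" by (rule coordinate_on_open_image[OF Vc E2(1,3)])
    obtain h where h: "h holomorphic_on (?\<psi> ` w ` E2)" "\<And>t. t \<in> w ` E2 \<Longrightarrow> deriv ?\<psi> t * deriv h (?\<psi> t) = 1"
        "\<And>t. t \<in> w ` E2 \<Longrightarrow> h (?\<psi> t) = t"
      by (rule holomorphic_has_inverse[OF E2(4) o2 E2(5)], rule that)
    have oI: "open (?\<psi> ` w ` E2)" by (rule open_mapping_thm3[OF E2(4) o2 E2(5)])
    have "\<beta> (p x) \<in> V0" using pf[OF x] V0(2) by simp
    then obtain W c0 where W: "openin TY W" "p x \<in> W" "\<And>y. y \<in> W \<Longrightarrow> v0 (\<beta> y) = matrix_act A (u0 y) + c0"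
      using locally_affineE[OF \<beta> U0(1) V0(1) U0(2)] by metis
    let ?E = "E1 \<inter> {y \<in> topspace TX. f y \<in> E2} \<inter> {y \<in> topspace TX. p y \<in> W}"
    have oE: "openin TX ?E"
      by (rule openin_Int[OF openin_Int[OF E1(1) openin_continuous_map_preimage[OF cf E2(1)]]
            openin_continuous_map_preimage[OF cont_p W(1)]])
    have ozE: "open (z ` ?E)" by (rule coordinate_on_open_image[OF Uc oE]) (use E1(3) in auto)
    have mem: "z x \<in> z ` ?E" using E1(2) E2(2) W(2) x by auto
    define L where "L t = matrix_act A (?\<phi> t) + c0" for t
    have key: "?g t = h (L t) \<and> L t \<in> ?\<psi> ` w ` E2" if tE: "t \<in> z ` ?E" for t
    proof -
      obtain y where y: "y \<in> E1" "y \<in> points X" "f y \<in> E2" "p y \<in> W" "t = z y" using tE by auto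
      have inv: "inv_into U z (z y) = y" using coordinate_on_inj[OF Uc] y(1) E1(3) by auto
      have "?\<psi> (w (f y)) = v0 (p (f y))" by (rule E2(6)[OF y(3)])
      also have "\<dots> = matrix_act A (u0 (p y)) + c0" using pf[OF y(2)] W(3)[OF y(4)] by simp
      also have "\<dots> = L t" using E1(5)[OF y(1)] by (simp only: L_def y(5))
      finally have eq: "?\<psi> (w (f y)) = L t" .
      have "h (?\<psi> (w (f y))) = w (f y)" using y(3) by (intro h(3)) auto
      then have "h (L t) = w (f y)" unfolding eq .
      then have "?g t = h (L t)" using inv by (simp add: y(5))
      moreover have "L t \<in> ?\<psi> ` w ` E2" unfolding eq[symmetric] using y(3) by blast
      ultimately show ?thesis ..
    qed
    let ?c = "deriv ?\<phi> (z x)" and ?d = "deriv h (L (z x))"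
    have c: "(?\<phi> has_field_derivative ?c) (at (z x))" "?c \<noteq> 0"
      using deriv_chart_nonzero[OF ch(1) U0(1) ch(3) U0(2)] by auto
    have Lx: "L (z x) \<in> ?\<psi> ` w ` E2" using key[OF mem] by simp
    then have d: "(h has_field_derivative ?d) (at (L (z x)))" by (rule holomorphic_derivI[OF h(1) oI])
    have d0: "?d \<noteq> 0" using Lx h(2) by fastforce
    have "(L has_derivative (\<lambda>v. matrix_act A (?c * v))) (at (z x))"
      unfolding L_def
      using has_derivative_add[OF bounded_linear.has_derivative[OF bounded_linear_matrix_act
            c(1)[unfolded has_field_derivative_def]] has_derivative_const[of c0]] by simp
    from has_derivative_compose[OF this d[unfolded has_field_derivative_def]]
    have "((\<lambda>t. h (L t)) has_derivative (\<lambda>v. ?d * matrix_act A (?c * v))) (at (z x))" .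
    then have gd: "(?g has_derivative (\<lambda>v. ?d * matrix_act A (?c * v))) (at (z x))"
      by (rule has_derivative_transform_within_open[OF _ ozE mem]) (simp only: key)
    obtain e where e: "e > 0" "ball (z x) e \<subseteq> z ` ?E" using openE[OF ozE mem] .
    have "continuous_on (ball (z x) e) (\<lambda>t. h (L t))"
    proof (rule continuous_on_compose2[OF holomorphic_on_imp_continuous_on[OF h(1)]])
      have "continuous_on (ball (z x) e) ?\<phi>"
        using e(2) by (intro holomorphic_on_imp_continuous_on holomorphic_on_subset[OF E1(4)]) auto
      then show "continuous_on (ball (z x) e) L" unfolding L_def by (intro continuous_intros)
      show "L ` ball (z x) e \<subseteq> ?\<psi> ` w ` E2" using key e(2) by blast
    qed
    then have gc: "continuous_on (ball (z x) e) ?g"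
      by (rule continuous_on_eq) (use key e(2) in auto)
    show ?thesis
      using affine_derivative_imp_quasiconformal_at[OF gd d0 c(2) A e(1) gc] by blast
  qed
  then show ?thesis
    unfolding quasiconformal_homeo_def using f by blast
qed

lemma lift_in_veech_group:
  assumes f: "homeomorphic_map TX TX f" and \<beta>: "locally_affine P \<beta> A" and A: "det A = 1"
    and pf: "\<And>x. x \<in> points X \<Longrightarrow> p (f x) = \<beta> (p x)"
  shows "psl_class A \<in> veech_group X pulled_back_qdiff"
proof -
  have aff: "affine_with_derivative X pulled_back_qdiff f A"
    by (rule lift_affine_with_derivative[OF homeomorphic_imp_continuous_map[OF f] \<beta> pf])
  have "f ` points X = points X" using f by (rule homeomorphic_imp_surjective_map)
  then have "f \<in> affine_homeos X pulled_back_qdiff"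
    using aff lift_quasiconformal[OF f \<beta> A pf] by (auto simp: affine_homeos_def nonzero_points_eq)
  with aff A show ?thesis by (auto simp: veech_group_def SL2R_def)
qed

end

section \<open>Monodromy and the finite index argument\<close>

lemma det_shear_matrix: "det (shear_matrix n) = 1"
  by (simp add: shear_matrix_def det_2)

lemma det_rotation_matrix: "det (rotation_matrix n) = 1"
  by (simp add: rotation_matrix_def det_2 power2_eq_square[symmetric])

text \<open>The reservoir for the calculation: it contains the two generators and is closed under
  products, so all words in the generators stay in it.\<close>

definition affine_derivatives :: "nat \<Rightarrow> (real^2^2) set" where
  "affine_derivatives n = {A. det A = 1 \<and> (\<exists>\<alpha>. affine_automorphism (polygon_surface n) \<alpha> A)}"

lemma affine_derivatives_one: "mat 1 \<in> affine_derivatives n"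
proof -
  have "affine_automorphism (polygon_surface n) (\<lambda>x. x) (mat 1)"
    using locally_affine_polygon_id homeomorphic_map_id[of "polygon_topology n"]
    by (auto simp: affine_automorphism_def id_def)
  then show ?thesis by (auto simp: affine_derivatives_def)
qed

lemma affine_derivatives_mult:
  assumes n: "n \<ge> 2" and A: "A \<in> affine_derivatives n" and B: "B \<in> affine_derivatives n"
  shows "A ** B \<in> affine_derivatives n"
proof -
  obtain \<alpha> \<beta> where \<alpha>: "affine_automorphism (polygon_surface n) \<alpha> A"
      and \<beta>: "affine_automorphism (polygon_surface n) \<beta> B"
    using A B by (auto simp: affine_derivatives_def)
  have "affine_automorphism (polygon_surface n) (\<alpha> \<circ> \<beta>) (A ** B)"
    by (rule affine_automorphism_compose[OF translation_surface_polygon[OF n] \<beta> \<alpha>])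
  moreover have "det (A ** B) = 1" using A B by (simp add: affine_derivatives_def det_mul)
  ultimately show ?thesis unfolding affine_derivatives_def by blast
qed

lemma shear_in_affine_derivatives:
  assumes "n \<ge> 2" shows "shear_matrix n \<in> affine_derivatives n"
proof -
  obtain \<alpha> where "affine_automorphism (polygon_surface n) \<alpha> (shear_matrix n)"
    by (rule polygon_shear[OF assms])
  then show ?thesis using det_shear_matrix unfolding affine_derivatives_def by blast
qed

lemma rotation_in_affine_derivatives:
  assumes "n \<ge> 2" shows "rotation_matrix n \<in> affine_derivatives n"
proof -
  obtain \<alpha> where "affine_automorphism (polygon_surface n) \<alpha> (rotation_matrix n)"
    by (rule polygon_rotation[OF assms])
  then show ?thesis using det_rotation_matrix unfolding affine_derivatives_def by blast
qed

locale polygon_covering =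
  fixes n :: nat and X :: "'a surface" and p :: "'a \<Rightarrow> complex set" and G :: "('a \<Rightarrow> 'a) set"
  assumes n: "n \<ge> 2" and RX: "riemann_surface X"
    and cov: "finite_unramified_covering X (polygon_surface n) p"
    and deck: "transitive_deck_maps (surface_topology X) p G" and finG: "finite G"
begin

abbreviation "S \<equiv> punctured_polygon n"

sublocale translation_covering X "polygon_surface n" p
  using RX cov translation_surface_polygon[OF n] by unfold_locales

lemma haus: "Hausdorff_space TX" and conn: "connected_space TX" and nonempty: "points X \<noteq> {}"
  using RX unfolding riemann_surface_def by blast+

lemmas G = transitive_deck_mapsD[OF deck]

text \<open>The covering \<open>\<alpha>\<^sup>-\<^sup>1 \<circ> p\<close> is described by a lift \<open>s\<close> of the polygon and by the deck transformations
  \<open>d k\<close> by which the lifts of two opposite sides differ.\<close>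

definition monodromy :: "(complex set \<Rightarrow> complex set) \<Rightarrow> (complex \<Rightarrow> 'a) \<Rightarrow> (nat \<Rightarrow> 'a \<Rightarrow> 'a) \<Rightarrow> bool" where
  "monodromy \<alpha> s d \<longleftrightarrow> continuous_map (top_of_set S) TX s \<and> (\<forall>z \<in> S. p (s z) = \<alpha> (glue_class n z)) \<and>
     d \<in> {..<2 * n} \<rightarrow>\<^sub>E G \<and>
     (\<forall>k < 2 * n. \<forall>z \<in> S. side_height n k z = apothem n \<longrightarrow> s (z - side_width n k) = d k (s z))"

text \<open>Convexity of the polygon gives the lift \<open>s\<close>. Along an open side,
  \<open>s\<close> after the translation and \<open>g \<circ> s\<close> lift the same map, so a deck
  transformation that relates them at one point relates them on the whole connected side.\<close>

lemma monodromy_exists: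
  assumes \<alpha>: "continuous_map TY TY \<alpha>"
  obtains s d where "monodromy \<alpha> s d"
proof -
  have \<psi>: "continuous_map (top_of_set S) TY (\<alpha> \<circ> glue_class n)"
    using continuous_map_compose[OF continuous_map_glue_class(1)] \<alpha> by simp
  obtain s where s: "continuous_map (top_of_set S) TX s"
      and ps: "\<And>z. z \<in> S \<Longrightarrow> p (s z) = (\<alpha> \<circ> glue_class n) z"
    by (rule covering_map_lift_convex[OF cov_map haus convex_punctured_polygon[OF n] \<psi>], rule that)
  have sX: "s z \<in> points X" if "z \<in> S" for z using s that by (auto simp: continuous_map_def)
  have "\<exists>g \<in> G. \<forall>z \<in> S. side_height n k z = apothem n \<longrightarrow> s (z - side_width n k) = g (s z)" for k
  proof (cases "\<exists>z \<in> S. side_height n k z = apothem n")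
    case False
    obtain x0 where "x0 \<in> points X" using nonempty by blast
    then obtain g where "g \<in> G" using G(3)[of x0 x0] by blast
    with False show ?thesis by blast
  next
    case True
    let ?D = "open_segment (vertex n k) (vertex n (Suc k))" and ?v = "side_width n k"
    obtain z0 where z0: "z0 \<in> S" "side_height n k z0 = apothem n" using True by blast
    have DS: "z \<in> S" "z - ?v \<in> S" "glue_class n (z - ?v) = glue_class n z" if "z \<in> ?D" for z
    proof -
      note z = side_heights_on_side(2,1)[OF n that]
      show "z \<in> S" by (rule z(1))
      show "z - ?v \<in> S" by (rule side_translate(1)[OF n z])
      with z show "glue_class n (z - ?v) = glue_class n z"
        using glue_class_eq_iff[OF n z(1), of "z - ?v"] by auto
    qed
    have z0D: "z0 \<in> ?D" by (rule side_eq_if_side_height[OF n z0])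
    have "p (s z0) = p (s (z0 - ?v))" using ps DS[OF z0D] by simp
    then obtain g where g: "g \<in> G" "g (s z0) = s (z0 - ?v)"
      using G(3)[OF sX[OF z0(1)] sX[OF DS(2)[OF z0D]]] by blast
    have "s (z - ?v) = g (s z)" if z: "z \<in> S" "side_height n k z = apothem n" for z
    proof -
      have zD: "z \<in> ?D" by (rule side_eq_if_side_height[OF n z])
      have C: "connected_space (top_of_set ?D)"
        by (simp add: connected_space_subtopology convex_connected convex_open_segment)
      have sub: "?D \<subseteq> S" using DS(1) by blast
      have sD: "continuous_map (top_of_set ?D) TX s" by (rule continuous_map_from_subtopology_mono[OF s sub])
      have c1: "continuous_map (top_of_set ?D) TX (s \<circ> (\<lambda>z. z - ?v))"
      proof (rule continuous_map_compose[OF _ s])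
        show "continuous_map (top_of_set ?D) (top_of_set S) (\<lambda>z. z - ?v)"
          using DS(2) by (auto intro!: continuous_intros)
      qed
      have c2: "continuous_map (top_of_set ?D) TX (g \<circ> s)" by (rule continuous_map_compose[OF sD G(1)[OF g(1)]])
      have c3: "p ((s \<circ> (\<lambda>z. z - ?v)) c) = p ((g \<circ> s) c)" if "c \<in> topspace (top_of_set ?D)" for c
      proof -
        have c: "c \<in> ?D" using that by simp
        show ?thesis using DS[OF c] ps G(2)[OF g(1) sX[OF DS(1)[OF c]]] by simp
      qed
      have c4: "(s \<circ> (\<lambda>z. z - ?v)) z0 = (g \<circ> s) z0" using g(2) by simp
      have "z0 \<in> topspace (top_of_set ?D)" "z \<in> topspace (top_of_set ?D)" using z0D zD by auto
      from covering_map_lift_unique[OF cov_map haus C c1 c2 c3 this(1) c4 this(2)]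
      show ?thesis by simp
    qed
    with g(1) show ?thesis by blast
  qed
  then obtain d where d: "\<And>k. d k \<in> G"
      "\<And>k z. \<lbrakk>z \<in> S; side_height n k z = apothem n\<rbrakk> \<Longrightarrow> s (z - side_width n k) = d k (s z)"
    by metis
  \<comment> \<open>Restriction puts the tuple into a function space that is finite for finite
    \<open>G\<close>.\<close>
  have "monodromy \<alpha> s (restrict d {..<2 * n})"
    unfolding monodromy_def using s ps d by auto
  then show ?thesis by (rule that)
qed

lemma deck_fixed_point:
  assumes g: "g \<in> G" "x \<in> points X" "g x = x" and y: "y \<in> points X"
  shows "g y = y"
proof -
  have c: "continuous_map TX TX (\<lambda>x. x)" by simp
  have pg: "p (g c) = p c" if "c \<in> points X" for c by (rule G(2)[OF g(1) that])
  show ?thesis by (rule covering_map_lift_unique[OF cov_map haus conn G(1)[OF g(1)] c pg g(2,3) y])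
qed

text \<open>With \<open>\<alpha> \<circ> glue_class n\<close> and
  \<open>\<alpha>' \<circ> glue_class n\<close> as quotient maps, \<open>s\<close> and
  \<open>s'\<close> are sections over the same polygon with the same side transformations. The
  resulting homeomorphism carries translates of \<open>s\<close> to translates of \<open>s'\<close>,
  so it covers \<open>\<alpha>' \<circ> \<gamma>\<close>, where \<open>\<gamma>\<close> inverts
  \<open>\<alpha>\<close>.\<close>

lemma same_monodromy_imp_veech:
  assumes \<alpha>: "affine_automorphism (polygon_surface n) \<alpha> A" and \<alpha>': "affine_automorphism (polygon_surface n) \<alpha>' B"
    and det: "det A = 1" "det B = 1" and mono: "monodromy \<alpha> s d" "monodromy \<alpha>' s' d" and A': "A' ** A = mat 1"
  shows "psl_class (B ** A') \<in> veech_group X pulled_back_qdiff"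
proof -
  have n0: "n > 0" using n by simp
  have s: "continuous_map (top_of_set S) TX s" "\<And>z. z \<in> S \<Longrightarrow> p (s z) = \<alpha> (glue_class n z)"
      "\<And>k z. \<lbrakk>k < 2 * n; z \<in> S; side_height n k z = apothem n\<rbrakk> \<Longrightarrow> s (z - side_width n k) = d k (s z)"
      and dG: "\<And>k. k < 2 * n \<Longrightarrow> d k \<in> G"
    using mono(1) unfolding monodromy_def by (auto simp: PiE_iff)
  have s': "continuous_map (top_of_set S) TX s'" "\<And>z. z \<in> S \<Longrightarrow> p (s' z) = \<alpha>' (glue_class n z)"
      "\<And>k z. \<lbrakk>k < 2 * n; z \<in> S; side_height n k z = apothem n\<rbrakk> \<Longrightarrow> s' (z - side_width n k) = d k (s' z)"
    using mono(2) unfolding monodromy_def by auto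
  have h: "homeomorphic_map TY TY \<alpha>" "homeomorphic_map TY TY \<alpha>'"
    using \<alpha> \<alpha>' by (auto simp: affine_automorphism_def)
  obtain \<gamma> where \<gamma>: "homeomorphic_maps TY TY \<alpha> \<gamma>" using h(1) by (auto simp: homeomorphic_map_maps)
  have glue_in: "glue_class n z \<in> topspace TY" if "z \<in> S" for z
    using that by (simp add: topspace_polygon_topology)
  have inj: "\<alpha> (glue_class n z) = \<alpha> (glue_class n z') \<longleftrightarrow> glue_class n z = glue_class n z'"
      "\<alpha>' (glue_class n z) = \<alpha>' (glue_class n z') \<longleftrightarrow> glue_class n z = glue_class n z'"
    if "z \<in> S" "z' \<in> S" for z z'
    using h glue_in[OF that(1)] glue_in[OF that(2)]
    by (auto simp: homeomorphic_eq_everything_map dest: inj_onD)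
  have sX: "s z \<in> points X" "s' z \<in> points X" if "z \<in> S" for z
    using s(1) s'(1) that by (auto simp: continuous_map_def)
  have quot: "quotient_map (top_of_set S) TY (glue_class n)"
    using continuous_map_glue_class(2) by simp
  have q: "quotient_map (top_of_set S) TY (\<alpha> \<circ> glue_class n)" "quotient_map (top_of_set S) TY (\<alpha>' \<circ> glue_class n)"
    using h by (auto simp: homeomorphic_map_def intro: quotient_map_compose[OF quot])
  have data: "\<exists>k \<in> G. s z' = k (s z) \<and> s' z' = k (s' z)"
    if zz: "z \<in> S" "z' \<in> S" "glue_class n z = glue_class n z'" for z z'
  proof (cases "z' = z")
    case True
    \<comment> \<open>Transitivity on fibres supplies an element that fixes \<open>s z\<close>; a
      deck map with one fixed point fixes every point, in particular \<open>s' z\<close>.\<close>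
    obtain k where "k \<in> G" "k (s z) = s z" using G(3)[OF sX(1)[OF zz(1)] sX(1)[OF zz(1)]] by blast
    then show ?thesis using deck_fixed_point[of k "s z" "s' z"] sX[OF zz(1)] True by metis
  next
    case False
    then obtain i where i: "side_height n i z = apothem n" "z' = z - side_width n i"
      using glue_class_eq_iff[OF n zz(1,2)] zz(3) by auto
    define k where "k = i mod (2 * n)"
    have k: "k < 2 * n" "side_height n k z = apothem n" "z' = z - side_width n k"
      using n0 i side_height_mod[OF n0, of i z] side_width_cong[OF n0, of k i] by (auto simp: k_def)
    show ?thesis using dG[OF k(1)] s(3)[OF k(1) zz(1) k(2)] s'(3)[OF k(1) zz(1) k(2)] k(3) by blast
  qed
  obtain f where f: "homeomorphic_map TX TX f"
      "\<And>g z. \<lbrakk>g \<in> G; z \<in> topspace (top_of_set S)\<rbrakk> \<Longrightarrow> f (g (s z)) = g (s' z)"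
      "\<And>x. x \<in> topspace TX \<Longrightarrow> \<exists>g \<in> G. \<exists>z \<in> topspace (top_of_set S). x = g (s z)"
  proof (rule covering_map_deck_equivariant_homeomorphism[OF cov_map haus conn deck q _ s(1) _ s'(1)])
    show "(\<alpha> \<circ> glue_class n) z = (\<alpha> \<circ> glue_class n) z' \<longleftrightarrow> (\<alpha>' \<circ> glue_class n) z = (\<alpha>' \<circ> glue_class n) z'"
      if "z \<in> topspace (top_of_set S)" "z' \<in> topspace (top_of_set S)" for z z'
      using inj[of z z'] that by simp
    show "\<exists>k \<in> G. s z' = k (s z) \<and> s' z' = k (s' z)"
      if "z \<in> topspace (top_of_set S)" "z' \<in> topspace (top_of_set S)"
        "(\<alpha> \<circ> glue_class n) z = (\<alpha> \<circ> glue_class n) z'" for z z'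
      using data[of z z'] inj(1)[of z z'] that by simp
  qed (use s(2) s'(2) that in auto)
  have "affine_automorphism (polygon_surface n) (\<alpha>' \<circ> \<gamma>) (B ** A')"
    by (rule affine_automorphism_compose[OF TP affine_automorphism_inverse[OF TP \<alpha> \<gamma> A'] \<alpha>'])
  then have loc: "locally_affine (polygon_surface n) (\<alpha>' \<circ> \<gamma>) (B ** A')" by (simp add: affine_automorphism_def)
  have "det A' * det A = 1" using arg_cong[OF A', of det] by (simp add: det_mul)
  then have det': "det (B ** A') = 1" using det by (simp add: det_mul)
  have pf: "p (f x) = (\<alpha>' \<circ> \<gamma>) (p x)" if x: "x \<in> points X" for x
  proof -
    obtain g z where gz: "g \<in> G" "z \<in> S" "x = g (s z)" using f(3)[OF x] by auto
    have "p (f x) = \<alpha>' (glue_class n z)" using f(2)[OF gz(1), of z] gz G(2)[OF gz(1) sX(2)[OF gz(2)]] s'(2) by simp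
    moreover have "p x = \<alpha> (glue_class n z)" using gz G(2)[OF gz(1) sX(1)[OF gz(2)]] s(2) by simp
    moreover have "\<gamma> (\<alpha> (glue_class n z)) = glue_class n z"
      using \<gamma> glue_in[OF gz(2)] by (simp add: homeomorphic_maps_def)
    ultimately show ?thesis by simp
  qed
  show ?thesis by (rule lift_in_veech_group[OF f(1) loc det' pf])
qed

lemma calculation_stops: "rs_stops n (veech_group X pulled_back_qdiff)"
proof -
  let ?A = "affine_derivatives n"
  \<comment> \<open>A class consists of a matrix and its negative; the colour is taken from one
    chosen matrix, with one chosen automorphism and lift.\<close>
  define rep where "rep C = (SOME A. A \<in> ?A \<and> psl_class A = C)" for C
  have rep: "rep C \<in> ?A" "psl_class (rep C) = C" if "C \<in> psl_class ` ?A" for C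
  proof -
    have "\<exists>A. A \<in> ?A \<and> psl_class A = C" using that by auto
    from someI_ex[OF this] show "rep C \<in> ?A" "psl_class (rep C) = C" unfolding rep_def by auto
  qed
  have "\<exists>\<alpha> s d. affine_automorphism (polygon_surface n) \<alpha> A \<and> monodromy \<alpha> s d" if A: "A \<in> ?A" for A
  proof -
    obtain \<alpha> where \<alpha>: "affine_automorphism (polygon_surface n) \<alpha> A" using A by (auto simp: affine_derivatives_def)
    then have "continuous_map TY TY \<alpha>" by (simp add: affine_automorphism_def homeomorphic_imp_continuous_map)
    then obtain s d where "monodromy \<alpha> s d" by (rule monodromy_exists)
    with \<alpha> show ?thesis by blast
  qed
  then obtain \<alpha> s d where asd: "\<And>A. A \<in> ?A \<Longrightarrow> affine_automorphism (polygon_surface n) (\<alpha> A) A"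
      "\<And>A. A \<in> ?A \<Longrightarrow> monodromy (\<alpha> A) (s A) (d A)"
    by metis
  have det: "det A = 1" if "A \<in> ?A" for A using that by (simp add: affine_derivatives_def)
  have mult: "psl_class A \<otimes>\<^bsub>PSL2R\<^esub> psl_class B \<in> psl_class ` ?A" if "A \<in> ?A" "B \<in> ?A" for A B
    using psl_class_mult[OF det[OF that(1)] det[OF that(2)]] affine_derivatives_mult[OF n that] by simp
  show ?thesis
  proof (rule rs_stops_if_finitely_coloured[where M = "psl_class ` ?A" and F = "\<lambda>C. d (rep C)"])
    show "psl_class (mat 1) \<in> psl_class ` ?A" using affine_derivatives_one by blast
    show "C \<otimes>\<^bsub>PSL2R\<^esub> psl_class (shear_matrix n) \<in> psl_class ` ?A" if "C \<in> psl_class ` ?A" for C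
      using that mult shear_in_affine_derivatives[OF n] by blast
    show "C \<otimes>\<^bsub>PSL2R\<^esub> psl_class (rotation_matrix n) \<in> psl_class ` ?A" if "C \<in> psl_class ` ?A" for C
      using that mult rotation_in_affine_derivatives[OF n] by blast
    have "(\<lambda>C. d (rep C)) ` psl_class ` ?A \<subseteq> {..<2 * n} \<rightarrow>\<^sub>E G"
      using asd(2) rep(1) unfolding monodromy_def by blast
    then show "finite ((\<lambda>C. d (rep C)) ` psl_class ` ?A)"
      by (rule finite_subset) (intro finite_PiE finG finite_lessThan)
    fix C D assume CD: "C \<in> psl_class ` ?A" "D \<in> psl_class ` ?A" "d (rep C) = d (rep D)"
    have dC: "det (rep C) = 1" and dD: "det (rep D) = 1" using det rep(1) CD by auto
    then obtain C' where C': "rep C ** C' = mat 1" "C' ** rep C = mat 1"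
      using invertible_det_nz[of "rep C"] by (auto simp: invertible_def)
    have dC': "det C' = 1" using arg_cong[OF C'(1), of det] dC by (simp add: det_mul)
    have "psl_class (rep D ** C') \<in> veech_group X pulled_back_qdiff"
      using same_monodromy_imp_veech[OF asd(1)[OF rep(1)[OF CD(1)]] asd(1)[OF rep(1)[OF CD(2)]] dC dD
          asd(2)[OF rep(1)[OF CD(1)]] _ C'(2)] asd(2)[OF rep(1)[OF CD(2)]] CD(3) by simp
    moreover have "D \<otimes>\<^bsub>PSL2R\<^esub> inv\<^bsub>PSL2R\<^esub> C = psl_class (rep D) \<otimes>\<^bsub>PSL2R\<^esub> inv\<^bsub>PSL2R\<^esub> psl_class (rep C)"
      using rep(2) CD by simp
    moreover have "\<dots> = psl_class (rep D ** C')"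
      by (simp only: psl_class_inv[OF dC dC' C'(1)] psl_class_mult[OF dD dC'])
    ultimately show "D \<otimes>\<^bsub>PSL2R\<^esub> inv\<^bsub>PSL2R\<^esub> C \<in> veech_group X pulled_back_qdiff" by simp
  qed
qed

end

theorem theorem7p1:
  fixes n :: nat and X :: "'a surface" and p :: "'a \<Rightarrow> complex set"
  assumes "n \<ge> 4"
    and "finite_abelian_covering X (polygon_surface n) p"
  shows "rs_stops n (veech_group X (pullback_qdiff (polygon_surface n) p polygon_qdiff))"
proof -
  let ?T = "surface_topology X" and ?G = "carrier (Gal X p)"
  have n: "n \<ge> 2" using assms(1) by simp
  have RX: "riemann_surface X" and cov: "finite_unramified_covering X (polygon_surface n) p"
    and gal: "galois_covering X p"
    using assms(2) by (simp_all add: finite_abelian_covering_def)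
  have G: "g \<in> Bij (points X)" "holomorphic_map X X g" "\<And>x. x \<in> points X \<Longrightarrow> p (g x) = p x" if "g \<in> ?G" for g
    using that by (auto simp: Gal_def)
  have cG: "continuous_map ?T ?T g" if "g \<in> ?G" for g
    using G(2)[OF that] by (simp add: holomorphic_map_def)
  have deck: "transitive_deck_maps ?T p ?G"
    using G(3) cG gal by (auto simp: transitive_deck_maps_def galois_covering_def)
  have cov_map: "covering_map ?T (polygon_topology n) p" using cov by (simp add: finite_unramified_covering_def)
  have haus: "Hausdorff_space ?T" and conn: "connected_space ?T" using RX by (simp_all add: riemann_surface_def)
  obtain x0 where x0: "x0 \<in> points X" using RX unfolding riemann_surface_def by blast
  \<comment> \<open>A deck transformation is determined by its value at \<open>x0\<close>, which
    lies in a finite fibre.\<close>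
  have "finite ?G"
  proof (rule inj_on_finite)
    show "inj_on (\<lambda>g. g x0) ?G"
    proof (rule inj_onI)
      fix g h assume gh: "g \<in> ?G" "h \<in> ?G" "g x0 = h x0"
      show "g = h"
      proof (rule extensionalityI)
        \<comment> \<open>Elements of \<open>Bij\<close> are \<open>undefined\<close> outside the
          surface, so agreement on its points gives equality of functions.\<close>
        show "g \<in> extensional (points X)" "h \<in> extensional (points X)" using G(1) gh by (auto simp: Bij_def)
        show "g x = h x" if "x \<in> points X" for x
          using covering_map_lift_unique[OF cov_map haus conn cG[OF gh(1)] cG[OF gh(2)] _ x0 gh(3) that]
            G(3)[OF gh(1)] G(3)[OF gh(2)] by simp
      qed
    qed
    show "(\<lambda>g. g x0) ` ?G \<subseteq> {x \<in> points X. p x = p x0}"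
      using G(3)[OF _ x0] cG x0 by (auto simp: continuous_map_def)
    have "p x0 \<in> points (polygon_surface n)" using cov_map x0 by (auto simp: covering_map_def)
    then show "finite {x \<in> points X. p x = p x0}" using cov by (simp add: finite_unramified_covering_def)
  qed
  then interpret polygon_covering n X p ?G
    using n RX cov deck by unfold_locales
  show ?thesis using calculation_stops unfolding pulled_back_qdiff_def polygon_qdiff_def .
qed

end
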